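(* Let $M\ge 1$ be an integer, $\kappa_0,\kappa_1\in[0,1]$ and $N_0,N_1\ge 0$. Let $|\psi\rangle_{IS}=\sum_{\mathbf n\ge\mathbf 0}\sqrt{p_{\mathbf n}}\,|\chi_{\mathbf n}\rangle_I|\mathbf n\rangle_S$ be a pure state with $M$ signal modes $S$ and an arbitrary idler system $I$, where $|\mathbf n\rangle_S=|n_1\rangle\cdots|n_M\rangle$ are $M$-mode number states, $\{|\chi_{\mathbf n}\rangle_I\}$ are normalized (not necessarily orthogonal) states of $I$, and $\{p_{\mathbf n}\}$ is a probability distribution. Put $\Psi=|\psi\rangle\langle\psi|_{IS}$ and $p_n=\sum_{\mathbf n:\,n_1+\cdots+n_M=n}p_{\mathbf n}$. Let $$\tau_b=\bigl(\mathrm{id}_I\otimes\mathcal L_{\kappa_b,N_b}^{\otimes M}\bigr)(\Psi),\qquad b\in\{0,1\}.$$ With $G_b=(1-\kappa_b)N_b+1$, $\tilde\kappa_b=\kappa_b/G_b$ and $\nu=\bigl(\sqrt{G_0G_1}-\sqrt{(G_0-1)(G_1-1)}\bigr)^{-1}$, the fidelity satisfies $$\mathcal F(\tau_0,\tau_1)\;\ge\;\nu^M\sum_{n=0}^\infty p_n\Bigl[\nu\sqrt{\tilde\kappa_0\tilde\kappa_1}+\sqrt{(1-\tilde\kappa_0)(1-\tilde\kappa_1)}\Bigr]^n .$$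
   Context: Fidelity is the square-root (Uhlmann) fidelity $\mathcal F(\rho,\sigma)=\mathrm{Tr}\sqrt{\sqrt{\rho}\,\sigma\sqrt{\rho}}$. $\mathcal L_{\kappa,N}$ denotes the single-mode bosonic thermal loss channel with transmittance $\kappa\in[0,1]$ and excess noise $N\ge0$: the input mode $\hat a_{in}$ is mixed on a beam splitter with an environment mode $\hat a_{th}$ in the thermal state $\rho_{\rm th}(N)=\sum_{n\ge0}\frac{N^n}{(N+1)^{n+1}}|n\rangle\langle n|$, the output mode being $\hat a_{out}=\sqrt{\kappa}\,\hat a_{in}+\sqrt{1-\kappa}\,\hat a_{th}$, and the other output is traced out. *)

theory Defs
  imports "HOL-Analysis.Analysis"
begin

section \<open>Operators on Hilbert spaces with a chosen orthonormal basis\<close>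

text \<open>
  A complex Hilbert space is represented as the space of square-summable functions
  \<^typ>\<open>'a \<Rightarrow> complex\<close> on an index type \<^typ>\<open>'a\<close> of an orthonormal basis (every Hilbert space is of
  this form, separable or not), and an operator by its matrix in that basis.  The tensor product
  of two such spaces has index type \<^typ>\<open>'a \<times> 'b\<close>.  All operators below to which a definition is
  applied are bounded, and all infinite sums converge absolutely.
\<close>

type_synonym 'a vec = "'a \<Rightarrow> complex"
type_synonym 'a matrix = "'a \<Rightarrow> 'a \<Rightarrow> complex"

definition ket :: "'a \<Rightarrow> 'a vec" where
  "ket a = (\<lambda>x. if x = a then 1 else 0)"

definition unit_vec :: "'a vec \<Rightarrow> bool" where
  "unit_vec v \<longleftrightarrow> ((\<lambda>x. (cmod (v x))\<^sup>2) has_sum 1) UNIV"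

definition tensor_vec :: "'a vec \<Rightarrow> 'b vec \<Rightarrow> ('a \<times> 'b) vec" where
  "tensor_vec v w = (\<lambda>(a, b). v a * w b)"

definition outer :: "'a vec \<Rightarrow> 'a vec \<Rightarrow> 'a matrix" where
  "outer v w = (\<lambda>x y. v x * cnj (w y))"

definition op_times :: "'a matrix \<Rightarrow> 'a matrix \<Rightarrow> 'a matrix" where
  "op_times A B = (\<lambda>x y. \<Sum>\<^sub>\<infinity>z. A x z * B z y)"

definition adjoint_op :: "'a matrix \<Rightarrow> 'a matrix" where
  "adjoint_op A = (\<lambda>x y. cnj (A y x))"

definition op_trace :: "'a matrix \<Rightarrow> complex" where
  "op_trace A = (\<Sum>\<^sub>\<infinity>x. A x x)"

definition tensor_op :: "'a matrix \<Rightarrow> 'b matrix \<Rightarrow> ('a \<times> 'b) matrix" where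
  "tensor_op A B = (\<lambda>(a, b) (a', b'). A a a' * B b b')"

definition partial_trace_snd :: "('a \<times> 'b) matrix \<Rightarrow> 'a matrix" where
  "partial_trace_snd A = (\<lambda>a a'. \<Sum>\<^sub>\<infinity>b. A (a, b) (a', b))"

definition positive_op :: "'a matrix \<Rightarrow> bool" where
  "positive_op A \<longleftrightarrow>
     (\<forall>F v. finite F \<longrightarrow> (\<Sum>x\<in>F. \<Sum>y\<in>F. cnj (v x) * A x y * v y) \<in> \<real>\<^sub>\<ge>\<^sub>0)"

text \<open>
  The positive square root of a positive bounded operator.  As a positive matrix is Hermitian,
  the condition at \<open>x = y\<close> says that row \<open>x\<close> of \<open>S\<close> is square-summable with squared norm
  \<open>A x x\<close>.  Hence, for bounded \<open>A\<close>, the matrix \<open>S\<close> is that of a bounded operator, and it is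
  unique.
\<close>

definition op_sqrt :: "'a matrix \<Rightarrow> 'a matrix" where
  "op_sqrt A =
     (SOME S. positive_op S \<and> (\<forall>x y. ((\<lambda>z. S x z * S z y) has_sum A x y) UNIV))"

definition fidelity :: "'a matrix \<Rightarrow> 'a matrix \<Rightarrow> real" where
  "fidelity \<rho> \<sigma> =
     Re (op_trace (op_sqrt (op_times (op_times (op_sqrt \<rho>) \<sigma>) (op_sqrt \<rho>))))"


section \<open>The beam splitter\<close>

text \<open>
  Ladder operators of two modes, acting on vectors in the number basis.  The first mode is the
  signal, the second one the environment.
\<close>

definition create1 :: "(nat \<times> nat) vec \<Rightarrow> (nat \<times> nat) vec" where
  "create1 f = (\<lambda>(p, q). complex_of_real (sqrt (real p)) * f (p - 1, q))"

definition create2 :: "(nat \<times> nat) vec \<Rightarrow> (nat \<times> nat) vec" where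
  "create2 f = (\<lambda>(p, q). complex_of_real (sqrt (real q)) * f (p, q - 1))"

definition annih1 :: "(nat \<times> nat) vec \<Rightarrow> (nat \<times> nat) vec" where
  "annih1 f = (\<lambda>(p, q). complex_of_real (sqrt (real (p + 1))) * f (p + 1, q))"

definition annih2 :: "(nat \<times> nat) vec \<Rightarrow> (nat \<times> nat) vec" where
  "annih2 f = (\<lambda>(p, q). complex_of_real (sqrt (real (q + 1))) * f (p, q + 1))"

definition rot :: "real \<Rightarrow> real \<Rightarrow> (nat \<times> nat) vec \<Rightarrow> (nat \<times> nat) vec" where
  "rot c d f = (\<lambda>x. complex_of_real c * create1 f x + complex_of_real d * create2 f x)"

text \<open>
  The beam splitter unitary \<open>U\<close> fixes the vacuum and satisfies, in the Heisenberg picture,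
  \<open>U\<^sup>* a\<^sub>1 U = \<surd>\<kappa> a\<^sub>1 + \<surd>(1-\<kappa>) a\<^sub>2\<close> and
  \<open>U\<^sup>* a\<^sub>2 U = \<surd>\<kappa> a\<^sub>2 - \<surd>(1-\<kappa>) a\<^sub>1\<close>.
  Equivalently \<open>U a\<^sub>1\<^sup>* U\<^sup>* = \<surd>\<kappa> a\<^sub>1\<^sup>* - \<surd>(1-\<kappa>) a\<^sub>2\<^sup>*\<close> and
  \<open>U a\<^sub>2\<^sup>* U\<^sup>* = \<surd>(1-\<kappa>) a\<^sub>1\<^sup>* + \<surd>\<kappa> a\<^sub>2\<^sup>*\<close>,
  which determines the image of every number state \<open>|m, k\<rangle>\<close>.
  The Heisenberg relations are verified on number states below.
\<close>

definition bs_ket :: "real \<Rightarrow> nat \<times> nat \<Rightarrow> (nat \<times> nat) vec" where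
  "bs_ket \<kappa> = (\<lambda>(m, k) x. complex_of_real (1 / sqrt (fact m * fact k)) *
     (rot (sqrt \<kappa>) (- sqrt (1 - \<kappa>)) ^^ m)
       ((rot (sqrt (1 - \<kappa>)) (sqrt \<kappa>) ^^ k) (ket (0, 0))) x)"

definition beam_splitter :: "real \<Rightarrow> (nat \<times> nat) matrix" where
  "beam_splitter \<kappa> = (\<lambda>x y. bs_ket \<kappa> y x)"

lemma annih1_rot: "annih1 (rot c d f) = (\<lambda>x. rot c d (annih1 f) x + of_real c * f x)"
proof
  fix x :: "nat \<times> nat"
  obtain p q where x: "x = (p, q)" by force
  have s: "complex_of_real (sqrt (real n)) * complex_of_real (sqrt (real n)) = of_nat n" for n
    by (simp flip: of_real_mult)
  have s1: "complex_of_real (sqrt (1 + real n)) * complex_of_real (sqrt (1 + real n)) = 1 + of_nat n" for n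
    using s[of "Suc n"] by simp
  show "annih1 (rot c d f) x = rot c d (annih1 f) x + of_real c * f x"
  proof (cases p)
    case 0
    then show ?thesis unfolding x
      by (simp add: annih1_def rot_def create1_def create2_def algebra_simps)
  next
    case (Suc p')
    have e1: "complex_of_real (sqrt (2 + real p')) * complex_of_real (sqrt (2 + real p')) = 2 + of_nat p'"
      using s[of "Suc (Suc p')"] by simp
    have "complex_of_real (sqrt (2 + real p')) * (complex_of_real (sqrt (2 + real p')) * z)
        = (2 + of_nat p') * z" for z
      using e1 by (metis mult.assoc)
    moreover have "complex_of_real (sqrt (1 + real p')) * (complex_of_real (sqrt (1 + real p')) * z)
        = (1 + of_nat p') * z" for z
      using s1 by (metis mult.assoc)
    ultimately show ?thesis unfolding x Suc
      by (simp add: annih1_def rot_def create1_def create2_def algebra_simps)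
  qed
qed

definition swap_modes :: "(nat \<times> nat) vec \<Rightarrow> (nat \<times> nat) vec" where
  "swap_modes f = (\<lambda>(p, q). f (q, p))"

lemma annih2_rot: "annih2 (rot c d f) = (\<lambda>x. rot c d (annih2 f) x + of_real d * f x)"
proof -
  have a: "annih2 g = swap_modes (annih1 (swap_modes g))"
    and r: "rot c d g = swap_modes (rot d c (swap_modes g))"
    and s: "swap_modes (swap_modes g) = g" for c d g
    by (auto simp: annih1_def annih2_def rot_def create1_def create2_def swap_modes_def fun_eq_iff)
  show ?thesis
    unfolding a r[of c d] s annih1_rot by (auto simp: swap_modes_def fun_eq_iff)
qed

lemma rot_add: "rot c d (\<lambda>x. f x + g x) = (\<lambda>x. rot c d f x + rot c d g x)"
  and rot_scale: "rot c d (\<lambda>x. a * f x) = (\<lambda>x. a * rot c d f x)"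
  by (auto simp: rot_def create1_def create2_def fun_eq_iff algebra_simps)

lemma comm_rot_pow:
  assumes "\<And>f. D (rot c d f) = (\<lambda>x. rot c d (D f) x + a * f x)"
  shows "D ((rot c d ^^ m) g) =
    (\<lambda>x. (rot c d ^^ m) (D g) x + of_nat m * a * (rot c d ^^ (m - 1)) g x)"
proof (induction m)
  case (Suc m)
  have "rot c d ((rot c d ^^ (m - 1)) g) = (rot c d ^^ m) g" if "m \<noteq> 0"
    using that by (cases m) simp_all
  then have R: "of_nat m * a * rot c d ((rot c d ^^ (m - 1)) g) x = of_nat m * a * (rot c d ^^ m) g x" for x
    by (cases "m = 0") simp_all
  have "D ((rot c d ^^ Suc m) g) = (\<lambda>x. rot c d (D ((rot c d ^^ m) g)) x + a * (rot c d ^^ m) g x)"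
    by (simp add: assms)
  also have "rot c d (D ((rot c d ^^ m) g)) =
      (\<lambda>x. (rot c d ^^ Suc m) (D g) x + of_nat m * a * (rot c d ^^ m) g x)"
    unfolding Suc.IH rot_add rot_scale R by simp
  finally show ?case by (simp add: algebra_simps)
qed simp

lemma rot_pow_add: "(rot c d ^^ m) (\<lambda>x. f x + a * g x) =
    (\<lambda>x. (rot c d ^^ m) f x + a * (rot c d ^^ m) g x)"
  by (induction m) (simp_all add: rot_add rot_scale)

lemma comm_bs_ket:
  assumes D: "\<And>c d f. D (rot c d f) = (\<lambda>x. rot c d (D f) x + of_real (e c d) * f x)"
    and scale: "\<And>a f. D (\<lambda>x. a * f x) = (\<lambda>x. a * D f x)"
    and vac: "D (ket (0, 0)) = (\<lambda>x. 0)"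
  shows "D (bs_ket \<kappa> (m, k)) x =
      of_real (e (sqrt \<kappa>) (- sqrt (1 - \<kappa>)) * sqrt (real m)) * bs_ket \<kappa> (m - 1, k) x
    + of_real (e (sqrt (1 - \<kappa>)) (sqrt \<kappa>) * sqrt (real k)) * bs_ket \<kappa> (m, k - 1) x"
proof -
  define A where "A = rot (sqrt \<kappa>) (- sqrt (1 - \<kappa>))"
  define B where "B = rot (sqrt (1 - \<kappa>)) (sqrt \<kappa>)"
  define v where "v = ket (0::nat, 0::nat)"
  define \<alpha> where "\<alpha> = complex_of_real (e (sqrt \<kappa>) (- sqrt (1 - \<kappa>)))"
  define \<beta> where "\<beta> = complex_of_real (e (sqrt (1 - \<kappa>)) (sqrt \<kappa>))"
  have z: "(rot c d ^^ n) (\<lambda>x. 0) = (\<lambda>x. 0)" for c d n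
    by (induction n) (auto simp: rot_def create1_def create2_def)
  have B: "D ((B ^^ k) v) = (\<lambda>x. of_nat k * \<beta> * (B ^^ (k - 1)) v x)"
    unfolding B_def v_def \<beta>_def by (subst comm_rot_pow[OF D]) (simp add: vac z)
  have "D ((A ^^ m) ((B ^^ k) v)) = (\<lambda>x. (A ^^ m) (D ((B ^^ k) v)) x
      + of_nat m * \<alpha> * (A ^^ (m - 1)) ((B ^^ k) v) x)"
    unfolding A_def \<alpha>_def by (rule comm_rot_pow[OF D])
  also have "(A ^^ m) (D ((B ^^ k) v)) = (\<lambda>x. of_nat k * \<beta> * (A ^^ m) ((B ^^ (k - 1)) v) x)"
    using rot_pow_add[of m "sqrt \<kappa>" "- sqrt (1 - \<kappa>)" "\<lambda>x. 0" "of_nat k * \<beta>" "(B ^^ (k - 1)) v"]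
    unfolding B A_def z by simp
  finally have main: "D ((A ^^ m) ((B ^^ k) v)) x = of_nat k * \<beta> * (A ^^ m) ((B ^^ (k - 1)) v) x
      + of_nat m * \<alpha> * (A ^^ (m - 1)) ((B ^^ k) v) x" by simp
  have f: "1 / sqrt (fact n * c) * real n = sqrt (real n) * (1 / sqrt (fact (n - 1) * c))"
    for n :: nat and c :: real
  proof (cases n)
    case (Suc j)
    have "real n / sqrt (real n) = sqrt (real n)" by (simp add: real_div_sqrt)
    then show ?thesis by (simp add: Suc real_sqrt_mult divide_simps del: of_nat_Suc)
  qed simp
  have f': "complex_of_real (1 / sqrt (fact n * c)) * of_nat n
      = of_real (sqrt (real n)) * of_real (1 / sqrt (fact (n - 1) * c))" for n c
    using arg_cong[OF f[of n c], of complex_of_real] unfolding of_real_mult by simp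
  have "D (bs_ket \<kappa> (m, k)) x
      = of_real (1 / sqrt (fact m * fact k)) * D ((A ^^ m) ((B ^^ k) v)) x"
    unfolding bs_ket_def A_def B_def v_def prod.case scale ..
  also have "\<dots> = (of_real (1 / sqrt (fact k * fact m)) * of_nat k) * \<beta> * (A ^^ m) ((B ^^ (k - 1)) v) x
      + (of_real (1 / sqrt (fact m * fact k)) * of_nat m) * \<alpha> * (A ^^ (m - 1)) ((B ^^ k) v) x"
    unfolding main by (simp add: algebra_simps)
  also have "\<dots> = \<alpha> * of_real (sqrt (real m)) * bs_ket \<kappa> (m - 1, k) x
      + \<beta> * of_real (sqrt (real k)) * bs_ket \<kappa> (m, k - 1) x"
    unfolding f' bs_ket_def A_def B_def v_def prod.case by (simp add: algebra_simps)
  finally show ?thesis unfolding \<alpha>_def \<beta>_def by simp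
qed

lemma beam_splitter_heisenberg_signal:
  "annih1 (bs_ket \<kappa> (m, k)) x =
      of_real (sqrt \<kappa> * sqrt (real m)) * bs_ket \<kappa> (m - 1, k) x
    + of_real (sqrt (1 - \<kappa>) * sqrt (real k)) * bs_ket \<kappa> (m, k - 1) x"
  by (rule comm_bs_ket[where e = "\<lambda>c d. c", OF annih1_rot])
     (auto simp: annih1_def ket_def fun_eq_iff)

lemma beam_splitter_heisenberg_environment:
  "annih2 (bs_ket \<kappa> (m, k)) x =
      of_real (- sqrt (1 - \<kappa>) * sqrt (real m)) * bs_ket \<kappa> (m - 1, k) x
    + of_real (sqrt \<kappa> * sqrt (real k)) * bs_ket \<kappa> (m, k - 1) x"
  by (rule comm_bs_ket[where e = "\<lambda>c d. d", OF annih2_rot])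
     (auto simp: annih2_def ket_def fun_eq_iff)


section \<open>The thermal loss channel and its tensor powers\<close>

definition thermal_state :: "real \<Rightarrow> nat matrix" where
  "thermal_state N =
     (\<lambda>x y. \<Sum>\<^sub>\<infinity>n. complex_of_real (N ^ n / (N + 1) ^ (n + 1)) * outer (ket n) (ket n) x y)"

definition thermal_loss :: "real \<Rightarrow> real \<Rightarrow> nat matrix \<Rightarrow> nat matrix" where
  "thermal_loss \<kappa> N \<rho> = partial_trace_snd
     (op_times (op_times (beam_splitter \<kappa>) (tensor_op \<rho> (thermal_state N)))
       (adjoint_op (beam_splitter \<kappa>)))"

text \<open>
  The number basis of \<open>M\<close> modes is indexed by \<^typ>\<open>'m \<Rightarrow> nat\<close>, where \<^typ>\<open>'m\<close> is a finite type with
  \<open>M\<close> elements.  The \<open>M\<close>-fold tensor power of a map is the linear extension of its action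
  \<open>\<Otimes>\<^sub>k |a\<^sub>k\<rangle>\<langle>b\<^sub>k| \<mapsto> \<Otimes>\<^sub>k \<Phi>(|a\<^sub>k\<rangle>\<langle>b\<^sub>k|)\<close>
  on matrix units.  For a thermal loss channel and a trace class \<open>\<rho>\<close> the sum converges absolutely,
  since \<open>\<Phi>(|a\<rangle>\<langle>b|)\<close> has entries of modulus at most 1, and its \<open>(x, y)\<close> entry vanishes
  unless \<open>a - b = x - y\<close>.
\<close>

definition tensor_power_map ::
    "(nat matrix \<Rightarrow> nat matrix) \<Rightarrow> ('m::finite \<Rightarrow> nat) matrix \<Rightarrow> ('m \<Rightarrow> nat) matrix" where
  "tensor_power_map \<Phi> \<rho> =
     (\<lambda>x y. \<Sum>\<^sub>\<infinity>(a, b). \<rho> a b * (\<Prod>k\<in>UNIV. \<Phi> (outer (ket (a k)) (ket (b k))) (x k) (y k)))"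

text \<open>
  In block form \<open>\<rho> = \<Sum>\<^sub>i\<^sub>j |i\<rangle>\<langle>j| \<otimes> \<rho>\<^sub>i\<^sub>j\<close>, the map \<open>id \<otimes> \<Phi>\<close> acts as
  \<open>\<Phi>\<close> on every block.
\<close>

definition id_tensor_map ::
    "('s matrix \<Rightarrow> 't matrix) \<Rightarrow> ('i \<times> 's) matrix \<Rightarrow> ('i \<times> 't) matrix" where
  "id_tensor_map \<Phi> \<rho> = (\<lambda>(i, x) (j, y). \<Phi> (\<lambda>a b. \<rho> (i, a) (j, b)) x y)"


section \<open>The input state\<close>

definition input_vec ::
    "(('m::finite \<Rightarrow> nat) \<Rightarrow> real) \<Rightarrow> (('m \<Rightarrow> nat) \<Rightarrow> 'i vec) \<Rightarrow> ('i \<times> ('m \<Rightarrow> nat)) vec" where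
  "input_vec p \<phi> =
     (\<lambda>x. \<Sum>\<^sub>\<infinity>n. complex_of_real (sqrt (p n)) * tensor_vec (\<phi> n) (ket n) x)"

definition total_number_prob :: "(('m::finite \<Rightarrow> nat) \<Rightarrow> real) \<Rightarrow> nat \<Rightarrow> real" where
  "total_number_prob p n = (\<Sum>a | (\<Sum>k\<in>UNIV. a k) = n. p a)"

lemma finite_total_number: "finite {a :: 'm::finite \<Rightarrow> nat. (\<Sum>k\<in>UNIV. a k) = n}"
proof (rule finite_subset)
  show "{a :: 'm \<Rightarrow> nat. (\<Sum>k\<in>UNIV. a k) = n} \<subseteq> PiE UNIV (\<lambda>_. {..n})"
    by (auto intro: member_le_sum)
qed (simp add: finite_PiE)

end

theory Submission
  imports Defs
begin

text \<open>
  The thermal loss channel is a pure loss channel of transmittance \<open>\<kappa>\<^sub>t = \<kappa> / G\<close> followed by a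
  quantum-limited amplifier of gain \<open>G\<close>.  Keeping the number of lost and of created photons of every
  mode as environment, one obtains purifications of both outputs with a common environment.  As their
  Kraus operators map number states to number states, the overlap of the purifications is
  \<open>\<Sum>\<^sub>a p\<^sub>a \<Prod>\<^sub>j \<Sum>\<^sub>l\<^sub>k \<langle>a\<^sub>j| L\<^sub>l\<^sup>* A\<^sub>k\<^sup>* A'\<^sub>k L'\<^sub>l |a\<^sub>j\<rangle>\<close> whatever the idler states are, and the inner sum is evaluated by
  the negative binomial and the binomial theorem.  By Uhlmann's theorem the overlap is a lower bound for the fidelity.

  The decomposition of the channel is proved by showing that both sides obey the same recurrence in
  the input photon numbers.  Uhlmann's bound is derived from eigenbases of the two square roots in
  the definition of the fidelity; they exist because the quadratic form of a positive
  Hilbert--Schmidt matrix attains its maximum on the weakly compact unit ball.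
\<close>


section \<open>Square-summable vectors\<close>

text \<open>\<open>op_sqrt\<close> is a choice and a divergent infinite sum has the value 0, so the
  fidelity cannot be read off its formula. Both roots enter only through positivity and their
  squares, and the trace of the outer root must be shown to converge before it can be bounded below.
  The idler basis is arbitrary, possibly uncountable; hence limits run over finite subsets, and
  eigenbases come from Zorn's lemma instead of a sequence of eigenvalues. The beam splitter
  amplitudes of general number states are alternating sums. Loss followed by amplification replaces
  them by Kraus entries that are single products, and the recurrence leaves only the vacuum input to
  be evaluated. The constant \<open>\<nu>\<close> is the overlap of the two amplifiers on the
  vacuum: with \<open>H = sqrt (G0 * G1)\<close> and \<open>g = sqrt ((G0 - 1) * (G1 - 1))\<close>,
  having created \<open>k\<close> photons contributes \<open>(g / H) ^ k / H\<close>, and this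
  geometric series sums to \<open>1 / (H - g)\<close>. On \<open>m\<close> photons the overlap is
  \<open>\<nu> ^ (m + 1)\<close>: one factor per mode and one per photon that survives the
  loss.\<close>

definition l2 :: "'a vec \<Rightarrow> bool" where
  "l2 v \<longleftrightarrow> (\<lambda>x. (cmod (v x))\<^sup>2) summable_on UNIV"

definition nrm2 :: "'a vec \<Rightarrow> real" where
  "nrm2 v = (\<Sum>\<^sub>\<infinity>x. (cmod (v x))\<^sup>2)"

definition ip :: "'a vec \<Rightarrow> 'a vec \<Rightarrow> complex" where
  "ip u v = (\<Sum>\<^sub>\<infinity>x. cnj (u x) * v x)"

text \<open>Families rather than sets: an eigenbasis is a set indexed by itself, and its normalised
  images under another operator keep the same index.\<close>

definition orthonormal :: "'i set \<Rightarrow> ('i \<Rightarrow> 'a vec) \<Rightarrow> bool" where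
  "orthonormal I w \<longleftrightarrow> (\<forall>i\<in>I. l2 (w i)) \<and> (\<forall>i\<in>I. \<forall>j\<in>I. ip (w i) (w j) = (if i = j then 1 else 0))"

lemma orthonormal_subset: "orthonormal I w \<Longrightarrow> J \<subseteq> I \<Longrightarrow> orthonormal J w"
  by (simp add: orthonormal_def subset_iff)

lemma l2_mult_abs_summable:
  assumes "l2 u" "l2 v" shows "(\<lambda>x. norm (u x * v x)) summable_on UNIV"
  by (rule abs_summable_product) (use assms in \<open>simp_all add: l2_def norm_mult power2_eq_square\<close>)

lemma l2_mult_summable: "l2 u \<Longrightarrow> l2 v \<Longrightarrow> (\<lambda>x. u x * v x) summable_on UNIV"
  by (rule abs_summable_summable[OF l2_mult_abs_summable])

lemma l2_cnj [simp]: "l2 (\<lambda>x. cnj (v x)) \<longleftrightarrow> l2 v"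
  by (simp add: l2_def)

lemma nrm2_cnj [simp]: "nrm2 (\<lambda>x. cnj (v x)) = nrm2 v"
  by (simp add: nrm2_def)

lemma l2_scale: "l2 v \<Longrightarrow> l2 (\<lambda>x. c * v x)"
  by (simp add: l2_def norm_mult power_mult_distrib summable_on_cmult_right)

lemma nrm2_scale: "nrm2 (\<lambda>x. c * v x) = (cmod c)\<^sup>2 * nrm2 v"
  by (simp add: nrm2_def norm_mult power_mult_distrib infsum_cmult_right')

lemma l2_mono: "l2 v \<Longrightarrow> (\<And>x. cmod (u x) \<le> cmod (v x)) \<Longrightarrow> l2 u"
  unfolding l2_def by (erule summable_on_comparison_test) (auto intro: power_mono)

lemma l2_add:
  assumes "l2 u" "l2 v" shows "l2 (\<lambda>x. u x + v x)"
proof -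
  have "(\<lambda>x. 2 * (cmod (u x))\<^sup>2 + 2 * (cmod (v x))\<^sup>2) summable_on UNIV"
    using assms unfolding l2_def by (intro summable_on_add summable_on_cmult_right)
  moreover have "(cmod (u x + v x))\<^sup>2 \<le> 2 * (cmod (u x))\<^sup>2 + 2 * (cmod (v x))\<^sup>2" for x
  proof -
    have "(cmod (u x + v x))\<^sup>2 \<le> (cmod (u x) + cmod (v x))\<^sup>2"
      by (simp add: norm_triangle_ineq power_mono)
    also have "\<dots> \<le> 2 * (cmod (u x))\<^sup>2 + 2 * (cmod (v x))\<^sup>2"
      using sum_squares_ge_zero[of "cmod (u x) - cmod (v x)" 0] by (simp add: power2_eq_square algebra_simps)
    finally show ?thesis .
  qed
  ultimately show ?thesis
    unfolding l2_def by (rule summable_on_comparison_test) auto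
qed

lemma l2_diff: "l2 u \<Longrightarrow> l2 v \<Longrightarrow> l2 (\<lambda>x. u x - v x)"
  using l2_add[of u "\<lambda>x. -1 * v x"] l2_scale[of v "-1"] by simp

lemma l2_zero [simp]: "l2 (\<lambda>x. 0)"
  by (simp add: l2_def)

lemma l2_sum: "(\<And>i. i \<in> I \<Longrightarrow> l2 (w i)) \<Longrightarrow> l2 (\<lambda>x. \<Sum>i\<in>I. w i x)"
  by (induction I rule: infinite_finite_induct) (auto intro: l2_add)

lemma l2_ket [simp]: "l2 (ket a)"
  unfolding l2_def
  by (rule finite_nonzero_values_imp_summable_on) (auto simp: ket_def intro: finite_subset[of _ "{a}"])

lemma nrm2_ket [simp]: "nrm2 (ket a) = 1"
proof -
  have "((\<lambda>x. (cmod (ket a x))\<^sup>2) has_sum 1) UNIV"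
    by (rule has_sum_finite_neutralI[of "{a}"]) (auto simp: ket_def)
  then show ?thesis unfolding nrm2_def by (rule infsumI)
qed

lemma nrm2_nonneg [simp]: "0 \<le> nrm2 v"
  by (simp add: nrm2_def infsum_nonneg)

lemma nrm2_has_sum: "l2 v \<Longrightarrow> ((\<lambda>x. (cmod (v x))\<^sup>2) has_sum nrm2 v) UNIV"
  by (simp add: l2_def nrm2_def)

lemma l2_finite_bound:
  assumes "\<And>F. finite F \<Longrightarrow> (\<Sum>x\<in>F. (cmod (v x))\<^sup>2) \<le> C"
  shows "l2 v" "nrm2 v \<le> C"
proof -
  show s: "l2 v" unfolding l2_def
    by (rule nonneg_bdd_above_summable_on) (auto intro!: bdd_aboveI[of _ C] assms)
  show "nrm2 v \<le> C" using s unfolding l2_def nrm2_def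
    by (rule infsum_le_finite_sums) (auto intro: assms)
qed

lemma nrm2_finite_le: "l2 v \<Longrightarrow> finite F \<Longrightarrow> (\<Sum>x\<in>F. (cmod (v x))\<^sup>2) \<le> nrm2 v"
  unfolding l2_def nrm2_def by (rule finite_sum_le_infsum) auto

lemma nrm2_eq_0: "l2 v \<Longrightarrow> nrm2 v = 0 \<Longrightarrow> v x = 0"
  using nrm2_finite_le[of v "{x}"] by simp

lemma ip_has_sum: "l2 u \<Longrightarrow> l2 v \<Longrightarrow> ((\<lambda>x. cnj (u x) * v x) has_sum ip u v) UNIV"
  unfolding ip_def by (intro has_sum_infsum l2_mult_summable) simp_all

lemma ip_cnj: "cnj (ip u v) = ip v u"
  unfolding ip_def by (simp flip: infsum_cnj add: mult.commute)

lemma ip_add_right: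
  "l2 u \<Longrightarrow> l2 v \<Longrightarrow> l2 w \<Longrightarrow> ip u (\<lambda>x. v x + w x) = ip u v + ip u w"
  unfolding ip_def by (subst infsum_add[symmetric]) (auto simp: algebra_simps intro!: l2_mult_summable)

lemma ip_scale_right: "ip u (\<lambda>x. c * v x) = c * ip u v"
  unfolding ip_def by (simp flip: infsum_cmult_right' add: algebra_simps)

lemma ip_scale_left: "ip (\<lambda>x. c * u x) v = cnj c * ip u v"
  using ip_scale_right[of v c u] ip_cnj by (metis complex_cnj_mult)

lemma ip_diff_right:
  "l2 u \<Longrightarrow> l2 v \<Longrightarrow> l2 w \<Longrightarrow> ip u (\<lambda>x. v x - w x) = ip u v - ip u w"
  using ip_add_right[of u v "\<lambda>x. -1 * w x"] ip_scale_right[of u "-1" w] l2_scale[of w "-1"] by simp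

lemma ip_add_left:
  "l2 u \<Longrightarrow> l2 v \<Longrightarrow> l2 w \<Longrightarrow> ip (\<lambda>x. v x + w x) u = ip v u + ip w u"
  using ip_add_right[of u v w] ip_cnj by (metis complex_cnj_add)

lemma ip_diff_left:
  "l2 u \<Longrightarrow> l2 v \<Longrightarrow> l2 w \<Longrightarrow> ip (\<lambda>x. v x - w x) u = ip v u - ip w u"
  using ip_diff_right[of u v w] ip_cnj by (metis complex_cnj_diff)

lemma ip_zero_right [simp]: "ip u (\<lambda>x. 0) = 0"
  by (simp add: ip_def)

lemma ip_sum_right:
  "l2 u \<Longrightarrow> (\<And>i. i \<in> I \<Longrightarrow> l2 (w i)) \<Longrightarrow> ip u (\<lambda>x. \<Sum>i\<in>I. w i x) = (\<Sum>i\<in>I. ip u (w i))"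
proof (induction I rule: infinite_finite_induct)
  case (insert i I)
  then show ?case by (simp add: ip_add_right l2_sum)
qed auto

lemma ip_sum_left:
  "l2 u \<Longrightarrow> (\<And>i. i \<in> I \<Longrightarrow> l2 (w i)) \<Longrightarrow> ip (\<lambda>x. \<Sum>i\<in>I. w i x) u = (\<Sum>i\<in>I. ip (w i) u)"
  using ip_sum_right[of u I w] ip_cnj by (metis (no_types, lifting) cnj_sum sum.cong)

lemma ip_self: "ip v v = of_real (nrm2 v)"
proof -
  have e: "cnj (v x) * v x = of_real ((cmod (v x))\<^sup>2)" for x
    by (simp add: complex_norm_square mult.commute del: of_real_power)
  show ?thesis
  proof (cases "l2 v")
    case True
    then show ?thesis unfolding ip_def e
      by (intro infsumI) (simp only: has_sum_of_real_iff nrm2_has_sum)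
  next
    \<comment> \<open>Outside \<open>l2\<close> both sums diverge, so both sides take the default
      value 0.\<close>
    case False
    then have "\<not> (\<lambda>x. complex_of_real ((cmod (v x))\<^sup>2)) summable_on UNIV"
      using summable_on_Re by (fastforce simp: l2_def)
    moreover have "\<not> (\<lambda>x. (cmod (v x))\<^sup>2) summable_on UNIV"
      using False by (simp add: l2_def)
    ultimately show ?thesis
      unfolding ip_def e nrm2_def by (metis infsum_not_exists of_real_0)
  qed
qed

lemma ip_ket_left [simp]: "ip (ket a) v = v a"
proof -
  have "((\<lambda>x. cnj (ket a x) * v x) has_sum v a) UNIV"
    by (rule has_sum_finite_neutralI[of "{a}"]) (auto simp: ket_def)
  then show ?thesis unfolding ip_def by (rule infsumI)
qed

lemma ip_ket_right [simp]: "ip v (ket a) = cnj (v a)"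
  by (metis ip_cnj ip_ket_left)

lemma nrm2_diff:
  assumes "l2 u" "l2 v"
  shows "nrm2 (\<lambda>x. u x - v x) = nrm2 u + nrm2 v - 2 * Re (ip v u)"
proof -
  have "complex_of_real (nrm2 (\<lambda>x. u x - v x)) = ip u u + ip v v - (ip v u + cnj (ip v u))"
    using assms by (simp add: ip_self[symmetric] ip_diff_right ip_diff_left l2_diff ip_cnj)
  also have "\<dots> = of_real (nrm2 u + nrm2 v - 2 * Re (ip v u))"
    by (simp add: ip_self complex_add_cnj)
  finally show ?thesis by (simp only: of_real_eq_iff)
qed

section \<open>Orthonormal families: Bessel, expansions, Parseval\<close>

lemma nrm2_orthonormal_sum:
  assumes "orthonormal I w" "finite I"
  shows "nrm2 (\<lambda>x. \<Sum>i\<in>I. c i * w i x) = (\<Sum>i\<in>I. (cmod (c i))\<^sup>2)"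
proof -
  have l: "l2 (w i)" "l2 (\<lambda>x. c i * w i x)" if "i \<in> I" for i
    using assms that by (auto simp: orthonormal_def intro: l2_scale)
  have "complex_of_real (nrm2 (\<lambda>x. \<Sum>i\<in>I. c i * w i x)) = (\<Sum>i\<in>I. \<Sum>j\<in>I. cnj (c i) * (c j * ip (w i) (w j)))"
    unfolding ip_self[symmetric] using l
    by (simp add: ip_sum_left ip_sum_right l2_sum ip_scale_left ip_scale_right sum_distrib_left)
  also have "\<dots> = (\<Sum>i\<in>I. \<Sum>j\<in>I. if i = j then cnj (c i) * c i else 0)"
    using assms by (intro sum.cong) (auto simp: orthonormal_def)
  also have "\<dots> = of_real (\<Sum>i\<in>I. (cmod (c i))\<^sup>2)"
    using assms(2) by (simp add: complex_norm_square mult.commute del: of_real_power)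
  finally show ?thesis by (simp only: of_real_eq_iff)
qed

lemma bessel_finite:
  assumes "orthonormal I w" "finite I" "l2 v"
  shows "(\<Sum>i\<in>I. (cmod (ip (w i) v))\<^sup>2) \<le> nrm2 v"
proof -
  define c where "c i = ip (w i) v" for i
  have l: "l2 (w i)" "l2 (\<lambda>x. c i * w i x)" if "i \<in> I" for i
    using assms that by (auto simp: orthonormal_def intro: l2_scale)
  have "ip (\<lambda>x. \<Sum>i\<in>I. c i * w i x) v = (\<Sum>i\<in>I. cnj (c i) * c i)"
    using l assms(3) by (simp add: ip_sum_left ip_scale_left c_def)
  also have "\<dots> = of_real (\<Sum>i\<in>I. (cmod (c i))\<^sup>2)"
    by (simp add: complex_norm_square mult.commute del: of_real_power)
  finally have e: "ip (\<lambda>x. \<Sum>i\<in>I. c i * w i x) v = of_real (\<Sum>i\<in>I. (cmod (c i))\<^sup>2)" .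
  have "0 \<le> nrm2 (\<lambda>x. v x - (\<Sum>i\<in>I. c i * w i x))" by simp
  also have "\<dots> = nrm2 v - (\<Sum>i\<in>I. (cmod (c i))\<^sup>2)"
    using l assms by (subst nrm2_diff) (auto intro!: l2_sum simp: e nrm2_orthonormal_sum)
  finally show ?thesis by (simp add: c_def)
qed

lemma bessel:
  assumes "orthonormal I w" "l2 v"
  shows "(\<lambda>i. (cmod (ip (w i) v))\<^sup>2) summable_on I" "(\<Sum>\<^sub>\<infinity>i\<in>I. (cmod (ip (w i) v))\<^sup>2) \<le> nrm2 v"
proof -
  have b: "(\<Sum>i\<in>F. (cmod (ip (w i) v))\<^sup>2) \<le> nrm2 v" if "finite F" "F \<subseteq> I" for F
    using assms that by (intro bessel_finite) (auto intro: orthonormal_subset)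
  show s: "(\<lambda>i. (cmod (ip (w i) v))\<^sup>2) summable_on I"
    by (rule nonneg_bdd_above_summable_on) (auto intro!: bdd_aboveI[of _ "nrm2 v"] b)
  show "(\<Sum>\<^sub>\<infinity>i\<in>I. (cmod (ip (w i) v))\<^sup>2) \<le> nrm2 v"
    using s by (rule infsum_le_finite_sums) (auto intro: b)
qed

lemma cauchy_schwarz:
  assumes "l2 u" "l2 v"
  shows "(cmod (ip u v))\<^sup>2 \<le> nrm2 u * nrm2 v"
proof (cases "nrm2 u = 0")
  case True
  then have "u = (\<lambda>x. 0)" using nrm2_eq_0[OF assms(1)] by auto
  then show ?thesis by (simp add: ip_def)
next
  case False
  then have p: "nrm2 u > 0" by (simp add: less_le)
  define a where "a = complex_of_real (1 / sqrt (nrm2 u))"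
  have "(cmod a)\<^sup>2 * nrm2 u = 1" using p by (simp add: a_def power_divide norm_divide)
  \<comment> \<open>Cauchy-Schwarz is Bessel's inequality for the one-member family obtained by
    normalising \<open>u\<close>.\<close>
  then have "orthonormal {()} (\<lambda>_ x. a * u x)"
    using assms by (auto simp: orthonormal_def l2_scale ip_self nrm2_scale)
  from bessel_finite[OF this _ assms(2)] have "(cmod (ip (\<lambda>x. a * u x) v))\<^sup>2 \<le> nrm2 v" by simp
  then have "(cmod (ip u v))\<^sup>2 / nrm2 u \<le> nrm2 v"
    using p unfolding ip_scale_left by (simp add: norm_mult power_mult_distrib a_def norm_divide power_divide)
  then show ?thesis using p by (simp add: field_simps)
qed

lemma cauchy_schwarz_sqrt:
  assumes "l2 u" "l2 v"
  shows "cmod (ip u v) \<le> sqrt (nrm2 u) * sqrt (nrm2 v)"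
  using cauchy_schwarz[OF assms] by (simp add: real_le_rsqrt flip: real_sqrt_mult)

lemma orthonormal_expansion_bound:
  assumes on: "orthonormal I w" and c: "(\<lambda>i. (cmod (c i))\<^sup>2) summable_on I"
  shows "(\<lambda>i. c i * w i x) summable_on I"
    and "l2 (\<lambda>x. \<Sum>\<^sub>\<infinity>i\<in>I. c i * w i x)"
    and "nrm2 (\<lambda>x. \<Sum>\<^sub>\<infinity>i\<in>I. c i * w i x) \<le> (\<Sum>\<^sub>\<infinity>i\<in>I. (cmod (c i))\<^sup>2)"
proof -
  have s: "(\<lambda>i. c i * w i x) summable_on I" for x
  proof (rule abs_summable_summable, rule abs_summable_product)
    show "(\<lambda>i. norm (c i * c i)) summable_on I" using c by (simp add: norm_mult power2_eq_square)
    \<comment> \<open>Bessel's inequality for \<open>ket x\<close>, whose coefficients are the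
      entries \<open>w i x\<close> up to conjugation.\<close>
    show "(\<lambda>i. norm (w i x * w i x)) summable_on I"
      using bessel(1)[OF on l2_ket[of x]] by (simp add: norm_mult power2_eq_square)
  qed
  then show "(\<lambda>i. c i * w i x) summable_on I" .
  \<comment> \<open>On finitely many coordinates the square sum passes to the limit over finite
    \<open>J\<close>, and each partial sum is already controlled by
    \<open>nrm2_orthonormal_sum\<close>.\<close>
  have b: "(\<Sum>x\<in>F. (cmod (\<Sum>\<^sub>\<infinity>i\<in>I. c i * w i x))\<^sup>2) \<le> (\<Sum>\<^sub>\<infinity>i\<in>I. (cmod (c i))\<^sup>2)" if "finite F" for F
  proof (rule tendsto_upperbound)
    show "((\<lambda>J. \<Sum>x\<in>F. (cmod (\<Sum>i\<in>J. c i * w i x))\<^sup>2) \<longlongrightarrow>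
       (\<Sum>x\<in>F. (cmod (\<Sum>\<^sub>\<infinity>i\<in>I. c i * w i x))\<^sup>2)) (finite_subsets_at_top I)"
      by (intro tendsto_intros infsum_tendsto s)
    show "\<forall>\<^sub>F J in finite_subsets_at_top I. (\<Sum>x\<in>F. (cmod (\<Sum>i\<in>J. c i * w i x))\<^sup>2) \<le> (\<Sum>\<^sub>\<infinity>i\<in>I. (cmod (c i))\<^sup>2)"
    proof (rule eventually_finite_subsets_at_top_weakI)
      fix J assume J: "finite J" "J \<subseteq> I"
      then have on': "orthonormal J w" using on by (blast intro: orthonormal_subset)
      have "(\<Sum>x\<in>F. (cmod (\<Sum>i\<in>J. c i * w i x))\<^sup>2) \<le> nrm2 (\<lambda>x. \<Sum>i\<in>J. c i * w i x)"
        using on' that by (intro nrm2_finite_le l2_sum l2_scale) (auto simp: orthonormal_def)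
      also have "\<dots> = (\<Sum>i\<in>J. (cmod (c i))\<^sup>2)" using on' J(1) by (rule nrm2_orthonormal_sum)
      also have "\<dots> \<le> (\<Sum>\<^sub>\<infinity>i\<in>I. (cmod (c i))\<^sup>2)" using c J by (intro finite_sum_le_infsum) auto
      finally show "(\<Sum>x\<in>F. (cmod (\<Sum>i\<in>J. c i * w i x))\<^sup>2) \<le> (\<Sum>\<^sub>\<infinity>i\<in>I. (cmod (c i))\<^sup>2)" .
    qed
  qed simp
  show "l2 (\<lambda>x. \<Sum>\<^sub>\<infinity>i\<in>I. c i * w i x)"
    "nrm2 (\<lambda>x. \<Sum>\<^sub>\<infinity>i\<in>I. c i * w i x) \<le> (\<Sum>\<^sub>\<infinity>i\<in>I. (cmod (c i))\<^sup>2)"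
    using l2_finite_bound[OF b] by auto
qed

text \<open>The double sum over \<open>x\<close> and \<open>i\<close> need not converge absolutely,
  so the order of summation is changed by a tail estimate: Cauchy-Schwarz bounds the error of a
  finite part by the norm of the expansion over the remaining indices.\<close>

lemma orthonormal_expansion_ip:
  assumes on: "orthonormal I w" and c: "(\<lambda>i. (cmod (c i))\<^sup>2) summable_on I" and u: "l2 u"
  shows "((\<lambda>i. c i * ip u (w i)) has_sum ip u (\<lambda>x. \<Sum>\<^sub>\<infinity>i\<in>I. c i * w i x)) I"
proof -
  define W where "W = (\<lambda>x. \<Sum>\<^sub>\<infinity>i\<in>I. c i * w i x)"
  define K where "K = sqrt (nrm2 u)"
  have lw: "l2 (w i)" if "i \<in> I" for i using on that by (auto simp: orthonormal_def)
  have tail: "cmod (ip u W - (\<Sum>i\<in>J. c i * ip u (w i))) \<le>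
      K * sqrt ((\<Sum>\<^sub>\<infinity>i\<in>I. (cmod (c i))\<^sup>2) - (\<Sum>i\<in>J. (cmod (c i))\<^sup>2))" if J: "finite J" "J \<subseteq> I" for J
  proof -
    have on': "orthonormal (I - J) w" using on by (rule orthonormal_subset) auto
    have c': "(\<lambda>i. (cmod (c i))\<^sup>2) summable_on (I - J)"
      using c by (rule summable_on_subset_banach) auto
    have "(\<Sum>\<^sub>\<infinity>i\<in>I-J. f i) = (\<Sum>\<^sub>\<infinity>i\<in>I. f i) - (\<Sum>i\<in>J. f i)"
      if "f summable_on I" for f :: "'a \<Rightarrow> 'c :: banach"
      using that J by (subst infsum_Diff) auto
    note diff = this
    have "ip u W - (\<Sum>i\<in>J. c i * ip u (w i)) = ip u W - ip u (\<lambda>x. \<Sum>i\<in>J. c i * w i x)"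
      using J lw by (subst ip_sum_right) (auto intro!: u l2_scale simp: ip_scale_right subset_iff)
    also have "\<dots> = ip u (\<lambda>x. W x - (\<Sum>i\<in>J. c i * w i x))"
      using J lw by (subst ip_diff_right)
        (auto intro!: u l2_sum l2_scale orthonormal_expansion_bound[OF on c] simp: W_def subset_iff)
    also have "(\<lambda>x. W x - (\<Sum>i\<in>J. c i * w i x)) = (\<lambda>x. \<Sum>\<^sub>\<infinity>i\<in>I-J. c i * w i x)"
      unfolding W_def by (subst diff) (auto intro: orthonormal_expansion_bound[OF on c])
    also have "cmod (ip u \<dots>) \<le> K * sqrt (nrm2 (\<lambda>x. \<Sum>\<^sub>\<infinity>i\<in>I-J. c i * w i x))"
      unfolding K_def by (intro cauchy_schwarz_sqrt u orthonormal_expansion_bound[OF on' c'])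
    also have "\<dots> \<le> K * sqrt (\<Sum>\<^sub>\<infinity>i\<in>I-J. (cmod (c i))\<^sup>2)"
      by (intro mult_left_mono real_sqrt_le_mono orthonormal_expansion_bound[OF on' c']) (simp add: K_def)
    finally show ?thesis by (simp only: diff[OF c])
  qed
  have t0: "((\<lambda>J. K * sqrt ((\<Sum>\<^sub>\<infinity>i\<in>I. (cmod (c i))\<^sup>2) - (\<Sum>i\<in>J. (cmod (c i))\<^sup>2))) \<longlongrightarrow>
     K * sqrt ((\<Sum>\<^sub>\<infinity>i\<in>I. (cmod (c i))\<^sup>2) - (\<Sum>\<^sub>\<infinity>i\<in>I. (cmod (c i))\<^sup>2))) (finite_subsets_at_top I)"
    by (intro tendsto_intros infsum_tendsto c)
  have "((\<lambda>J. ip u W - (\<Sum>i\<in>J. c i * ip u (w i))) \<longlongrightarrow> 0) (finite_subsets_at_top I)"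
    by (rule Lim_null_comparison[of _ "\<lambda>J. K * sqrt ((\<Sum>\<^sub>\<infinity>i\<in>I. (cmod (c i))\<^sup>2) - (\<Sum>i\<in>J. (cmod (c i))\<^sup>2))"])
      (auto intro!: eventually_finite_subsets_at_top_weakI tail t0[simplified])
  from tendsto_diff[OF tendsto_const[of "ip u W"] this] show ?thesis
    unfolding has_sum_def W_def by simp
qed

text \<open>Formulated through the orthogonal complement because that is what maximality in Zorn's
  lemma delivers; \<open>parseval\<close> turns it into an expansion.\<close>

definition complete_on :: "'i set \<Rightarrow> ('i \<Rightarrow> 'a vec) \<Rightarrow> bool" where
  "complete_on I w \<longleftrightarrow> (\<forall>v. l2 v \<longrightarrow> (\<forall>i\<in>I. ip (w i) v = 0) \<longrightarrow> v = (\<lambda>x. 0))"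

text \<open>The difference between \<open>v\<close> and its expansion is orthogonal to every
  \<open>w i\<close>, hence zero by completeness.\<close>

lemma parseval:
  assumes on: "orthonormal I w" and co: "complete_on I w" and u: "l2 u" and v: "l2 v"
  shows "((\<lambda>i. ip u (w i) * ip (w i) v) has_sum ip u v) I"
proof -
  define c where "c i = ip (w i) v" for i
  define W where "W = (\<lambda>x. \<Sum>\<^sub>\<infinity>i\<in>I. c i * w i x)"
  have c: "(\<lambda>i. (cmod (c i))\<^sup>2) summable_on I" unfolding c_def by (rule bessel[OF on v])
  have lW: "l2 W" unfolding W_def by (rule orthonormal_expansion_bound[OF on c])
  have "ip (w i) W = c i" if i: "i \<in> I" for i
  proof -
    have "((\<lambda>j. c j * ip (w i) (w j)) has_sum ip (w i) W) I"
      unfolding W_def using on i by (intro orthonormal_expansion_ip c) (auto simp: orthonormal_def)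
    moreover have "((\<lambda>j. c j * ip (w i) (w j)) has_sum c i) I"
      using on i by (intro has_sum_finite_neutralI[of "{i}"]) (auto simp: orthonormal_def)
    ultimately show ?thesis by (rule has_sum_unique)
  qed
  then have "ip (w i) (\<lambda>x. v x - W x) = 0" if "i \<in> I" for i
    using on that v lW by (subst ip_diff_right) (auto simp: orthonormal_def c_def)
  then have "(\<lambda>x. v x - W x) = (\<lambda>x. 0)"
    using co v lW by (auto simp: complete_on_def intro: l2_diff)
  then have "v = W" by (simp add: fun_eq_iff)
  then show ?thesis using orthonormal_expansion_ip[OF on c u] unfolding W_def c_def
    by (simp add: mult.commute)
qed

lemma parseval_nrm2:
  assumes "orthonormal I w" "complete_on I w" "l2 v"
  shows "((\<lambda>i. (cmod (ip (w i) v))\<^sup>2) has_sum nrm2 v) I"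
proof -
  have "((\<lambda>i. ip v (w i) * ip (w i) v) has_sum ip v v) I" using assms by (intro parseval)
  then have "((\<lambda>i. complex_of_real ((cmod (ip (w i) v))\<^sup>2)) has_sum of_real (nrm2 v)) I"
    by (subst (asm) ip_cnj[symmetric]) (simp add: ip_self complex_norm_square mult.commute del: of_real_power)
  then show ?thesis by (simp only: has_sum_of_real_iff)
qed



section \<open>The spectral theorem for positive Hilbert--Schmidt matrices\<close>

definition hs :: "('a \<Rightarrow> 'b \<Rightarrow> complex) \<Rightarrow> bool" where
  "hs A \<longleftrightarrow> l2 (\<lambda>(x, y). A x y)"

definition apply_op :: "('a \<Rightarrow> 'b \<Rightarrow> complex) \<Rightarrow> 'b vec \<Rightarrow> 'a vec" where
  "apply_op A v = (\<lambda>x. \<Sum>\<^sub>\<infinity>y. A x y * v y)"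

lemma l2_tensor:
  assumes "l2 u" "l2 v"
  shows "l2 (\<lambda>(x, y). u x * v y)" "nrm2 (\<lambda>(x, y). u x * v y) = nrm2 u * nrm2 v"
proof -
  have a: "((\<lambda>y. (cmod (u x * v y))\<^sup>2) has_sum (cmod (u x))\<^sup>2 * nrm2 v) UNIV" for x
    using has_sum_cmult_right[OF nrm2_has_sum[OF assms(2)]] by (simp add: norm_mult power_mult_distrib)
  have b: "((\<lambda>x. (cmod (u x))\<^sup>2 * nrm2 v) has_sum nrm2 u * nrm2 v) UNIV"
    using has_sum_cmult_left[OF nrm2_has_sum[OF assms(1)]] .
  have s: "(\<lambda>(x, y). (cmod (u x * v y))\<^sup>2) summable_on UNIV \<times> UNIV"
    by (rule summable_on_SigmaI[where g = "\<lambda>x. (cmod (u x))\<^sup>2 * nrm2 v"])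
       (use a b in \<open>auto simp: summable_on_def\<close>)
  have "((\<lambda>(x, y). (cmod (u x * v y))\<^sup>2) has_sum nrm2 u * nrm2 v) (UNIV \<times> UNIV)"
    by (rule has_sum_SigmaI[where g = "\<lambda>x. (cmod (u x))\<^sup>2 * nrm2 v"]) (use a b s in auto)
  then have "((\<lambda>z. (cmod (case z of (x, y) \<Rightarrow> u x * v y))\<^sup>2) has_sum nrm2 u * nrm2 v) UNIV"
    by (simp add: case_prod_unfold)
  then show "l2 (\<lambda>(x, y). u x * v y)" "nrm2 (\<lambda>(x, y). u x * v y) = nrm2 u * nrm2 v"
    by (auto simp: l2_def nrm2_def summable_on_def infsumI)
qed

lemma hs_flip: "hs A \<Longrightarrow> hs (\<lambda>x y. A y x)"
  unfolding hs_def l2_def using summable_on_swap[of "\<lambda>z. (cmod (case z of (x, y) \<Rightarrow> A x y))\<^sup>2" UNIV UNIV]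
  by (simp add: case_prod_unfold)

lemma hs_cnj [simp]: "hs (\<lambda>x y. cnj (A x y)) \<longleftrightarrow> hs A"
  by (simp add: hs_def l2_def case_prod_unfold)

lemma hs_rows:
  assumes "hs A"
  shows "l2 (A x)" "((\<lambda>x. nrm2 (A x)) has_sum nrm2 (\<lambda>(x, y). A x y)) UNIV"
proof -
  have s: "((\<lambda>(x, y). (cmod (A x y))\<^sup>2) has_sum nrm2 (\<lambda>(x, y). A x y)) (UNIV \<times> UNIV)"
    using nrm2_has_sum assms by (fastforce simp: hs_def case_prod_unfold)
  have l: "l2 (A x)" for x
    unfolding l2_def by (rule summable_on_SigmaD1[of "\<lambda>x y. (cmod (A x y))\<^sup>2" UNIV "\<lambda>_. UNIV"])
      (use s in \<open>auto simp: summable_on_def\<close>)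
  then show "l2 (A x)" .
  show "((\<lambda>x. nrm2 (A x)) has_sum nrm2 (\<lambda>(x, y). A x y)) UNIV"
    by (rule has_sum_SigmaD[OF s]) (use nrm2_has_sum[OF l] in auto)
qed

lemma hs_cols:
  assumes "hs A"
  shows "l2 (\<lambda>x. A x y)" "((\<lambda>y. nrm2 (\<lambda>x. A x y)) has_sum nrm2 (\<lambda>(x, y). A x y)) UNIV"
proof -
  have "nrm2 (\<lambda>(y, x). A x y) = nrm2 (\<lambda>(x, y). A x y)"
    unfolding nrm2_def
    by (rule infsum_reindex_bij_witness[of _ prod.swap prod.swap]) auto
  then show "l2 (\<lambda>x. A x y)" "((\<lambda>y. nrm2 (\<lambda>x. A x y)) has_sum nrm2 (\<lambda>(x, y). A x y)) UNIV"
    using hs_rows[OF hs_flip[OF assms]] by auto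
qed

lemma hsI_rows:
  assumes "\<And>x. l2 (A x)" "(\<lambda>x. nrm2 (A x)) summable_on UNIV"
  shows "hs A"
proof -
  have "(\<lambda>(x, y). (cmod (A x y))\<^sup>2) summable_on UNIV \<times> UNIV"
    by (rule summable_on_SigmaI[where g = "\<lambda>x. nrm2 (A x)"]) (use assms nrm2_has_sum in auto)
  then show ?thesis by (simp add: hs_def l2_def case_prod_unfold)
qed

lemma apply_op_ip: "apply_op A v x = ip (\<lambda>y. cnj (A x y)) v"
  by (simp add: apply_op_def ip_def)

lemma l2_apply:
  assumes "hs A" "l2 v" shows "l2 (apply_op A v)" "nrm2 (apply_op A v) \<le> nrm2 (\<lambda>(x, y). A x y) * nrm2 v"
proof -
  have b: "(cmod (apply_op A v x))\<^sup>2 \<le> nrm2 (A x) * nrm2 v" for x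
    using cauchy_schwarz[of "\<lambda>y. cnj (A x y)" v] hs_rows[OF assms(1)] assms(2) by (simp add: apply_op_ip)
  have s: "((\<lambda>x. nrm2 (A x) * nrm2 v) has_sum nrm2 (\<lambda>(x, y). A x y) * nrm2 v) UNIV"
    by (intro has_sum_cmult_left hs_rows assms)
  then show l: "l2 (apply_op A v)"
    unfolding l2_def by (intro summable_on_comparison_test[OF has_sum_imp_summable b]) auto
  show "nrm2 (apply_op A v) \<le> nrm2 (\<lambda>(x, y). A x y) * nrm2 v"
    using nrm2_has_sum[OF l] s b by (rule has_sum_mono)
qed

lemma apply_op_add: "hs A \<Longrightarrow> l2 v \<Longrightarrow> l2 w \<Longrightarrow> apply_op A (\<lambda>x. v x + w x) = (\<lambda>x. apply_op A v x + apply_op A w x)"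
  by (simp add: apply_op_ip ip_add_right hs_rows fun_eq_iff)

lemma apply_op_scale: "apply_op A (\<lambda>x. c * v x) = (\<lambda>x. c * apply_op A v x)"
  by (simp add: apply_op_ip ip_scale_right fun_eq_iff)

lemma apply_op_ket [simp]: "apply_op A (ket y) x = A x y"
  by (simp add: apply_op_ip)

text \<open>The sum over pairs converges absolutely, as both factors are square-summable there. With
  \<open>u = v\<close>, the quadratic form becomes the pairing of a fixed square-summable function
  with the products \<open>v x * cnj (v y)\<close>; this gives its weak continuity in
  \<open>max_form\<close>.\<close>

lemma hs_form:
  assumes "hs A" "l2 u" "l2 v"
  shows "ip u (apply_op A v) = ip (\<lambda>(x, y). u x * cnj (v y)) (\<lambda>(x, y). A x y)"
proof -
  have l: "l2 (\<lambda>(x, y). u x * cnj (v y))" using assms by (intro l2_tensor) auto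
  have s: "((\<lambda>(x, y). cnj (u x * cnj (v y)) * A x y) has_sum ip (\<lambda>(x, y). u x * cnj (v y)) (\<lambda>(x, y). A x y)) (UNIV \<times> UNIV)"
    using ip_has_sum[OF l] assms by (fastforce simp: hs_def case_prod_unfold)
  have "((\<lambda>x. cnj (u x) * apply_op A v x) has_sum ip (\<lambda>(x, y). u x * cnj (v y)) (\<lambda>(x, y). A x y)) UNIV"
  proof (rule has_sum_SigmaD[OF s])
    fix x
    have "((\<lambda>y. A x y * v y) has_sum apply_op A v x) UNIV"
      unfolding apply_op_def using hs_rows[OF assms(1)] assms by (intro has_sum_infsum l2_mult_summable)
    from has_sum_cmult_right[OF this, of "cnj (u x)"]
    show "((\<lambda>y. case (x, y) of (x, y) \<Rightarrow> cnj (u x * cnj (v y)) * A x y) has_sum cnj (u x) * apply_op A v x) UNIV"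
      by (simp add: algebra_simps)
  qed
  then show ?thesis unfolding ip_def by (rule infsumI)
qed

lemma hs_adjoint:
  assumes "hs A" "l2 u" "l2 v"
  shows "ip u (apply_op A v) = ip (apply_op (\<lambda>y x. cnj (A x y)) u) v"
proof -
  have "ip v (apply_op (\<lambda>y x. cnj (A x y)) u) = ip (\<lambda>(y, x). v y * cnj (u x)) (\<lambda>(y, x). cnj (A x y))"
    using assms by (intro hs_form) (auto intro: hs_flip)
  also have "\<dots> = ip (\<lambda>(x, y). cnj (u x * cnj (v y))) (\<lambda>(x, y). cnj (A x y))"
    unfolding ip_def by (rule infsum_reindex_bij_witness[of _ prod.swap prod.swap]) auto
  also have "\<dots> = cnj (ip (\<lambda>(x, y). u x * cnj (v y)) (\<lambda>(x, y). A x y))"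
    unfolding ip_def by (simp flip: infsum_cnj add: case_prod_unfold)
  also have "\<dots> = cnj (ip u (apply_op A v))" using assms by (simp add: hs_form)
  finally show ?thesis by (metis ip_cnj complex_cnj_cnj)
qed

section \<open>Positive matrices\<close>

lemma positive_op_diag:
  assumes "positive_op A" shows "A x x \<in> \<real>\<^sub>\<ge>\<^sub>0"
  using assms[unfolded positive_op_def, rule_format, of "{x}" "\<lambda>_. 1"] by simp

lemma positive_op_2:
  assumes "positive_op A" "x \<noteq> y"
  shows "cnj a * A x x * a + cnj a * A x y * b + (cnj b * A y x * a + cnj b * A y y * b) \<in> \<real>\<^sub>\<ge>\<^sub>0"
  using assms(1)[unfolded positive_op_def, rule_format, of "{x, y}" "\<lambda>z. if z = x then a else b"] assms(2)
  by (simp add: algebra_simps)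

text \<open>Positivity includes reality of the form. On the vectors \<open>(1, 1)\<close> and
  \<open>(1, \<i>)\<close> it forces the imaginary and the real part of
  \<open>A x y - cnj (A y x)\<close> to vanish.\<close>

lemma positive_op_hermitian:
  assumes "positive_op A" shows "cnj (A x y) = A y x"
proof (cases "x = y")
  case True
  then show ?thesis using positive_op_diag[OF assms, of x] by (auto elim!: nonneg_Reals_cases)
next
  case False
  have d: "Im (A x x) = 0" "Im (A y y) = 0"
    using positive_op_diag[OF assms] by (auto simp: complex_nonneg_Reals_iff)
  have "Im (A x y + A y x) = 0" "Im (\<i> * A x y - \<i> * A y x) = 0"
    using positive_op_2[OF assms False, of 1 1] positive_op_2[OF assms False, of 1 \<i>] d
    by (auto simp: complex_nonneg_Reals_iff)
  then show ?thesis by (auto simp: complex_eq_iff)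
qed

text \<open>With \<open>p\<close>, \<open>q\<close> the diagonal entries and
  \<open>c = A x y\<close>, the form at \<open>(t * c, -1)\<close> is a quadratic polynomial in the
  real number \<open>t\<close>. Its minimiser \<open>t = 1 / p\<close> yields the claim; if
  \<open>p = 0\<close>, a nonzero \<open>c\<close> would make the polynomial linear and unbounded
  below.\<close>

lemma positive_op_minor:
  assumes "positive_op A" shows "(cmod (A x y))\<^sup>2 \<le> Re (A x x) * Re (A y y)"
proof (cases "x = y")
  case True
  have "cmod (A x x) = Re (A x x)" using positive_op_diag[OF assms, of x] by (auto elim!: nonneg_Reals_cases)
  then show ?thesis using True by (simp add: power2_eq_square)
next
  case False
  define p q c where "p = Re (A x x)" and "q = Re (A y y)" and "c = A x y"
  have e: "A x x = of_real p" "A y y = of_real q" "A y x = cnj c" and pq: "p \<ge> 0" "q \<ge> 0"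
    using positive_op_diag[OF assms] positive_op_hermitian[OF assms, of x y]
    by (auto simp: p_def q_def c_def complex_nonneg_Reals_iff complex_eq_iff)
  have key: "0 \<le> t\<^sup>2 * p * (cmod c)\<^sup>2 - 2 * t * (cmod c)\<^sup>2 + q" for t :: real
  proof -
    have "cnj (of_real t * c) * A x x * (of_real t * c) + cnj (of_real t * c) * A x y * (-1)
        + (cnj (-1) * A y x * (of_real t * c) + cnj (-1) * A y y * (-1))
        = of_real (t\<^sup>2 * p) * (c * cnj c) - of_real (2 * t) * (c * cnj c) + of_real q"
      by (simp add: e c_def[symmetric] algebra_simps power2_eq_square)
    also have "\<dots> = of_real (t\<^sup>2 * p * (cmod c)\<^sup>2 - 2 * t * (cmod c)\<^sup>2 + q)"
      by (simp add: complex_norm_square[symmetric])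
    finally show ?thesis
      using positive_op_2[OF assms False, of "of_real t * c" "-1"] by (simp only: nonneg_Reals_of_real_iff)
  qed
  show ?thesis
  proof (cases "p = 0")
    case True
    have "c = 0"
    proof (rule ccontr)
      assume "c \<noteq> 0"
      then have n: "(cmod c)\<^sup>2 > 0" by simp
      have "0 \<le> - 2 * t * (cmod c)\<^sup>2 + q" for t using key[of t] True by simp
      from this[of "(q + 1) / (cmod c)\<^sup>2"] show False using n pq by simp
    qed
    then show ?thesis using pq by (simp add: c_def[symmetric] p_def[symmetric] q_def[symmetric])
  next
    case False
    then have p: "p > 0" using pq by simp
    have "0 \<le> (1 / p)\<^sup>2 * p * (cmod c)\<^sup>2 - 2 * (1 / p) * (cmod c)\<^sup>2 + q" by (rule key)
    also have "\<dots> = q - (cmod c)\<^sup>2 / p" using p by (simp add: field_simps power2_eq_square)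
    finally show ?thesis using p by (simp add: field_simps c_def[symmetric] p_def[symmetric] q_def[symmetric])
  qed
qed

lemma positive_hs_form:
  assumes "positive_op A" "hs A" "l2 v" shows "ip v (apply_op A v) \<in> \<real>\<^sub>\<ge>\<^sub>0"
proof -
  have "((\<lambda>z. case z of (x, y) \<Rightarrow> cnj (v x) * A x y * v y) has_sum ip v (apply_op A v)) UNIV"
    using ip_has_sum[OF l2_tensor(1)[of v "\<lambda>y. cnj (v y)"] assms(2)[unfolded hs_def]] assms
    by (simp add: hs_form case_prod_unfold algebra_simps)
  then have t: "(sum (\<lambda>(x, y). cnj (v x) * A x y * v y) \<longlongrightarrow> ip v (apply_op A v)) (finite_subsets_at_top UNIV)"
    by (simp add: has_sum_def)
  \<comment> \<open>Positivity speaks of finitely supported vectors, that is of sums over squares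
    \<open>F \<times> F\<close>. These are cofinal among the finite sets of index pairs, so the
    limit may be taken along them.\<close>
  have fl: "filterlim (\<lambda>F. F \<times> F) (finite_subsets_at_top UNIV) (finite_subsets_at_top (UNIV :: 'a set))"
    unfolding filterlim_def le_filter_def eventually_filtermap eventually_finite_subsets_at_top
  proof safe
    fix P and X :: "('a \<times> 'a) set"
    assume X: "finite X" and P: "\<forall>Y. finite Y \<and> X \<subseteq> Y \<and> Y \<subseteq> UNIV \<longrightarrow> P Y"
    have "X \<subseteq> (fst ` X \<union> snd ` X) \<times> (fst ` X \<union> snd ` X)" by force
    then show "\<exists>X. finite X \<and> X \<subseteq> UNIV \<and> (\<forall>Y. finite Y \<and> X \<subseteq> Y \<and> Y \<subseteq> UNIV \<longrightarrow> P (Y \<times> Y))"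
      using X by (intro exI[of _ "fst ` X \<union> snd ` X"]) (auto intro!: P[rule_format])
  qed
  have "((\<lambda>F. \<Sum>(x, y)\<in>F \<times> F. cnj (v x) * A x y * v y) \<longlongrightarrow> ip v (apply_op A v)) (finite_subsets_at_top UNIV)"
    using filterlim_compose[OF t fl] by simp
  then show ?thesis
    by (rule Lim_in_closed_set[OF closed_nonneg_Reals_complex, rotated -1])
       (use assms(1) in \<open>auto intro!: eventually_finite_subsets_at_top_weakI
          simp: positive_op_def sum.cartesian_product[symmetric]\<close>)
qed



section \<open>Weak compactness of the unit ball\<close>

lemma has_sum_diff:
  fixes f g :: "'a \<Rightarrow> 'b :: real_normed_vector"
  shows "(f has_sum a) A \<Longrightarrow> (g has_sum b) A \<Longrightarrow> ((\<lambda>x. f x - g x) has_sum (a - b)) A"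
  using has_sum_add[of f A a "\<lambda>x. - g x" "- b"] by (simp add: has_sum_uminus)

text \<open>Each condition on the right concerns finitely many coordinates and is therefore closed
  in the product topology.\<close>

lemma l2_ball_eq:
  "{v :: 'a vec. l2 v \<and> nrm2 v \<le> 1} = (\<Inter>F\<in>{F. finite F}. {v. (\<Sum>x\<in>F. (cmod (v x))\<^sup>2) \<le> 1})"
proof safe
  fix v :: "'a vec" assume "v \<in> (\<Inter>F\<in>{F. finite F}. {v. (\<Sum>x\<in>F. (cmod (v x))\<^sup>2) \<le> 1})"
  then have "(\<Sum>x\<in>F. (cmod (v x))\<^sup>2) \<le> 1" if "finite F" for F using that by auto
  then show "l2 v" "nrm2 v \<le> 1" using l2_finite_bound[of v 1] by auto
qed (use nrm2_finite_le in \<open>force intro: order_trans\<close>)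

lemma closed_l2_ball: "closed {v :: 'a vec. l2 v \<and> nrm2 v \<le> 1}"
  unfolding l2_ball_eq by (intro closed_INT ballI closed_Collect_le continuous_intros) auto

text \<open>Finite partial sums are continuous, and Cauchy-Schwarz makes their convergence uniform
  on bounded sets. The map \<open>\<Phi>\<close> serves two uses: \<open>v\<close> itself for
  orthogonality constraints, and the products \<open>v x * cnj (v y)\<close> for the quadratic
  form.\<close>

lemma continuous_on_ip:
  assumes h: "l2 h" and \<Phi>: "\<And>v. v \<in> K \<Longrightarrow> l2 (\<Phi> v)" "\<And>v. v \<in> K \<Longrightarrow> nrm2 (\<Phi> v) \<le> 1"
    and c: "\<And>z. continuous_on K (\<lambda>v. \<Phi> v z)"
  shows "continuous_on K (\<lambda>v. ip h (\<Phi> v))"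
proof (rule uniform_limit_theorem[where F = "finite_subsets_at_top UNIV"
      and f = "\<lambda>F v. \<Sum>z\<in>F. cnj (h z) * \<Phi> v z"])
  show "\<forall>\<^sub>F F in finite_subsets_at_top UNIV. continuous_on K (\<lambda>v. \<Sum>z\<in>F. cnj (h z) * \<Phi> v z)"
    by (intro always_eventually allI continuous_intros c)
  have tail: "cmod ((\<Sum>z\<in>F. cnj (h z) * \<Phi> v z) - ip h (\<Phi> v)) \<le> sqrt (nrm2 h - (\<Sum>z\<in>F. (cmod (h z))\<^sup>2))"
    if F: "finite F" and v: "v \<in> K" for F v
  proof -
    define g where "g z = (if z \<in> F then 0 else h z)" for z
    have g: "l2 g" using h by (rule l2_mono) (simp add: g_def)
    have "((\<lambda>z. (cmod (h z))\<^sup>2 - (if z \<in> F then (cmod (h z))\<^sup>2 else 0)) has_sum nrm2 h - (\<Sum>z\<in>F. (cmod (h z))\<^sup>2)) UNIV"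
      by (intro has_sum_diff nrm2_has_sum h has_sum_finite_neutralI[of F]) (use F in auto)
    then have ng: "nrm2 g = nrm2 h - (\<Sum>z\<in>F. (cmod (h z))\<^sup>2)"
      unfolding nrm2_def[of g] by (intro infsumI) (auto simp: g_def if_distrib cong: if_cong elim!: has_sum_cong[THEN iffD1, rotated])
    have "((\<lambda>z. cnj (h z) * \<Phi> v z - (if z \<in> F then cnj (h z) * \<Phi> v z else 0)) has_sum
        ip h (\<Phi> v) - (\<Sum>z\<in>F. cnj (h z) * \<Phi> v z)) UNIV"
      by (intro has_sum_diff ip_has_sum h \<Phi> v has_sum_finite_neutralI[of F]) (use F in auto)
    then have "ip g (\<Phi> v) = ip h (\<Phi> v) - (\<Sum>z\<in>F. cnj (h z) * \<Phi> v z)"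
      unfolding ip_def[of g] by (intro infsumI) (auto simp: g_def elim!: has_sum_cong[THEN iffD1, rotated])
    then have "cmod ((\<Sum>z\<in>F. cnj (h z) * \<Phi> v z) - ip h (\<Phi> v)) = cmod (ip g (\<Phi> v))"
      by (simp add: norm_minus_commute)
    also have "\<dots> \<le> sqrt (nrm2 g) * sqrt (nrm2 (\<Phi> v))" by (intro cauchy_schwarz_sqrt g \<Phi> v)
    also have "\<dots> \<le> sqrt (nrm2 g) * 1" by (intro mult_left_mono) (use \<Phi> v in auto)
    finally show ?thesis by (simp add: ng)
  qed
  have t0: "((\<lambda>F. sqrt (nrm2 h - (\<Sum>z\<in>F. (cmod (h z))\<^sup>2))) \<longlongrightarrow> sqrt (nrm2 h - nrm2 h)) (finite_subsets_at_top UNIV)"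
    using nrm2_has_sum[OF h] unfolding has_sum_def by (intro tendsto_intros)
  show "uniform_limit K (\<lambda>F v. \<Sum>z\<in>F. cnj (h z) * \<Phi> v z) (\<lambda>v. ip h (\<Phi> v)) (finite_subsets_at_top UNIV)"
    unfolding uniform_limit_iff
  proof (intro allI impI)
    fix e :: real assume "e > 0"
    then have "\<forall>\<^sub>F F in finite_subsets_at_top UNIV. sqrt (nrm2 h - (\<Sum>z\<in>F. (cmod (h z))\<^sup>2)) < e"
      using t0 by (intro order_tendstoD(2)) auto
    moreover have "\<forall>\<^sub>F F in finite_subsets_at_top (UNIV :: 'a set). finite F"
      by (rule eventually_finite_subsets_at_top_weakI)
    ultimately show "\<forall>\<^sub>F F in finite_subsets_at_top UNIV. \<forall>v\<in>K. dist (\<Sum>z\<in>F. cnj (h z) * \<Phi> v z) (ip h (\<Phi> v)) < e"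
    proof eventually_elim
      case (elim F)
      then show ?case using tail[of F] by (auto simp: dist_norm intro: le_less_trans)
    qed
  qed
qed simp

text \<open>Functions carry the product topology, which on the unit ball is the weak topology.\<close>

lemma compact_l2_ball: "compact {v :: 'a vec. l2 v \<and> nrm2 v \<le> 1}"
proof -
  have "compactin (product_topology (\<lambda>_. euclidean) UNIV) (PiE (UNIV :: 'a set) (\<lambda>_. cball (0::complex) 1))"
    by (simp add: compactin_PiE)
  then have cp: "compact (PiE (UNIV :: 'a set) (\<lambda>_. cball (0::complex) 1))"
    by (simp only: euclidean_product_topology compactin_euclidean_iff)
  have "v \<in> PiE UNIV (\<lambda>_. cball 0 1)" if v: "l2 v" "nrm2 v \<le> 1" for v :: "'a vec"
  proof -
    have "(cmod (v x))\<^sup>2 \<le> 1\<^sup>2" for x using nrm2_finite_le[of v "{x}"] v by simp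
    then have "cmod (v x) \<le> 1" for x by (rule power2_le_imp_le) simp
    then show ?thesis by auto
  qed
  then have "{v :: 'a vec. l2 v \<and> nrm2 v \<le> 1} = PiE UNIV (\<lambda>_. cball 0 1) \<inter> {v. l2 v \<and> nrm2 v \<le> 1}"
    by blast
  then show ?thesis using compact_Int_closed[OF cp closed_l2_ball] by simp
qed

text \<open>In infinite dimension the unit sphere is not weakly closed, so the maximum is taken over
  the ball. The maximiser may then have norm below 1, which is why its value is recorded as an
  inequality.\<close>

lemma max_form:
  assumes A: "hs A" "positive_op A" and G: "\<And>i. i \<in> I \<Longrightarrow> l2 (w i)"
    and v0: "l2 v0" "v0 \<noteq> (\<lambda>x. 0)" "\<And>i. i \<in> I \<Longrightarrow> ip (w i) v0 = 0"
  obtains h s where "l2 h" "h \<noteq> (\<lambda>x. 0)" "\<forall>i\<in>I. ip (w i) h = 0" "s \<ge> 0"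
    "Re (ip h (apply_op A h)) \<ge> s * nrm2 h"
    "\<forall>v. l2 v \<longrightarrow> (\<forall>i\<in>I. ip (w i) v = 0) \<longrightarrow> Re (ip v (apply_op A v)) \<le> s * nrm2 v"
proof -
  define B where "B = {v :: 'a vec. l2 v \<and> nrm2 v \<le> 1}"
  \<comment> \<open>Inner products with a fixed vector are continuous in the product topology only
    on bounded sets, so each constraint is imposed inside \<open>B\<close>.\<close>
  define K where "K = B \<inter> (\<Inter>i\<in>I. {v \<in> B. ip (w i) v = 0})"
  define Q where "Q v = Re (ip v (apply_op A v))" for v
  have cB: "compact B" unfolding B_def by (rule compact_l2_ball)
  have cc: "continuous_on S (\<lambda>v :: 'a vec. v z)" for S z
    by (rule continuous_on_subset[OF continuous_on_product_coordinates]) auto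
  have clB: "closed B" unfolding B_def by (rule closed_l2_ball)
  have "closed {v \<in> B. ip (w i) v = 0}" if "i \<in> I" for i
    by (intro continuous_closed_preimage_constant continuous_on_ip G that clB) (auto simp: B_def cc)
  then have "compact K" unfolding K_def by (intro compact_Int_closed cB closed_INT) auto
  moreover have "(\<lambda>x. 0) \<in> K" by (auto simp: K_def B_def nrm2_def)
  moreover have "continuous_on K Q"
  proof -
    have "continuous_on K (\<lambda>v. ip (\<lambda>(x, y). A x y) (\<lambda>(x, y). v x * cnj (v y)))"
    proof (rule continuous_on_ip)
      fix v assume v: "v \<in> K"
      then show "l2 (\<lambda>(x, y). v x * cnj (v y))" by (intro l2_tensor) (auto simp: K_def B_def)
      have "nrm2 (\<lambda>(x, y). v x * cnj (v y)) = nrm2 v * nrm2 v"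
        using v by (subst l2_tensor(2)) (auto simp: K_def B_def)
      also have "\<dots> \<le> 1" using v by (intro mult_le_one) (auto simp: K_def B_def)
      finally show "nrm2 (\<lambda>(x, y). v x * cnj (v y)) \<le> 1" .
    next
      fix z :: "'a \<times> 'a"
      show "continuous_on K (\<lambda>v. case z of (x, y) \<Rightarrow> v x * cnj (v y))"
        unfolding case_prod_unfold by (intro continuous_intros cc)
    qed (use A in \<open>simp add: hs_def\<close>)
    then have "continuous_on K (\<lambda>v. Re (ip (\<lambda>(x, y). A x y) (\<lambda>(x, y). v x * cnj (v y))))"
      by (intro continuous_intros)
    moreover have "Q v = Re (ip (\<lambda>(x, y). A x y) (\<lambda>(x, y). v x * cnj (v y)))" if "v \<in> K" for v
    proof -
      have "ip v (apply_op A v) = ip (\<lambda>(x, y). v x * cnj (v y)) (\<lambda>(x, y). A x y)"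
        using that A by (intro hs_form) (auto simp: K_def B_def)
      also have "\<dots> = cnj (ip (\<lambda>(x, y). A x y) (\<lambda>(x, y). v x * cnj (v y)))" by (simp only: ip_cnj)
      finally show ?thesis by (simp add: Q_def)
    qed
    ultimately show ?thesis by (simp cong: continuous_on_cong)
  qed
  ultimately obtain h0 where h0: "h0 \<in> K" "\<And>v. v \<in> K \<Longrightarrow> Q v \<le> Q h0"
    using continuous_attains_sup[of K Q] by blast
  define s where "s = Q h0"
  have Qnn: "Q v \<ge> 0" if "l2 v" for v
    using positive_hs_form[OF A(2,1) that] by (simp add: Q_def complex_nonneg_Reals_iff)
  have s0: "s \<ge> 0" unfolding s_def using h0(1) by (intro Qnn) (auto simp: K_def B_def)
  have Qs: "Q (\<lambda>x. c * v x) = (cmod c)\<^sup>2 * Q v" for c v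
    unfolding Q_def apply_op_scale ip_scale_left ip_scale_right
    by (simp add: complex_norm_square[symmetric] mult.assoc[symmetric] mult.commute[of "cnj c"] del: of_real_power)
  have up: "Q v \<le> s * nrm2 v" if v: "l2 v" "\<And>i. i \<in> I \<Longrightarrow> ip (w i) v = 0" for v
  proof (cases "nrm2 v = 0")
    case True
    then have "v = (\<lambda>x. 0)" using nrm2_eq_0[OF v(1)] by auto
    then show ?thesis using True by (simp add: Q_def ip_def)
  next
    case False
    then have p: "nrm2 v > 0" by (simp add: less_le)
    define c where "c = complex_of_real (1 / sqrt (nrm2 v))"
    have c: "(cmod c)\<^sup>2 = 1 / nrm2 v" using p by (simp add: c_def norm_divide power_divide)
    have "(\<lambda>x. c * v x) \<in> K" using v p by (auto simp: K_def B_def l2_scale nrm2_scale c ip_scale_right)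
    from h0(2)[OF this] show ?thesis using p by (simp add: Qs c s_def field_simps)
  qed
  show thesis
  proof (cases "s = 0")
    \<comment> \<open>If the maximum is 0, the maximiser found may be the zero vector. The form then
      vanishes on the whole complement, and \<open>v0\<close> takes its place.\<close>
    case True
    show ?thesis
      by (rule that[of v0 0]) (use v0 Qnn up True in \<open>auto simp: Q_def\<close>)
  next
    case False
    have "s * nrm2 h0 \<le> s * 1" using h0(1) s0 by (intro mult_left_mono) (auto simp: K_def B_def)
    moreover have "h0 \<noteq> (\<lambda>x. 0)" using False by (auto simp: s_def Q_def ip_def)
    ultimately show ?thesis
      by (intro that[of h0 s]) (use h0(1) s0 up in \<open>auto simp: Q_def s_def K_def B_def\<close>)
  qed
qed

lemma eigenvector_orthogonal:
  assumes A: "hs A" "positive_op A" and G: "\<And>i. i \<in> I \<Longrightarrow> l2 (w i)"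
    and eig: "\<And>i. i \<in> I \<Longrightarrow> \<exists>c. apply_op A (w i) = (\<lambda>x. of_real c * w i x)"
    and v0: "l2 v0" "v0 \<noteq> (\<lambda>x. 0)" "\<And>i. i \<in> I \<Longrightarrow> ip (w i) v0 = 0"
  obtains h s where "l2 h" "nrm2 h = 1" "\<forall>i\<in>I. ip (w i) h = 0" "s \<ge> 0"
    "apply_op A h = (\<lambda>x. of_real s * h x)"
proof -
  obtain h s where h: "l2 h" "h \<noteq> (\<lambda>x. 0)" and hI: "\<forall>i\<in>I. ip (w i) h = 0" and s: "s \<ge> 0"
    and ge: "Re (ip h (apply_op A h)) \<ge> s * nrm2 h"
    and le: "\<forall>v. l2 v \<longrightarrow> (\<forall>i\<in>I. ip (w i) v = 0) \<longrightarrow> Re (ip v (apply_op A v)) \<le> s * nrm2 v"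
    by (rule max_form[OF A G v0])
  have sym: "ip u (apply_op A v) = ip (apply_op A u) v" if "l2 u" "l2 v" for u v
  proof -
    have "(\<lambda>y x. cnj (A x y)) = A" using positive_op_hermitian[OF A(2)] by (simp add: fun_eq_iff)
    then show ?thesis using hs_adjoint[OF A(1) that] by simp
  qed
  \<comment> \<open>The residual of the eigenvalue equation. As \<open>A\<close> is symmetric, it
    maps the complement of the given eigenvectors into itself, so \<open>u\<close> is an admissible
    direction of variation.\<close>
  define u where "u = (\<lambda>x. apply_op A h x - of_real s * h x)"
  have lAh: "l2 (apply_op A h)" using A(1) h(1) by (rule l2_apply)
  have lu: "l2 u" unfolding u_def using lAh h(1) by (intro l2_diff l2_scale)
  have uG: "ip (w i) u = 0" if i: "i \<in> I" for i
  proof -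
    obtain c where "apply_op A (w i) = (\<lambda>x. of_real c * w i x)" using eig i by blast
    then have "ip (w i) (apply_op A h) = 0"
      using sym[OF G[OF i] h(1)] hI i by (simp add: ip_scale_left)
    then show ?thesis unfolding u_def
      using G[OF i] lAh h(1) hI i by (simp add: ip_diff_right l2_scale ip_scale_right)
  qed
  have uu: "ip u u = ip u (apply_op A h) - of_real s * ip u h"
    using lu lAh h(1) by (subst (2) u_def) (simp add: ip_diff_right l2_scale ip_scale_right)
  text \<open>First-order optimality of \<open>h\<close> in the direction \<open>u\<close>.\<close>
  have var: "2 * t * nrm2 u \<le> t\<^sup>2 * (s * nrm2 u)" for t :: real
  proof -
    define v where "v = (\<lambda>x. h x + of_real t * u x)"
    have lv: "l2 v" "ip (w i) v = 0" if "i \<in> I" for i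
      using h hI lu uG that G by (auto simp: v_def l2_add l2_scale ip_add_right ip_scale_right)
    have lv': "l2 v" unfolding v_def using h lu by (intro l2_add l2_scale)
    have ltu: "l2 (\<lambda>x. of_real t * u x)" using lu by (rule l2_scale)
    have Av: "apply_op A v = (\<lambda>x. apply_op A h x + of_real t * apply_op A u x)"
      unfolding v_def using A(1) h(1) ltu by (simp add: apply_op_add apply_op_scale)
    have lAu: "l2 (apply_op A u)" "l2 (\<lambda>x. of_real t * apply_op A u x)"
      using A(1) lu by (auto intro: l2_apply l2_scale)
    have r: "ip h (apply_op A u) = cnj (ip u (apply_op A h))" "ip h u = cnj (ip u h)"
      using sym[OF h(1) lu] by (simp_all add: ip_cnj)
    have q1: "Re (ip v (apply_op A v)) = Re (ip h (apply_op A h)) + 2 * t * Re (ip u (apply_op A h)) + t\<^sup>2 * Re (ip u (apply_op A u))"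
      unfolding Av unfolding v_def using h(1) lu ltu lAh lAu
      by (simp add: ip_add_left ip_add_right l2_add ip_scale_left ip_scale_right r power2_eq_square algebra_simps)
    have q2: "nrm2 v = nrm2 h + 2 * t * Re (ip u h) + t\<^sup>2 * nrm2 u"
    proof -
      have "complex_of_real (nrm2 v) = ip v v" by (simp add: ip_self)
      then have "nrm2 v = Re (ip v v)" by (metis Re_complex_of_real)
      also have "\<dots> = Re (ip h h) + 2 * t * Re (ip u h) + t\<^sup>2 * Re (ip u u)"
        unfolding v_def using h(1) lu ltu
        by (simp add: ip_add_left ip_add_right l2_add ip_scale_left ip_scale_right r power2_eq_square algebra_simps)
      finally show ?thesis by (simp add: ip_self)
    qed
    have "Re (ip v (apply_op A v)) \<le> s * nrm2 v" using le lv lv' by blast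
    then have "2 * t * (Re (ip u (apply_op A h)) - s * Re (ip u h)) + t\<^sup>2 * Re (ip u (apply_op A u)) \<le> t\<^sup>2 * (s * nrm2 u)"
      using ge unfolding q1 q2 by (simp add: algebra_simps)
    moreover have "Re (ip u (apply_op A h)) - s * Re (ip u h) = nrm2 u"
      using arg_cong[OF uu, of Re] by (simp add: ip_self)
    moreover have "Re (ip u (apply_op A u)) \<ge> 0"
      using positive_hs_form[OF A(2,1) lu] by (simp add: complex_nonneg_Reals_iff)
    then have "t\<^sup>2 * Re (ip u (apply_op A u)) \<ge> 0" by simp
    ultimately show ?thesis by simp
  qed
  have "nrm2 u = 0"
  proof (rule ccontr)
    assume "nrm2 u \<noteq> 0"
    then have p: "nrm2 u > 0" by (simp add: less_le)
    \<comment> \<open>A step so short that the quadratic term is at most half of the linear one; the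
      summand 1 covers \<open>s = 0\<close>.\<close>
    define k where "k = 1 / (s + 1)"
    have k: "k > 0" "k * s \<le> 1" using s by (simp_all add: k_def field_simps)
    have "2 * k * nrm2 u \<le> k\<^sup>2 * (s * nrm2 u)" by (rule var)
    also have "\<dots> = k * nrm2 u * (k * s)" by (simp add: power2_eq_square)
    also have "\<dots> \<le> k * nrm2 u * 1" using k p by (intro mult_left_mono) auto
    finally show False using mult_pos_pos[OF k(1) p] by simp
  qed
  then have e: "apply_op A h x = of_real s * h x" for x
    using nrm2_eq_0[OF lu, of x] by (simp add: u_def)
  have p: "nrm2 h > 0" using h(2) nrm2_eq_0[OF h(1)] by (auto simp: less_le fun_eq_iff)
  define c where "c = complex_of_real (1 / sqrt (nrm2 h))"
  have c: "(cmod c)\<^sup>2 = 1 / nrm2 h" using p by (simp add: c_def norm_divide power_divide)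
  show thesis
    by (rule that[of "\<lambda>x. c * h x" s])
       (use h hI s p in \<open>auto simp: l2_scale nrm2_scale c ip_scale_right apply_op_scale e fun_eq_iff\<close>)
qed

text \<open>Kernel vectors belong to \<open>G\<close> with eigenvalue 0, which makes
  \<open>G\<close> complete. Nonnegativity of \<open>s\<close> on the whole type saves membership
  conditions later.\<close>

definition eigenbasis :: "'a matrix \<Rightarrow> 'a vec set \<Rightarrow> ('a vec \<Rightarrow> real) \<Rightarrow> bool" where
  "eigenbasis A G s \<longleftrightarrow> orthonormal G (\<lambda>g. g) \<and> complete_on G (\<lambda>g. g) \<and> (\<forall>g. s g \<ge> 0) \<and>
     (\<forall>g\<in>G. apply_op A g = (\<lambda>x. of_real (s g) * g x))"

text \<open>A maximal orthonormal set of eigenvectors is complete, since a nonzero vector orthogonal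
  to it would yield a further eigenvector by \<open>eigenvector_orthogonal\<close>. Zorn's lemma
  also covers kernels of uncountable dimension.\<close>

theorem spectral_theorem_hs:
  assumes A: "hs A" "positive_op A"
  shows "\<exists>G s. eigenbasis A G s"
proof -
  define ev where "ev g \<longleftrightarrow> (\<exists>c\<ge>0. apply_op A g = (\<lambda>x. complex_of_real c * g x))" for g
  define \<G> where "\<G> = {G. orthonormal G (\<lambda>g. g) \<and> (\<forall>g\<in>G. ev g)}"
  have "\<exists>M\<in>\<G>. \<forall>X\<in>\<G>. M \<subseteq> X \<longrightarrow> X = M"
  proof (rule subset_Zorn')
    fix C assume C: "subset.chain \<G> C"
    then have sub: "\<And>X. X \<in> C \<Longrightarrow> orthonormal X (\<lambda>g. g) \<and> (\<forall>g\<in>X. ev g)"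
      by (auto simp: \<G>_def subset.chain_def)
    have "ip g h = (if g = h then 1 else 0)" if gh: "g \<in> \<Union>C" "h \<in> \<Union>C" for g h
    proof -
      obtain X Y where XY: "X \<in> C" "g \<in> X" "Y \<in> C" "h \<in> Y" using gh by blast
      then have "X \<subseteq> Y \<or> Y \<subseteq> X" using C unfolding subset.chain_def by blast
      then have "\<exists>Z\<in>C. g \<in> Z \<and> h \<in> Z" using XY by blast
      then show ?thesis using sub by (auto simp: orthonormal_def)
    qed
    moreover have "l2 g" "ev g" if "g \<in> \<Union>C" for g
      using that sub by (auto simp: orthonormal_def)
    ultimately show "\<Union>C \<in> \<G>" by (simp add: \<G>_def orthonormal_def)
  qed
  then obtain G where G: "G \<in> \<G>" and max: "\<And>X. X \<in> \<G> \<Longrightarrow> G \<subseteq> X \<Longrightarrow> X = G" by blast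
  have on: "orthonormal G (\<lambda>g. g)" and ev: "\<And>g. g \<in> G \<Longrightarrow> ev g" using G by (auto simp: \<G>_def)
  have lG: "l2 g" if "g \<in> G" for g using on that by (auto simp: orthonormal_def)
  have "complete_on G (\<lambda>g. g)"
  proof (rule ccontr)
    assume "\<not> complete_on G (\<lambda>g. g)"
    then obtain v where v: "l2 v" "v \<noteq> (\<lambda>x. 0)" "\<And>g. g \<in> G \<Longrightarrow> ip g v = 0"
      by (auto simp: complete_on_def)
    have eig: "\<exists>c. apply_op A g = (\<lambda>x. of_real c * g x)" if "g \<in> G" for g
      using ev[OF that] unfolding ev_def by blast
    obtain h s where h: "l2 h" "nrm2 h = 1" "\<forall>g\<in>G. ip g h = 0" "s \<ge> 0"
        "apply_op A h = (\<lambda>x. of_real s * h x)"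
      by (rule eigenvector_orthogonal[OF A lG eig v])
    have hG: "h \<notin> G" using h(2,3) by (force simp: ip_self)
    have "ip h g = 0" if "g \<in> G" for g using h(3) that ip_cnj[of g h] by simp
    then have "insert h G \<in> \<G>" using h on ev hG by (auto simp: \<G>_def orthonormal_def ev_def ip_self)
    then show False using max[of "insert h G"] hG by auto
  qed
  moreover obtain s where "\<And>g. g \<in> G \<Longrightarrow> s g \<ge> 0 \<and> apply_op A g = (\<lambda>x. complex_of_real (s g) * g x)"
    using ev unfolding ev_def by metis
  ultimately have "eigenbasis A G (\<lambda>g. if g \<in> G then s g else 0)"
    using on by (simp add: eigenbasis_def)
  then show ?thesis by blast
qed



section \<open>Square roots and Uhlmann's inequality\<close>

lemma has_sum_finite_sum:
  fixes f :: "'i \<Rightarrow> 'a \<Rightarrow> 'b :: topological_comm_monoid_add"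
  assumes "\<And>i. i \<in> F \<Longrightarrow> (f i has_sum a i) A"
  shows "((\<lambda>x. \<Sum>i\<in>F. f i x) has_sum (\<Sum>i\<in>F. a i)) A"
  using assms by (induction F rule: infinite_finite_induct) (auto intro!: has_sum_add)

lemma has_sum_nonneg_Reals:
  fixes f :: "'a \<Rightarrow> complex"
  assumes "(f has_sum a) A" "\<And>x. x \<in> A \<Longrightarrow> f x \<in> \<real>\<^sub>\<ge>\<^sub>0"
  shows "a \<in> \<real>\<^sub>\<ge>\<^sub>0"
proof -
  have "((\<lambda>x. 0) has_sum Im a) A"
    using has_sum_Im[OF assms(1)] by (rule has_sum_cong[THEN iffD1, rotated]) (use assms(2) in \<open>auto simp: complex_nonneg_Reals_iff\<close>)
  then have "Im a = 0" by (rule has_sum_unique) simp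
  moreover have "Re a \<ge> 0"
    using has_sum_Re[OF assms(1)] by (rule has_sum_nonneg) (use assms(2) in \<open>auto simp: complex_nonneg_Reals_iff\<close>)
  ultimately show ?thesis by (simp add: complex_nonneg_Reals_iff)
qed

lemma nonneg_has_sum_swap:
  fixes f :: "'a \<Rightarrow> 'b \<Rightarrow> real"
  assumes nn: "\<And>x y. x \<in> A \<Longrightarrow> y \<in> B \<Longrightarrow> f x y \<ge> 0"
    and a: "\<And>x. x \<in> A \<Longrightarrow> (f x has_sum a x) B" and S: "(a has_sum S) A"
    and b: "\<And>y. y \<in> B \<Longrightarrow> ((\<lambda>x. f x y) has_sum b y) A"
  shows "(b has_sum S) B"
proof -
  have "(\<lambda>(x, y). f x y) summable_on A \<times> B"
    by (rule summable_on_SigmaI[where g = a]) (use nn a S in \<open>auto simp: summable_on_def\<close>)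
  then have "((\<lambda>(x, y). f x y) has_sum S) (A \<times> B)"
    by (intro has_sum_SigmaI[where g = a]) (use a S in auto)
  then have "((\<lambda>(y, x). f x y) has_sum S) (B \<times> A)"
    by (subst (asm) has_sum_swap) simp
  then show ?thesis by (rule has_sum_SigmaD) (use b in auto)
qed

lemma positive_op_apply_sym:
  assumes "positive_op A" "hs A" "l2 u" "l2 v"
  shows "ip u (apply_op A v) = ip (apply_op A u) v"
proof -
  have "(\<lambda>y x. cnj (A x y)) = A" using positive_op_hermitian[OF assms(1)] by (simp add: fun_eq_iff)
  then show ?thesis using hs_adjoint[OF assms(2-4)] by simp
qed

lemma eigenbasisE:
  assumes "eigenbasis A G s"
  shows "orthonormal G (\<lambda>g. g)" "complete_on G (\<lambda>g. g)" "s g \<ge> 0"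
    "g \<in> G \<Longrightarrow> apply_op A g = (\<lambda>x. of_real (s g) * g x)" "g \<in> G \<Longrightarrow> l2 g" "g \<in> G \<Longrightarrow> nrm2 g = 1"
proof -
  show on: "orthonormal G (\<lambda>g. g)" using assms by (simp add: eigenbasis_def)
  show "g \<in> G \<Longrightarrow> nrm2 g = 1" using on ip_self[of g] by (simp add: orthonormal_def)
qed (use assms in \<open>auto simp: eigenbasis_def orthonormal_def\<close>)

lemma eigenbasis_entry:
  assumes A: "positive_op A" "hs A" and G: "eigenbasis A G s"
  shows "((\<lambda>g. of_real (s g) * g x * cnj (g y)) has_sum A x y) G"
proof -
  have "((\<lambda>g. ip (ket x) g * ip g (apply_op A (ket y))) has_sum ip (ket x) (apply_op A (ket y))) G"
    by (intro parseval eigenbasisE[OF G] l2_apply A l2_ket)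
  moreover have "ip g (apply_op A (ket y)) = of_real (s g) * cnj (g y)" if "g \<in> G" for g
    using eigenbasisE(4,5)[OF G that] by (subst positive_op_apply_sym[OF A]) auto
  ultimately have "((\<lambda>g. of_real (s g) * g x * cnj (g y)) has_sum ip (ket x) (apply_op A (ket y))) G"
    by (simp add: mult_ac cong: has_sum_cong)
  then show ?thesis by simp
qed

lemma eigenbasis_diag:
  assumes A: "positive_op A" "hs A" and G: "eigenbasis A G s"
  shows "((\<lambda>g. s g * (cmod (g x))\<^sup>2) has_sum Re (A x x)) G"
proof -
  have "Re (complex_of_real (s g) * g x * cnj (g x)) = s g * (cmod (g x))\<^sup>2" for g
  proof -
    have "complex_of_real (s g) * g x * cnj (g x) = of_real (s g * (cmod (g x))\<^sup>2)"
      by (simp add: complex_norm_square mult.assoc del: of_real_power)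
    then show ?thesis by (metis Re_complex_of_real)
  qed
  then show ?thesis using has_sum_Re[OF eigenbasis_entry[OF A G, of x x]] by simp
qed

text \<open>Tonelli's theorem for \<open>s g * |g x|^2\<close>: summing over \<open>x\<close> first
  gives the eigenvalues, over \<open>g\<close> first the diagonal. Convergence is part of the claim
  because \<open>op_trace\<close> would otherwise be 0 by default.\<close>

lemma eigenbasis_trace:
  assumes A: "positive_op A" "hs A" and G: "eigenbasis A G s" and t: "(s has_sum t) G"
  shows "((\<lambda>x. A x x) has_sum of_real t) UNIV"
proof -
  have "((\<lambda>x. Re (A x x)) has_sum t) UNIV"
  proof (rule nonneg_has_sum_swap[OF _ _ t])
    fix g assume g: "g \<in> G"
    show "((\<lambda>x. s g * (cmod (g x))\<^sup>2) has_sum s g) UNIV"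
      using has_sum_cmult_right[OF nrm2_has_sum[OF eigenbasisE(5)[OF G g]], of "s g"] eigenbasisE(6)[OF G g] by simp
  qed (use eigenbasis_diag[OF A G] eigenbasisE(3)[OF G] in auto)
  then have "((\<lambda>x. complex_of_real (Re (A x x))) has_sum of_real t) UNIV" by (rule has_sum_of_real)
  moreover have "complex_of_real (Re (A x x)) = A x x" for x
    using positive_op_diag[OF A(1), of x] by (auto elim!: nonneg_Reals_cases)
  ultimately show ?thesis by simp
qed

text \<open>The minors of order 2 bound the entries by the product of the roots of the diagonal
  entries, a square-summable tensor product.\<close>

lemma positive_op_trace_class_hs:
  assumes "positive_op A" "(\<lambda>x. Re (A x x)) summable_on UNIV"
  shows "hs A"
proof -
  define a where "a x = complex_of_real (sqrt (Re (A x x)))" for x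
  have nn: "Re (A x x) \<ge> 0" for x using positive_op_diag[OF assms(1), of x] by (simp add: complex_nonneg_Reals_iff)
  have "l2 a" using assms(2) nn by (simp add: l2_def a_def)
  then have "l2 (\<lambda>(x, y). a x * a y)" by (intro l2_tensor)
  then show ?thesis unfolding hs_def
  proof (rule l2_mono, clarify)
    fix x y
    have "cmod (A x y) \<le> sqrt (Re (A x x) * Re (A y y))"
      using positive_op_minor[OF assms(1), of x y] by (rule real_le_rsqrt)
    then show "cmod (A x y) \<le> cmod (a x * a y)" using nn by (simp add: a_def norm_mult real_sqrt_mult)
  qed
qed

text \<open>The witness has the eigenvectors of \<open>A\<close> and the roots of its eigenvalues.
  It need not be Hilbert-Schmidt itself, but its columns are square-summable by
  \<open>eigenbasis_diag\<close>, and the entries of its square are computed as inner products of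
  columns.\<close>

theorem sqrt_exists:
  assumes A: "positive_op A" "hs A"
  shows "\<exists>S. positive_op S \<and> (\<forall>x y. ((\<lambda>z. S x z * S z y) has_sum A x y) UNIV)"
proof -
  obtain G s where G: "eigenbasis A G s"
    using spectral_theorem_hs[OF A(2,1)] by blast
  note on = eigenbasisE(1)[OF G] and s0 = eigenbasisE(3)[OF G]
  define c where "c y g = complex_of_real (sqrt (s g)) * cnj (g y)" for y and g :: "'a vec"
  define S where "S x y = (\<Sum>\<^sub>\<infinity>g\<in>G. c y g * g x)" for x y
  have c: "(\<lambda>g. (cmod (c y g))\<^sup>2) summable_on G" for y
    using eigenbasis_diag[OF A G, of y] s0 by (auto simp: c_def norm_mult power_mult_distrib summable_on_def)
  have S_sum: "((\<lambda>g. c y g * g x) has_sum S x y) G" for x y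
    unfolding S_def by (intro has_sum_infsum orthonormal_expansion_bound(1)[OF on c])
  have lS: "l2 (\<lambda>x. S x y)" for y
    unfolding S_def by (rule orthonormal_expansion_bound(2)[OF on c])
  have herm: "cnj (S x y) = S y x" for x y
    unfolding S_def by (subst infsum_cnj[symmetric]) (simp add: c_def mult_ac)
  have ip_g: "ip (\<lambda>x. S x y) g = cnj (c y g)" if g: "g \<in> G" for g y
  proof -
    have "((\<lambda>h. c y h * ip g h) has_sum ip g (\<lambda>x. S x y)) G"
      unfolding S_def using on g by (intro orthonormal_expansion_ip[OF on c]) (auto simp: orthonormal_def)
    moreover have "((\<lambda>h. c y h * ip g h) has_sum c y g) G"
      using on g by (intro has_sum_finite_neutralI[of "{g}"]) (auto simp: orthonormal_def)
    ultimately have "ip g (\<lambda>x. S x y) = c y g" by (rule has_sum_unique)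
    then show ?thesis by (metis ip_cnj)
  qed
  have "((\<lambda>z. S x z * S z y) has_sum A x y) UNIV" for x y
  proof -
    have "((\<lambda>g. c y g * ip (\<lambda>z. S z x) g) has_sum ip (\<lambda>z. S z x) (\<lambda>z. S z y)) G"
      using orthonormal_expansion_ip[OF on c lS] unfolding S_def .
    moreover have "c y g * ip (\<lambda>z. S z x) g = of_real (s g) * g x * cnj (g y)" if "g \<in> G" for g
      using s0 that by (simp add: ip_g c_def flip: of_real_mult)
    ultimately have "((\<lambda>g. of_real (s g) * g x * cnj (g y)) has_sum ip (\<lambda>z. S z x) (\<lambda>z. S z y)) G"
      by (simp cong: has_sum_cong)
    then have "ip (\<lambda>z. S z x) (\<lambda>z. S z y) = A x y"
      using eigenbasis_entry[OF A G] by (rule has_sum_unique)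
    then show ?thesis using ip_has_sum[OF lS lS, of x y] by (simp add: herm)
  qed
  moreover have "positive_op S"
    unfolding positive_op_def
  proof (intro allI impI)
    fix F :: "'a set" and v
    assume "finite F"
    have "((\<lambda>g. \<Sum>x\<in>F. \<Sum>y\<in>F. cnj (v x) * (c y g * g x) * v y) has_sum (\<Sum>x\<in>F. \<Sum>y\<in>F. cnj (v x) * S x y * v y)) G"
      by (intro has_sum_finite_sum has_sum_cmult_left has_sum_cmult_right S_sum)
    then show "(\<Sum>x\<in>F. \<Sum>y\<in>F. cnj (v x) * S x y * v y) \<in> \<real>\<^sub>\<ge>\<^sub>0"
    proof (rule has_sum_nonneg_Reals)
      fix g
      have "(\<Sum>x\<in>F. \<Sum>y\<in>F. cnj (v x) * (c y g * g x) * v y)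
          = (\<Sum>x\<in>F. \<Sum>y\<in>F. of_real (sqrt (s g)) * ((cnj (v x) * g x) * cnj (cnj (v y) * g y)))"
        by (simp add: c_def mult_ac)
      also have "\<dots> = of_real (sqrt (s g)) * ((\<Sum>x\<in>F. cnj (v x) * g x) * cnj (\<Sum>x\<in>F. cnj (v x) * g x))"
        unfolding sum_distrib_left[symmetric] cnj_sum sum_product ..
      also have "\<dots> = of_real (sqrt (s g) * (cmod (\<Sum>x\<in>F. cnj (v x) * g x))\<^sup>2)"
        by (simp add: complex_norm_square del: of_real_power)
      finally show "(\<Sum>x\<in>F. \<Sum>y\<in>F. cnj (v x) * (c y g * g x) * v y) \<in> \<real>\<^sub>\<ge>\<^sub>0"
        using s0[of g] by (simp only: nonneg_Reals_of_real_iff) simp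
    qed
  qed
  ultimately show ?thesis by blast
qed

section \<open>Gram matrices \<open>a a^*\<close>, the reduced states of purifications
  \<open>a\<close>\<close>

definition gram :: "('a \<Rightarrow> 'e \<Rightarrow> complex) \<Rightarrow> 'a matrix" where
  "gram a = (\<lambda>x y. \<Sum>\<^sub>\<infinity>e. a x e * cnj (a y e))"

definition adj :: "('a \<Rightarrow> 'e \<Rightarrow> complex) \<Rightarrow> 'e \<Rightarrow> 'a \<Rightarrow> complex" where
  "adj a = (\<lambda>e x. cnj (a x e))"

lemma gram_ip: "gram a x y = ip (a y) (a x)"
  by (simp add: gram_def ip_def mult.commute)

lemma hs_adj: "hs a \<Longrightarrow> hs (adj a)"
  unfolding adj_def using hs_flip[of "\<lambda>x y. cnj (a x y)"] by simp

lemma adj_adj [simp]: "adj (adj a) = a"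
  by (simp add: adj_def)

lemma apply_adj: "hs a \<Longrightarrow> l2 u \<Longrightarrow> l2 v \<Longrightarrow> ip u (apply_op a v) = ip (apply_op (adj a) u) v"
  unfolding adj_def by (rule hs_adjoint)

text \<open>The right-hand side involves \<open>a\<close> only through \<open>gram a\<close>. This
  lets \<open>polar\<close> exchange \<open>a\<close> for a square root with the same Gram
  matrix.\<close>

lemma gram_form:
  assumes "hs a" "l2 u" "l2 v"
  shows "ip (apply_op (adj a) u) (apply_op (adj a) v) = ip u (\<lambda>x. ip (\<lambda>y. gram a y x) v)"
proof -
  have "apply_op a (apply_op (adj a) v) = (\<lambda>x. ip (\<lambda>y. gram a y x) v)"
  proof
    fix x
    have l: "l2 (\<lambda>e. cnj (a x e))" using hs_rows[OF assms(1)] by simp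
    have "apply_op a (apply_op (adj a) v) x = ip (\<lambda>e. cnj (a x e)) (apply_op (adj a) v)" by (simp add: apply_op_ip)
    also have "\<dots> = ip (apply_op a (\<lambda>e. cnj (a x e))) v"
      using apply_adj[OF hs_adj[OF assms(1)] l assms(3)] by simp
    also have "apply_op a (\<lambda>e. cnj (a x e)) = (\<lambda>y. gram a y x)" by (simp add: apply_op_def gram_def)
    finally show "apply_op a (apply_op (adj a) v) x = ip (\<lambda>y. gram a y x) v" .
  qed
  moreover have "ip (apply_op (adj a) u) (apply_op (adj a) v) = ip u (apply_op a (apply_op (adj a) v))"
    using assms by (simp add: apply_adj l2_apply hs_adj)
  ultimately show ?thesis by simp
qed


text \<open>Moving \<open>a\<close> across the inner product with row \<open>x\<close> of
  \<open>R\<close>, by \<open>apply_adj\<close>, does the work of exchanging two infinite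
  sums.\<close>

lemma apply_op_assoc:
  assumes "hs R" "hs a" "l2 c"
  shows "apply_op (\<lambda>x e. apply_op R (\<lambda>z. a z e) x) c = apply_op R (apply_op a c)"
proof
  fix x
  have l: "l2 (\<lambda>z. cnj (R x z))" using hs_rows[OF assms(1)] by simp
  have f: "apply_op (adj a) (\<lambda>z. cnj (R x z)) = (\<lambda>e. cnj (apply_op R (\<lambda>z. a z e) x))"
    by (simp add: apply_op_def adj_def mult.commute flip: infsum_cnj)
  have "apply_op (\<lambda>x e. apply_op R (\<lambda>z. a z e) x) c x = ip (apply_op (adj a) (\<lambda>z. cnj (R x z))) c"
    unfolding f by (rule apply_op_ip)
  also have "\<dots> = ip (\<lambda>z. cnj (R x z)) (apply_op a c)" by (rule apply_adj[OF assms(2) l assms(3), symmetric])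
  also have "\<dots> = apply_op R (apply_op a c) x" by (rule apply_op_ip[symmetric])
  finally show "apply_op (\<lambda>x e. apply_op R (\<lambda>z. a z e) x) c x = apply_op R (apply_op a c) x" .
qed

lemma hs_compose:
  assumes "hs R" "hs a"
  shows "hs (\<lambda>x e. apply_op R (\<lambda>z. a z e) x)"
proof (rule hsI_rows)
  fix x
  have l: "l2 (\<lambda>z. cnj (R x z))" for x using hs_rows[OF assms(1)] by simp
  have e: "(\<lambda>e. apply_op R (\<lambda>z. a z e) x) = (\<lambda>e. cnj (apply_op (adj a) (\<lambda>z. cnj (R x z)) e))" for x
    by (simp add: apply_op_def adj_def mult.commute flip: infsum_cnj)
  show "l2 (\<lambda>e. apply_op R (\<lambda>z. a z e) x)"
    unfolding e l2_cnj by (intro l2_apply hs_adj assms l)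
  have "nrm2 (\<lambda>e. apply_op R (\<lambda>z. a z e) x) \<le> nrm2 (\<lambda>(x, y). adj a x y) * nrm2 (R x)" for x
    unfolding e nrm2_cnj using l2_apply(2)[OF hs_adj[OF assms(2)] l, of x] by simp
  moreover have "(\<lambda>x. nrm2 (\<lambda>(x, y). adj a x y) * nrm2 (R x)) summable_on UNIV"
    using hs_rows(2)[OF assms(1)] by (intro summable_on_cmult_right) (auto simp: summable_on_def)
  ultimately show "(\<lambda>x. nrm2 (\<lambda>e. apply_op R (\<lambda>z. a z e) x)) summable_on UNIV"
    using nrm2_nonneg by (blast intro: summable_on_comparison_test)
qed

lemma gram_positive:
  assumes "hs a"
  shows "positive_op (gram a)" "hs (gram a)"
proof -
  show p: "positive_op (gram a)" unfolding positive_op_def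
  proof (intro allI impI)
    fix F :: "'a set" and v :: "'a vec"
    assume "finite F"
    have "((\<lambda>e. a x e * cnj (a y e)) has_sum gram a x y) UNIV" for x y
      using ip_has_sum[OF hs_rows(1)[OF assms] hs_rows(1)[OF assms], of y x] by (simp add: gram_ip mult.commute)
    then have "((\<lambda>e. \<Sum>x\<in>F. \<Sum>y\<in>F. cnj (v x) * (a x e * cnj (a y e)) * v y) has_sum
        (\<Sum>x\<in>F. \<Sum>y\<in>F. cnj (v x) * gram a x y * v y)) UNIV"
      by (intro has_sum_finite_sum has_sum_cmult_left has_sum_cmult_right)
    then show "(\<Sum>x\<in>F. \<Sum>y\<in>F. cnj (v x) * gram a x y * v y) \<in> \<real>\<^sub>\<ge>\<^sub>0"
    proof (rule has_sum_nonneg_Reals)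
      fix e
      have "(\<Sum>x\<in>F. \<Sum>y\<in>F. cnj (v x) * (a x e * cnj (a y e)) * v y)
          = (\<Sum>x\<in>F. \<Sum>y\<in>F. (cnj (v x) * a x e) * cnj (cnj (v y) * a y e))"
        by (simp add: mult_ac)
      also have "\<dots> = (\<Sum>x\<in>F. cnj (v x) * a x e) * cnj (\<Sum>x\<in>F. cnj (v x) * a x e)"
        by (simp only: cnj_sum sum_product)
      also have "\<dots> = of_real ((cmod (\<Sum>x\<in>F. cnj (v x) * a x e))\<^sup>2)"
        by (simp add: complex_norm_square del: of_real_power)
      finally show "(\<Sum>x\<in>F. \<Sum>y\<in>F. cnj (v x) * (a x e * cnj (a y e)) * v y) \<in> \<real>\<^sub>\<ge>\<^sub>0"
        by (simp only: nonneg_Reals_of_real_iff) simp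
    qed
  qed
  show "hs (gram a)"
    using hs_rows(2)[OF assms] by (intro positive_op_trace_class_hs p) (auto simp: gram_ip ip_self summable_on_def)
qed

text \<open>Brings the operator under the outer root of the fidelity into the form
  \<open>T T^*\<close> with \<open>T = R a\<close>, so that \<open>op_sqrt_props\<close> applies to
  both roots.\<close>

lemma op_times_gram:
  assumes R: "positive_op R" "hs R" and a: "hs a"
  shows "op_times (op_times R (gram a)) R = gram (\<lambda>x e. apply_op R (\<lambda>z. a z e) x)"
proof (intro ext)
  fix x y
  define T where "T = (\<lambda>x e. apply_op R (\<lambda>z. a z e) x)"
  have hT: "hs T" unfolding T_def by (intro hs_compose R a)
  have RT: "apply_op T c = apply_op R (apply_op a c)" if "l2 c" for c
    unfolding T_def using R(2) a that by (rule apply_op_assoc)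
  have g: "(\<lambda>w. gram a w z) = apply_op a (\<lambda>e. cnj (a z e))" for z
    by (simp add: gram_def apply_op_def)
  have 1: "op_times R (gram a) x z = cnj (apply_op a (\<lambda>e. cnj (T x e)) z)" for z
  proof -
    have "op_times R (gram a) x z = apply_op R (\<lambda>w. gram a w z) x" by (simp add: op_times_def apply_op_def)
    also have "\<dots> = apply_op T (\<lambda>e. cnj (a z e)) x"
      unfolding g by (subst RT) (simp_all add: hs_rows[OF a])
    also have "\<dots> = cnj (apply_op a (\<lambda>e. cnj (T x e)) z)"
      by (simp add: apply_op_def mult.commute flip: infsum_cnj)
    finally show ?thesis .
  qed
  have "op_times (op_times R (gram a)) R x y = cnj (apply_op R (apply_op a (\<lambda>e. cnj (T x e))) y)"
    by (simp add: op_times_def[of "op_times R (gram a)"] 1 apply_op_def[of R] positive_op_hermitian[OF R(1)] mult.commute flip: infsum_cnj)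
  also have "\<dots> = cnj (apply_op T (\<lambda>e. cnj (T x e)) y)"
    by (subst RT) (simp_all add: hs_rows[OF hT])
  also have "\<dots> = gram T x y"
    by (simp add: apply_op_def gram_def mult.commute flip: infsum_cnj)
  finally show "op_times (op_times R (gram a)) R x y = gram (\<lambda>x e. apply_op R (\<lambda>z. a z e) x) x y"
    by (simp add: T_def)
qed

text \<open>Whatever matrix the choice returns, the diagonal of its square fixes the norms of its
  rows. These are the norms of the rows of \<open>a\<close>, so the root is Hilbert-Schmidt and has
  an eigenbasis.\<close>

lemma op_sqrt_props:
  assumes "hs (a :: 'a \<Rightarrow> 'e \<Rightarrow> complex)"
  shows "positive_op (op_sqrt (gram a))" "hs (op_sqrt (gram a))" "gram (op_sqrt (gram a)) = gram a"
proof -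
  define S where "S = op_sqrt (gram a)"
  have "positive_op S \<and> (\<forall>x y. ((\<lambda>z. S x z * S z y) has_sum gram a x y) UNIV)"
    using someI_ex[OF sqrt_exists[OF gram_positive[OF assms]]] unfolding S_def op_sqrt_def .
  then have p: "positive_op S" and S: "((\<lambda>z. S x z * S z y) has_sum gram a x y) UNIV" for x y by auto
  have S': "((\<lambda>z. S x z * cnj (S y z)) has_sum gram a x y) UNIV" for x y
    using S[of x y] by (simp add: positive_op_hermitian[OF p])
  have "((\<lambda>z. complex_of_real ((cmod (S x z))\<^sup>2)) has_sum of_real (nrm2 (a x))) UNIV" for x
    using S'[of x x] by (simp add: complex_norm_square gram_ip ip_self del: of_real_power)
  then have n: "((\<lambda>z. (cmod (S x z))\<^sup>2) has_sum nrm2 (a x)) UNIV" for x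
    by (simp only: has_sum_of_real_iff)
  then have "nrm2 (S x) = nrm2 (a x)" "l2 (S x)" for x
    by (auto simp: nrm2_def[of "S x"] l2_def summable_on_def intro: infsumI)
  then show "hs (op_sqrt (gram a))"
    using hs_rows(2)[OF assms] unfolding S_def[symmetric] by (intro hsI_rows) (auto simp: summable_on_def)
  show "positive_op (op_sqrt (gram a))" using p by (simp add: S_def)
  show "gram (op_sqrt (gram a)) = gram a"
    unfolding S_def[symmetric] using S' by (intro ext) (simp add: gram_def[of S] infsumI)
qed

text \<open>A singular value decomposition of \<open>a\<close>: the \<open>g\<close> are left
  singular vectors, the \<open>s g\<close> singular values, and the last family consists of the
  right singular vectors. For \<open>s g = 0\<close> the norm formula gives
  \<open>a^* g = 0\<close>.\<close>

lemma polar: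
  assumes a: "hs a" and P: "positive_op P" "hs P" "gram a = gram P" and G: "eigenbasis P G s"
  shows "g \<in> G \<Longrightarrow> l2 (apply_op (adj a) g)" "g \<in> G \<Longrightarrow> nrm2 (apply_op (adj a) g) = (s g)\<^sup>2"
    "orthonormal {g \<in> G. s g > 0} (\<lambda>g e. of_real (1 / s g) * apply_op (adj a) g e)"
proof -
  have e: "ip (apply_op (adj a) g) (apply_op (adj a) h) = (if g = h then of_real ((s g)\<^sup>2) else 0)"
    if "g \<in> G" "h \<in> G" for g h
  proof -
    have "adj P = P" using positive_op_hermitian[OF P(1)] by (simp add: adj_def fun_eq_iff)
    moreover have "ip (apply_op (adj a) g) (apply_op (adj a) h) = ip (apply_op (adj P) g) (apply_op (adj P) h)"
      using that by (simp add: gram_form a P(2,3) eigenbasisE(5)[OF G])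
    ultimately show ?thesis using eigenbasisE(1)[OF G] that
      by (simp add: eigenbasisE(4)[OF G] ip_scale_left ip_scale_right orthonormal_def power2_eq_square)
  qed
  show l: "l2 (apply_op (adj a) g)" if "g \<in> G" for g
    using that by (intro l2_apply hs_adj a eigenbasisE(5)[OF G])
  show "g \<in> G \<Longrightarrow> nrm2 (apply_op (adj a) g) = (s g)\<^sup>2"
    using e[of g g] by (simp add: ip_self del: of_real_power)
  have "ip (\<lambda>e. of_real (1 / s g) * apply_op (adj a) g e) (\<lambda>e. of_real (1 / s h) * apply_op (adj a) h e)
      = (if g = h then 1 else 0)" if "g \<in> G" "h \<in> G" "s g > 0" for g h
    unfolding ip_scale_left ip_scale_right e[OF that(1,2)] using that(3) by (auto simp: power2_eq_square)
  then show "orthonormal {g \<in> G. s g > 0} (\<lambda>g e. of_real (1 / s g) * apply_op (adj a) g e)"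
    using l by (auto simp: orthonormal_def simp del: of_real_divide intro!: l2_scale)
qed

lemma hs_bessel:
  assumes a: "hs a" and w: "orthonormal I w" "finite I"
  shows "(\<Sum>i\<in>I. nrm2 (apply_op a (w i))) \<le> nrm2 (\<lambda>(x, y). a x y)"
proof -
  have l: "l2 (w i)" if "i \<in> I" for i using w that by (auto simp: orthonormal_def)
  have "((\<lambda>x. \<Sum>i\<in>I. (cmod (apply_op a (w i) x))\<^sup>2) has_sum (\<Sum>i\<in>I. nrm2 (apply_op a (w i)))) UNIV"
    by (intro has_sum_finite_sum nrm2_has_sum l2_apply a l)
  then show ?thesis
  proof (rule has_sum_mono[OF _ hs_rows(2)[OF a]])
    fix x
    have "(\<Sum>i\<in>I. (cmod (ip (w i) (\<lambda>y. cnj (a x y))))\<^sup>2) \<le> nrm2 (\<lambda>y. cnj (a x y))"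
      using w hs_rows(1)[OF a] by (intro bessel_finite) auto
    moreover have "cmod (ip (w i) (\<lambda>y. cnj (a x y))) = cmod (apply_op a (w i) x)" for i
      unfolding apply_op_ip by (metis ip_cnj complex_mod_cnj)
    ultimately show "(\<Sum>i\<in>I. (cmod (apply_op a (w i) x))\<^sup>2) \<le> nrm2 (a x)" by simp
  qed
qed


lemma norm_sum_mult_le:
  fixes a b :: "'i \<Rightarrow> complex"
  assumes "(\<Sum>i\<in>I. (cmod (a i))\<^sup>2) \<le> p" "(\<Sum>i\<in>I. (cmod (b i))\<^sup>2) \<le> q"
  shows "cmod (\<Sum>i\<in>I. a i * b i) \<le> sqrt p * sqrt q"
proof -
  have "cmod (\<Sum>i\<in>I. a i * b i) \<le> (\<Sum>i\<in>I. \<bar>cmod (a i)\<bar> * \<bar>cmod (b i)\<bar>)"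
    using norm_sum[of "\<lambda>i. a i * b i" I] by (simp add: norm_mult)
  also have "\<dots> \<le> L2_set (\<lambda>i. cmod (a i)) I * L2_set (\<lambda>i. cmod (b i)) I" by (rule L2_set_mult_ineq)
  also have "\<dots> \<le> sqrt p * sqrt q"
    unfolding L2_set_def using order_trans[OF sum_nonneg assms(1)]
    by (intro mult_mono real_sqrt_le_mono assms) (auto intro: sum_nonneg)
  finally show ?thesis .
qed

text \<open>With \<open>R\<close> a root of \<open>a0 a0^*\<close>, \<open>T = R a1\<close> and
  \<open>S\<close> a root of \<open>T T^*\<close>, the fidelity is the trace of \<open>S\<close>,
  which is the trace norm of \<open>T\<close>. The overlap is the trace of \<open>T\<close> times
  the partial isometry that sends the left singular vectors of \<open>a0\<close> to its right ones,
  hence at most that norm in modulus.\<close>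

theorem fidelity_ge_overlap:
  fixes a0 a1 :: "'a \<Rightarrow> 'e \<Rightarrow> complex"
  assumes a0: "hs a0" and a1: "hs a1"
  shows "fidelity (gram a0) (gram a1) \<ge> cmod (ip (\<lambda>(x, e). a0 x e) (\<lambda>(x, e). a1 x e))"
proof -
  define R where "R = op_sqrt (gram a0)"
  define T where "T = (\<lambda>x e. apply_op R (\<lambda>z. a1 z e) x)"
  define S where "S = op_sqrt (gram T)"
  note R = op_sqrt_props[OF a0, folded R_def]
  have T: "hs T" unfolding T_def by (intro hs_compose R a1)
  note S = op_sqrt_props[OF T, folded S_def]
  have fid: "fidelity (gram a0) (gram a1) = Re (op_trace S)"
    unfolding fidelity_def S_def T_def by (simp add: op_times_gram R a1 R_def[symmetric])
  obtain G r where G: "eigenbasis R G r" using spectral_theorem_hs[OF R(2,1)] by blast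
  obtain F s where F: "eigenbasis S F s" using spectral_theorem_hs[OF S(2,1)] by blast
  note pol_R = polar[OF a0 R(1,2) R(3)[symmetric] G]
  note pol_S = polar[OF T S(1,2) S(3)[symmetric] F]
  define t where "t f = (\<lambda>e. of_real (1 / s f) * apply_op (adj T) f e)" for f
  define w where "w g = (\<lambda>e. of_real (1 / r g) * apply_op (adj a0) g e)" for g
  have on_t: "orthonormal {f \<in> F. s f > 0} t" and on_w: "orthonormal {g \<in> G. r g > 0} w"
    using pol_R(3) pol_S(3) by (simp_all only: t_def[abs_def] w_def[abs_def])
  \<comment> \<open>An a priori bound for the trace of \<open>S\<close>. Each \<open>s f\<close> is
    the inner product of \<open>R f\<close> and \<open>a1 (t f)\<close>, hence at most half the sum
    of their squared norms, and \<open>hs_bessel\<close> bounds the sums of these over orthonormal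
    families.\<close>
  define C where "C = (nrm2 (\<lambda>(x, y). R x y) + nrm2 (\<lambda>(x, y). a1 x y)) / 2"
  have "(\<Sum>f\<in>F0. s f) \<le> C" if F0: "finite F0" "F0 \<subseteq> F" for F0
  proof -
    define I where "I = {f \<in> F0. s f > 0}"
    have I: "finite I" "I \<subseteq> {f \<in> F. s f > 0}" using F0 by (auto simp: I_def)
    have "(\<Sum>f\<in>F0. s f) = (\<Sum>f\<in>I. s f)"
      using F0 eigenbasisE(3)[OF F] by (intro sum.mono_neutral_right) (auto simp: I_def less_le)
    also have "\<dots> \<le> (\<Sum>f\<in>I. (nrm2 (apply_op R f) + nrm2 (apply_op a1 (t f))) / 2)"
    proof (rule sum_mono)
      fix f assume "f \<in> I"
      then have f: "f \<in> F" "s f > 0" using I by auto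
      have lt: "l2 (t f)" using on_t f by (simp add: orthonormal_def)
      note lf = eigenbasisE(5)[OF F f(1)]
      have "ip (apply_op R f) (apply_op a1 (t f)) = ip f (apply_op R (apply_op a1 (t f)))"
        by (intro positive_op_apply_sym[symmetric] R lf l2_apply a1 lt)
      also have "\<dots> = ip f (apply_op T (t f))"
        unfolding T_def by (subst apply_op_assoc[OF R(2) a1 lt]) simp
      also have "\<dots> = ip (apply_op (adj T) f) (t f)" by (rule apply_adj[OF T lf lt])
      also have "\<dots> = of_real (s f)"
        using f pol_S(2)[OF f(1)] by (simp only: t_def ip_scale_right ip_self) (simp add: power2_eq_square)
      finally have "s f = cmod (ip (apply_op R f) (apply_op a1 (t f)))" using f by simp
      also have "\<dots> \<le> sqrt (nrm2 (apply_op R f)) * sqrt (nrm2 (apply_op a1 (t f)))"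
        by (intro cauchy_schwarz_sqrt l2_apply R lf a1 lt)
      also have "\<dots> \<le> (nrm2 (apply_op R f) + nrm2 (apply_op a1 (t f))) / 2"
        using arith_geo_mean_sqrt[of "nrm2 (apply_op R f)" "nrm2 (apply_op a1 (t f))"] by (simp add: real_sqrt_mult)
      finally show "s f \<le> (nrm2 (apply_op R f) + nrm2 (apply_op a1 (t f))) / 2" .
    qed
    also have "\<dots> = ((\<Sum>f\<in>I. nrm2 (apply_op R f)) + (\<Sum>f\<in>I. nrm2 (apply_op a1 (t f)))) / 2"
      by (simp only: sum.distrib sum_divide_distrib[symmetric])
    also have "\<dots> \<le> C"
      unfolding C_def using I
      by (intro divide_right_mono add_mono hs_bessel R a1 orthonormal_subset[OF on_t] orthonormal_subset[OF eigenbasisE(1)[OF F]]) auto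
    finally show ?thesis .
  qed
  then have "s summable_on F"
    using eigenbasisE(3)[OF F] by (intro nonneg_bdd_above_summable_on bdd_aboveI[of _ C]) auto
  then obtain tr where tr: "(s has_sum tr) F" by (auto simp: summable_on_def)
  have "op_trace S = of_real tr"
    unfolding op_trace_def by (rule infsumI) (rule eigenbasis_trace[OF S(1,2) F tr])
  then have fid': "fidelity (gram a0) (gram a1) = tr" by (simp add: fid)
  define ov where "ov = ip (\<lambda>(x, e). a0 x e) (\<lambda>(x, e). a1 x e)"
  define v0 v1 where "v0 e = (\<lambda>x. a0 x e)" and "v1 e = (\<lambda>x. a1 x e)" for e
  have lv: "l2 (v0 e)" "l2 (v1 e)" for e unfolding v0_def v1_def by (intro hs_cols a0 a1)+
  have adj_v: "apply_op (adj a0) g = (\<lambda>e. ip (v0 e) g)" "apply_op (adj a1) g = (\<lambda>e. ip (v1 e) g)" for g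
    by (simp_all add: apply_op_def adj_def ip_def v0_def v1_def)
  \<comment> \<open>The overlap is the trace of \<open>a1 a0^*\<close>, here evaluated in the
    eigenbasis of \<open>R\<close>: Parseval expands every pair of columns over \<open>G\<close>,
    and a bound by squares allows the sums over \<open>e\<close> and \<open>g\<close> to be
    exchanged.\<close>
  have sum_ov: "((\<lambda>g. ip (apply_op (adj a1) g) (apply_op (adj a0) g)) has_sum ov) G"
  proof -
    define c where "c = (\<lambda>(e, g). ip (v0 e) g * ip g (v1 e))"
    have "((\<lambda>(x, e). cnj (a0 x e) * a1 x e) has_sum ov) (UNIV \<times> UNIV)"
      using ip_has_sum[OF a0[unfolded hs_def] a1[unfolded hs_def]] by (simp add: ov_def case_prod_unfold)
    then have "((\<lambda>(e, x). cnj (a0 x e) * a1 x e) has_sum ov) (UNIV \<times> UNIV)"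
      by (subst (asm) has_sum_swap) simp
    then have s1: "((\<lambda>e. ip (v0 e) (v1 e)) has_sum ov) UNIV"
      by (rule has_sum_SigmaD) (use ip_has_sum[OF lv] in \<open>simp add: v0_def v1_def\<close>)
    have b: "(\<lambda>(e, g). (cmod (ip g (v0 e)))\<^sup>2 + (cmod (ip g (v1 e)))\<^sup>2) summable_on UNIV \<times> G"
    proof (rule summable_on_SigmaI[where g = "\<lambda>e. nrm2 (v0 e) + nrm2 (v1 e)"])
      fix e
      show "((\<lambda>g. case (e, g) of (e, g) \<Rightarrow> (cmod (ip g (v0 e)))\<^sup>2 + (cmod (ip g (v1 e)))\<^sup>2) has_sum nrm2 (v0 e) + nrm2 (v1 e)) G"
        unfolding prod.case by (intro has_sum_add parseval_nrm2 eigenbasisE(1,2)[OF G] lv)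
      show "(\<lambda>e. nrm2 (v0 e) + nrm2 (v1 e)) summable_on UNIV"
        unfolding v0_def v1_def using hs_cols(2)[OF a0] hs_cols(2)[OF a1]
        by (intro summable_on_add) (auto simp: summable_on_def)
    qed auto
    have "(\<lambda>z. norm (c z)) summable_on UNIV \<times> G"
    proof (rule summable_on_comparison_test[OF b])
      fix z :: "'e \<times> 'a vec"
      obtain e g where z: "z = (e, g)" by force
      have "cmod (ip (v0 e) g) = cmod (ip g (v0 e))" by (metis ip_cnj complex_mod_cnj)
      then have "norm (c z) = cmod (ip g (v0 e)) * cmod (ip g (v1 e))" by (simp add: c_def z norm_mult)
      also have "\<dots> \<le> (cmod (ip g (v0 e)))\<^sup>2 + (cmod (ip g (v1 e)))\<^sup>2"
        using sum_squares_bound[of "cmod (ip g (v0 e))" "cmod (ip g (v1 e))"]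
          mult_nonneg_nonneg[OF norm_ge_zero norm_ge_zero, of "ip g (v0 e)" "ip g (v1 e)"] by linarith
      finally show "norm (c z) \<le> (case z of (e, g) \<Rightarrow> (cmod (ip g (v0 e)))\<^sup>2 + (cmod (ip g (v1 e)))\<^sup>2)"
        by (simp add: z)
    qed simp
    then have "c summable_on UNIV \<times> G" by (rule abs_summable_summable)
    then have "(c has_sum ov) (UNIV \<times> G)"
      by (intro has_sum_SigmaI[OF _ s1]) (auto simp: c_def intro!: parseval eigenbasisE(1,2)[OF G] lv)
    then have "((\<lambda>(g, e). c (e, g)) has_sum ov) (G \<times> UNIV)"
      by (subst (asm) has_sum_swap)
    then show ?thesis
    proof (rule has_sum_SigmaD)
      fix g assume "g \<in> G"
      then have "l2 g" by (rule eigenbasisE(5)[OF G])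
      then have "l2 (apply_op (adj a1) g)" "l2 (apply_op (adj a0) g)" by (auto intro: l2_apply hs_adj a0 a1)
      then have "((\<lambda>e. cnj (apply_op (adj a1) g e) * apply_op (adj a0) g e) has_sum ip (apply_op (adj a1) g) (apply_op (adj a0) g)) UNIV"
        by (rule ip_has_sum)
      then show "((\<lambda>e. case (g, e) of (g, e) \<Rightarrow> c (e, g)) has_sum ip (apply_op (adj a1) g) (apply_op (adj a0) g)) UNIV"
        by (simp add: c_def adj_v ip_cnj mult.commute)
    qed
  qed
  have fin: "cmod (\<Sum>g\<in>G0. ip (apply_op (adj a1) g) (apply_op (adj a0) g)) \<le> tr" if G0: "finite G0" "G0 \<subseteq> G" for G0
  proof -
    define J where "J = {g \<in> G0. r g > 0}"
    have J: "finite J" "J \<subseteq> {g \<in> G. r g > 0}" using G0 by (auto simp: J_def)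
    have on_J: "orthonormal J w" "orthonormal J (\<lambda>g. g)"
      using J by (auto intro: orthonormal_subset[OF on_w] orthonormal_subset[OF eigenbasisE(1)[OF G]])
    have lw: "l2 (w g)" if "g \<in> J" for g using on_J that by (simp add: orthonormal_def)
    have lg: "l2 g" if "g \<in> G" for g using that by (rule eigenbasisE(5)[OF G])
    have "ip (apply_op (adj a1) g) (apply_op (adj a0) g) = 0" if g: "g \<in> G0 - J" for g
    proof -
      have "g \<in> G" "r g = 0" using g G0 eigenbasisE(3)[OF G, of g] by (auto simp: J_def)
      then have "apply_op (adj a0) g = (\<lambda>x. 0)"
        using nrm2_eq_0[OF pol_R(1)] pol_R(2) by (simp add: fun_eq_iff)
      then show ?thesis by simp
    qed
    then have "(\<Sum>g\<in>G0. ip (apply_op (adj a1) g) (apply_op (adj a0) g)) = (\<Sum>g\<in>J. ip (apply_op (adj a1) g) (apply_op (adj a0) g))"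
      using G0 by (intro sum.mono_neutral_right) (auto simp: J_def)
    \<comment> \<open>For \<open>g\<close> in \<open>J\<close> one has
      \<open>T^* g = r g * a1^* g\<close> and \<open>a0^* g = r g * w g\<close>; the two factors
      \<open>r g\<close> cancel and \<open>a1\<close> is replaced by \<open>T\<close>.\<close>
    also have "\<dots> = (\<Sum>g\<in>J. ip g (apply_op T (w g)))"
    proof (rule sum.cong[OF refl])
      fix g assume g: "g \<in> J"
      then have gG: "g \<in> G" "r g > 0" using J by auto
      have "apply_op (adj T) g = (\<lambda>e. of_real (r g) * apply_op (adj a1) g e)"
      proof
        fix e
        have "apply_op (adj T) g e = ip (apply_op R (v1 e)) g"
          unfolding apply_op_def[of "adj T"] unfolding adj_def ip_def T_def v1_def ..
        also have "\<dots> = ip (v1 e) (apply_op R g)"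
          by (intro positive_op_apply_sym[symmetric] R lv lg gG)
        also have "\<dots> = of_real (r g) * apply_op (adj a1) g e"
          by (simp add: eigenbasisE(4)[OF G gG(1)] ip_scale_right adj_v)
        finally show "apply_op (adj T) g e = of_real (r g) * apply_op (adj a1) g e" .
      qed
      then have "ip (apply_op (adj T) g) (w g) = ip (apply_op (adj a1) g) (apply_op (adj a0) g)"
        using gG by (simp only: w_def ip_scale_right ip_scale_left) simp
      then show "ip (apply_op (adj a1) g) (apply_op (adj a0) g) = ip g (apply_op T (w g))"
        by (simp add: apply_adj[OF T lg[OF gG(1)] lw[OF g]])
    qed
    finally have eq: "(\<Sum>g\<in>G0. ip (apply_op (adj a1) g) (apply_op (adj a0) g)) = (\<Sum>g\<in>J. ip g (apply_op T (w g)))" .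
    have "((\<lambda>f. \<Sum>g\<in>J. ip g f * ip f (apply_op T (w g))) has_sum (\<Sum>g\<in>J. ip g (apply_op T (w g)))) F"
      using J by (intro has_sum_finite_sum parseval eigenbasisE(1,2)[OF F] l2_apply T lw lg) auto
    then have "cmod (\<Sum>g\<in>J. ip g (apply_op T (w g))) \<le> tr"
    proof (rule norm_infsum_le[OF _ tr])
      fix f assume f: "f \<in> F"
      note lf = eigenbasisE(5)[OF F f]
      \<comment> \<open>Cauchy-Schwarz over \<open>J\<close>. Bessel's inequality bounds one factor
        by the norm of \<open>f\<close>, the other by the norm of \<open>T^* f\<close>, which is
        \<open>s f\<close>; summing over \<open>f\<close> gives the trace of
        \<open>S\<close>.\<close>
      have "cmod (\<Sum>g\<in>J. ip g f * ip f (apply_op T (w g))) \<le> sqrt 1 * sqrt ((s f)\<^sup>2)"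
      proof (rule norm_sum_mult_le)
        show "(\<Sum>g\<in>J. (cmod (ip g f))\<^sup>2) \<le> 1"
          using bessel_finite[OF on_J(2) J(1) lf] eigenbasisE(6)[OF F f] by simp
        have "(\<Sum>g\<in>J. (cmod (ip (w g) (apply_op (adj T) f)))\<^sup>2) \<le> nrm2 (apply_op (adj T) f)"
          by (intro bessel_finite on_J J l2_apply hs_adj T lf)
        also have "\<dots> = (s f)\<^sup>2" by (rule pol_S(2)[OF f])
        also have "(\<Sum>g\<in>J. (cmod (ip (w g) (apply_op (adj T) f)))\<^sup>2) = (\<Sum>g\<in>J. (cmod (ip f (apply_op T (w g))))\<^sup>2)"
        proof (rule sum.cong[OF refl])
          fix g assume "g \<in> J"
          then have "ip f (apply_op T (w g)) = cnj (ip (w g) (apply_op (adj T) f))"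
            by (simp add: apply_adj[OF T lf lw] ip_cnj)
          then show "(cmod (ip (w g) (apply_op (adj T) f)))\<^sup>2 = (cmod (ip f (apply_op T (w g))))\<^sup>2" by simp
        qed
        finally show "(\<Sum>g\<in>J. (cmod (ip f (apply_op T (w g))))\<^sup>2) \<le> (s f)\<^sup>2" .
      qed
      then show "cmod (\<Sum>g\<in>J. ip g f * ip f (apply_op T (w g))) \<le> s f"
        using eigenbasisE(3)[OF F, of f] by simp
    qed
    then show ?thesis by (simp only: eq)
  qed
  have "cmod ov \<le> tr"
  proof (rule tendsto_upperbound)
    show "((\<lambda>G0. cmod (\<Sum>g\<in>G0. ip (apply_op (adj a1) g) (apply_op (adj a0) g))) \<longlongrightarrow> cmod ov) (finite_subsets_at_top G)"
      using sum_ov unfolding has_sum_def by (rule tendsto_norm)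
  qed (auto intro!: eventually_finite_subsets_at_top_weakI fin)
  then show ?thesis by (simp add: fid' ov_def)
qed



section \<open>Number amplitudes of the beam splitter\<close>

lemma rot_in_Reals:
  assumes "\<And>x. f x \<in> \<real>" shows "rot c d f x \<in> \<real>"
  using assms by (cases x) (auto simp: rot_def create1_def create2_def)

lemma rot_pow_in_Reals: "(\<And>x. f x \<in> \<real>) \<Longrightarrow> (rot c d ^^ n) f x \<in> \<real>"
  by (induction n arbitrary: x) (auto intro: rot_in_Reals)

lemma bs_ket_cnj [simp]: "cnj (bs_ket \<kappa> y x) = bs_ket \<kappa> y x"
proof -
  have "bs_ket \<kappa> y x \<in> \<real>"
    unfolding bs_ket_def case_prod_unfold by (intro Reals_mult rot_pow_in_Reals) (auto simp: ket_def)
  then show ?thesis by (simp add: Reals_cnj_iff)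
qed

lemma rot_commute: "rot c d (rot c' d' f) = rot c' d' (rot c d f)"
proof
  fix x :: "nat \<times> nat"
  obtain p q where "x = (p, q)" by force
  then show "rot c d (rot c' d' f) x = rot c' d' (rot c d f) x"
    by (simp add: rot_def create1_def create2_def algebra_simps)
qed

lemma rot_commute_pow: "rot c d ((rot c' d' ^^ n) f) = (rot c' d' ^^ n) (rot c d f)"
  by (induction n) (simp_all add: rot_commute[of c d])

lemma bs_ket_Suc_signal:
  "of_real (sqrt (Suc m)) * bs_ket \<kappa> (Suc m, k) x = rot (sqrt \<kappa>) (- sqrt (1 - \<kappa>)) (bs_ket \<kappa> (m, k)) x"
proof -
  have "sqrt (Suc m) * (1 / sqrt (fact (Suc m) * fact k)) = 1 / sqrt (fact m * fact k)"
    by (simp add: real_sqrt_mult)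
  then have "complex_of_real (sqrt (Suc m)) * of_real (1 / sqrt (fact (Suc m) * fact k)) = of_real (1 / sqrt (fact m * fact k))"
    by (metis of_real_mult)
  then show ?thesis unfolding bs_ket_def prod.case rot_scale
    by (simp add: mult.assoc[symmetric] del: fact_Suc of_real_divide)
qed

lemma bs_ket_Suc_environment:
  "of_real (sqrt (Suc k)) * bs_ket \<kappa> (m, Suc k) x = rot (sqrt (1 - \<kappa>)) (sqrt \<kappa>) (bs_ket \<kappa> (m, k)) x"
proof -
  have "sqrt (Suc k) * (1 / sqrt (fact m * fact (Suc k))) = 1 / sqrt (fact m * fact k)"
    by (simp add: real_sqrt_mult)
  then have "complex_of_real (sqrt (Suc k)) * of_real (1 / sqrt (fact m * fact (Suc k))) = of_real (1 / sqrt (fact m * fact k))"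
    by (metis of_real_mult)
  then show ?thesis unfolding bs_ket_def prod.case rot_scale
    by (simp add: mult.assoc[symmetric] rot_commute_pow del: fact_Suc of_real_divide)
qed

lemma rot_support:
  assumes "\<And>p q. p + q \<noteq> n \<Longrightarrow> f (p, q) = 0" "p + q \<noteq> Suc n"
  shows "rot c d f (p, q) = 0"
  using assms(1)[of "p - 1" q] assms(1)[of p "q - 1"] assms(2)
  by (cases p; cases q) (auto simp: rot_def create1_def create2_def)

lemma rot_pow_support:
  assumes "\<And>p q. p + q \<noteq> n \<Longrightarrow> f (p, q) = 0"
  shows "p + q \<noteq> n + m \<Longrightarrow> (rot c d ^^ m) f (p, q) = 0"
proof (induction m arbitrary: p q)
  case (Suc m)
  show ?case using rot_support[of "n + m" "(rot c d ^^ m) f" p q c d] Suc by simp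
qed (use assms in simp)

text \<open>Each application of \<open>rot\<close> raises the total photon number by one, starting
  from the vacuum.\<close>

lemma bs_ket_support:
  assumes "p + q \<noteq> m + k" shows "bs_ket \<kappa> (m, k) (p, q) = 0"
proof -
  have "(rot (sqrt (1 - \<kappa>)) (sqrt \<kappa>) ^^ k) (ket (0, 0)) (p, q) = 0" if "p + q \<noteq> k" for p q
    using rot_pow_support[of 0 "ket (0, 0)" p q k] that by (auto simp: ket_def)
  then show ?thesis
    using rot_pow_support[of k "(rot (sqrt (1 - \<kappa>)) (sqrt \<kappa>) ^^ k) (ket (0, 0))" p q m] assms
    by (simp add: bs_ket_def add.commute)
qed

lemma l2_finite_support: "finite {x. f x \<noteq> 0} \<Longrightarrow> l2 f"
  unfolding l2_def by (rule finite_nonzero_values_imp_summable_on) simp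

lemma finite_total_pair: "finite {(p, q). p + q \<le> (n :: nat)}"
  by (rule finite_subset[of _ "{..n} \<times> {..n}"]) auto

lemma finite_bs_ket: "finite {x. bs_ket \<kappa> y x \<noteq> 0}"
proof -
  obtain m k where y: "y = (m, k)" by force
  have "{x. bs_ket \<kappa> y x \<noteq> 0} \<subseteq> {(p, q). p + q \<le> m + k}"
  proof clarify
    fix p q assume "bs_ket \<kappa> y (p, q) \<noteq> 0"
    then have "p + q = m + k" using bs_ket_support y by blast
    then show "p + q \<le> m + k" by simp
  qed
  then show ?thesis using finite_total_pair by (rule finite_subset)
qed

lemma l2_bs_ket: "l2 (bs_ket \<kappa> y)"
  by (rule l2_finite_support) (rule finite_bs_ket)

section \<open>Adjoint ladder operators and norms of the beam splitter amplitudes\<close>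

lemma create1_adjoint: "ip (create1 f) g = ip f (annih1 g)"
proof -
  have "ip (create1 f) g = (\<Sum>\<^sub>\<infinity>(p, q)\<in>range (\<lambda>(p :: nat, q :: nat). (Suc p, q)). cnj (create1 f (p, q)) * g (p, q))"
    unfolding ip_def
  proof (rule infsum_cong_neutral)
    fix x :: "nat \<times> nat" assume "x \<in> UNIV - range (\<lambda>(p, q). (Suc p, q))"
    then have "fst x = 0" by (cases x; cases "fst x") auto
    then show "cnj (create1 f x) * g x = 0" by (cases x) (simp add: create1_def)
  qed (auto simp: case_prod_unfold)
  also have "\<dots> = (\<Sum>\<^sub>\<infinity>(p, q). cnj (create1 f (Suc p, q)) * g (Suc p, q))"
    by (subst infsum_reindex) (auto simp: inj_on_def o_def case_prod_unfold)
  also have "\<dots> = ip f (annih1 g)"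
    by (simp add: ip_def create1_def annih1_def case_prod_unfold algebra_simps)
  finally show ?thesis .
qed

lemma create2_adjoint: "ip (create2 f) g = ip f (annih2 g)"
proof -
  have "ip (create2 f) g = (\<Sum>\<^sub>\<infinity>(p, q)\<in>range (\<lambda>(p :: nat, q :: nat). (p, Suc q)). cnj (create2 f (p, q)) * g (p, q))"
    unfolding ip_def
  proof (rule infsum_cong_neutral)
    fix x :: "nat \<times> nat" assume "x \<in> UNIV - range (\<lambda>(p, q). (p, Suc q))"
    then have "snd x = 0" by (cases x; cases "snd x") auto
    then show "cnj (create2 f x) * g x = 0" by (cases x) (simp add: create2_def)
  qed (auto simp: case_prod_unfold)
  also have "\<dots> = (\<Sum>\<^sub>\<infinity>(p, q). cnj (create2 f (p, Suc q)) * g (p, Suc q))"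
    by (subst infsum_reindex) (auto simp: inj_on_def o_def case_prod_unfold)
  also have "\<dots> = ip f (annih2 g)"
    by (simp add: ip_def create2_def annih2_def case_prod_unfold algebra_simps)
  finally show ?thesis .
qed

lemma l2_ladder:
  assumes "finite {x. f x \<noteq> 0}"
  shows "l2 (create1 f)" "l2 (create2 f)" "l2 (annih1 f)" "l2 (annih2 f)"
proof -
  have fin: "finite {x. f x \<noteq> 0}" using assms .
  have "{x. create1 f x \<noteq> 0} \<subseteq> (\<lambda>(p, q). (Suc p, q)) ` {x. f x \<noteq> 0}"
  proof safe
    fix p q assume "create1 f (p, q) \<noteq> 0"
    then show "(p, q) \<in> (\<lambda>(p, q). (Suc p, q)) ` {x. f x \<noteq> 0}" by (cases p) (auto simp: create1_def)
  qed
  then show "l2 (create1 f)" by (intro l2_finite_support) (rule finite_subset, auto simp: fin)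
  have "{x. create2 f x \<noteq> 0} \<subseteq> (\<lambda>(p, q). (p, Suc q)) ` {x. f x \<noteq> 0}"
  proof safe
    fix p q assume "create2 f (p, q) \<noteq> 0"
    then show "(p, q) \<in> (\<lambda>(p, q). (p, Suc q)) ` {x. f x \<noteq> 0}" by (cases q) (auto simp: create2_def)
  qed
  then show "l2 (create2 f)" by (intro l2_finite_support) (rule finite_subset, auto simp: fin)
  have "{x. annih1 f x \<noteq> 0} \<subseteq> (\<lambda>(p, q). (p - 1, q)) ` {x. f x \<noteq> 0}"
    by (force simp: annih1_def image_iff)
  then show "l2 (annih1 f)" by (intro l2_finite_support) (rule finite_subset, auto simp: fin)
  have "{x. annih2 f x \<noteq> 0} \<subseteq> (\<lambda>(p, q). (p, q - 1)) ` {x. f x \<noteq> 0}"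
    by (force simp: annih2_def image_iff)
  then show "l2 (annih2 f)" by (intro l2_finite_support) (rule finite_subset, auto simp: fin)
qed

lemma rot_bs_adjoint:
  "ip (rot c d (bs_ket \<kappa> y)) (bs_ket \<kappa> y') =
   ip (bs_ket \<kappa> y) (\<lambda>x. of_real c * annih1 (bs_ket \<kappa> y') x + of_real d * annih2 (bs_ket \<kappa> y') x)"
proof -
  note l = l2_ladder[OF finite_bs_ket[of \<kappa> y]] l2_ladder[OF finite_bs_ket[of \<kappa> y']] l2_bs_ket[of \<kappa> y] l2_bs_ket[of \<kappa> y']
  have "ip (rot c d (bs_ket \<kappa> y)) (bs_ket \<kappa> y') = of_real c * ip (create1 (bs_ket \<kappa> y)) (bs_ket \<kappa> y')
      + of_real d * ip (create2 (bs_ket \<kappa> y)) (bs_ket \<kappa> y')"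
    unfolding rot_def using l by (subst ip_add_left) (auto simp: ip_scale_left intro: l2_scale)
  also have "\<dots> = of_real c * ip (bs_ket \<kappa> y) (annih1 (bs_ket \<kappa> y')) + of_real d * ip (bs_ket \<kappa> y) (annih2 (bs_ket \<kappa> y'))"
    by (simp only: create1_adjoint create2_adjoint)
  also have "\<dots> = ip (bs_ket \<kappa> y) (\<lambda>x. of_real c * annih1 (bs_ket \<kappa> y') x + of_real d * annih2 (bs_ket \<kappa> y') x)"
    using l by (subst ip_add_right) (auto simp: ip_scale_right intro: l2_scale)
  finally show ?thesis .
qed

text \<open>The two Heisenberg relations solved for their right-hand sides; their coefficients form
  a rotation matrix.\<close>

lemma bs_ket_annih:
  assumes "0 \<le> \<kappa>" "\<kappa> \<le> 1"
  shows "of_real (sqrt \<kappa>) * annih1 (bs_ket \<kappa> (m, k)) x + of_real (- sqrt (1 - \<kappa>)) * annih2 (bs_ket \<kappa> (m, k)) x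
      = of_real (sqrt m) * bs_ket \<kappa> (m - 1, k) x"
    and "of_real (sqrt (1 - \<kappa>)) * annih1 (bs_ket \<kappa> (m, k)) x + of_real (sqrt \<kappa>) * annih2 (bs_ket \<kappa> (m, k)) x
      = of_real (sqrt k) * bs_ket \<kappa> (m, k - 1) x"
proof -
  define A B where "A = complex_of_real (sqrt \<kappa>)" and "B = complex_of_real (sqrt (1 - \<kappa>))"
  define f g where "f = of_real (sqrt m) * bs_ket \<kappa> (m - 1, k) x" and "g = of_real (sqrt k) * bs_ket \<kappa> (m, k - 1) x"
  have "sqrt \<kappa> * sqrt \<kappa> + sqrt (1 - \<kappa>) * sqrt (1 - \<kappa>) = 1" using assms by simp
  then have AB: "A * A + B * B = 1" unfolding A_def B_def by (metis of_real_1 of_real_add of_real_mult)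
  have a: "annih1 (bs_ket \<kappa> (m, k)) x = A * f + B * g" "annih2 (bs_ket \<kappa> (m, k)) x = A * g - B * f"
    by (simp_all add: beam_splitter_heisenberg_signal beam_splitter_heisenberg_environment A_def B_def f_def g_def)
  have "A * (A * f + B * g) + - B * (A * g - B * f) = (A * A + B * B) * f" by (simp add: algebra_simps)
  then show "of_real (sqrt \<kappa>) * annih1 (bs_ket \<kappa> (m, k)) x + of_real (- sqrt (1 - \<kappa>)) * annih2 (bs_ket \<kappa> (m, k)) x
      = of_real (sqrt m) * bs_ket \<kappa> (m - 1, k) x"
    unfolding a AB by (simp add: A_def B_def f_def)
  have "B * (A * f + B * g) + A * (A * g - B * f) = (A * A + B * B) * g" by (simp add: algebra_simps)
  then show "of_real (sqrt (1 - \<kappa>)) * annih1 (bs_ket \<kappa> (m, k)) x + of_real (sqrt \<kappa>) * annih2 (bs_ket \<kappa> (m, k)) x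
      = of_real (sqrt k) * bs_ket \<kappa> (m, k - 1) x"
    unfolding a AB by (simp add: A_def B_def g_def)
qed

text \<open>A creation operator moved across the inner product becomes an annihilation operator,
  which lowers the other side with the same factor. The purpose is the bound
  \<open>bs_ket_le_1\<close>, on which the summability over the thermal state rests.\<close>

lemma nrm2_bs_ket:
  assumes "0 \<le> \<kappa>" "\<kappa> \<le> 1" shows "nrm2 (bs_ket \<kappa> (m, k)) = 1"
proof -
  define b where "b = bs_ket \<kappa>"
  have "ip (b (m, k)) (b (m, k)) = 1"
  proof (induction m)
    case 0
    show ?case
    proof (induction k)
      case 0
      have "b (0, 0) = ket (0, 0)" by (simp add: b_def bs_ket_def)
      then show ?case by (simp only: ip_self nrm2_ket of_real_1)
    next
      case (Suc k)
      have "of_real (sqrt (Suc k)) * ip (b (0, Suc k)) (b (0, Suc k))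
          = ip (rot (sqrt (1 - \<kappa>)) (sqrt \<kappa>) (b (0, k))) (b (0, Suc k))"
        unfolding b_def bs_ket_Suc_environment[symmetric] ip_scale_left by simp
      also have "\<dots> = ip (b (0, k)) (\<lambda>x. of_real (sqrt (1 - \<kappa>)) * annih1 (b (0, Suc k)) x + of_real (sqrt \<kappa>) * annih2 (b (0, Suc k)) x)"
        unfolding b_def by (rule rot_bs_adjoint)
      also have "(\<lambda>x. of_real (sqrt (1 - \<kappa>)) * annih1 (b (0, Suc k)) x + of_real (sqrt \<kappa>) * annih2 (b (0, Suc k)) x)
          = (\<lambda>x. of_real (sqrt (Suc k)) * b (0, k) x)"
        unfolding b_def bs_ket_annih[OF assms] by simp
      finally show ?case using Suc by (simp add: ip_scale_right del: of_nat_Suc)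
    qed
  next
    case (Suc m)
    have "of_real (sqrt (Suc m)) * ip (b (Suc m, k)) (b (Suc m, k))
        = ip (rot (sqrt \<kappa>) (- sqrt (1 - \<kappa>)) (b (m, k))) (b (Suc m, k))"
      unfolding b_def bs_ket_Suc_signal[symmetric] ip_scale_left by simp
    also have "\<dots> = ip (b (m, k)) (\<lambda>x. of_real (sqrt \<kappa>) * annih1 (b (Suc m, k)) x + of_real (- sqrt (1 - \<kappa>)) * annih2 (b (Suc m, k)) x)"
      unfolding b_def by (rule rot_bs_adjoint)
    also have "(\<lambda>x. of_real (sqrt \<kappa>) * annih1 (b (Suc m, k)) x + of_real (- sqrt (1 - \<kappa>)) * annih2 (b (Suc m, k)) x)
        = (\<lambda>x. of_real (sqrt (Suc m)) * b (m, k) x)"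
      unfolding b_def bs_ket_annih[OF assms] by simp
    finally show ?case using Suc by (simp add: ip_scale_right del: of_nat_Suc)
  qed
  then show ?thesis by (simp add: b_def ip_self)
qed

lemma bs_ket_le_1:
  assumes "0 \<le> \<kappa>" "\<kappa> \<le> 1" shows "cmod (bs_ket \<kappa> (m, k) x) \<le> 1"
proof -
  have "(cmod (bs_ket \<kappa> (m, k) x))\<^sup>2 \<le> 1\<^sup>2"
    using nrm2_finite_le[OF l2_bs_ket, of "{x}" \<kappa> "(m, k)"] nrm2_bs_ket[OF assms] by simp
  then show ?thesis by (rule power2_le_imp_le) simp
qed

text \<open>With the signal in the vacuum the environment photons split binomially between the two
  ports. These amplitudes supply the initial value of the recurrence for the channel.\<close>

lemma bs_ket_vacuum:
  assumes "0 \<le> \<kappa>" "\<kappa> \<le> 1"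
  shows "bs_ket \<kappa> (0, x + q) (x, q) = of_real (sqrt (real ((x + q) choose x) * (1 - \<kappa>) ^ x * \<kappa> ^ q))"
proof (induction x arbitrary: q)
  case 0
  show ?case
  proof (induction q)
    case 0
    then show ?case by (simp add: bs_ket_def ket_def)
  next
    case (Suc q)
    have "of_real (sqrt (Suc q)) * bs_ket \<kappa> (0, Suc q) (0, Suc q) = of_real (sqrt (Suc q)) * (of_real (sqrt \<kappa>) * bs_ket \<kappa> (0, q) (0, q))"
      using beam_splitter_heisenberg_environment[of \<kappa> 0 "Suc q" "(0, q)"] by (simp add: annih2_def)
    then have "bs_ket \<kappa> (0, Suc q) (0, Suc q) = of_real (sqrt \<kappa>) * bs_ket \<kappa> (0, q) (0, q)"
      by (simp del: of_nat_Suc)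
    then show ?case using Suc by (simp add: real_sqrt_mult)
  qed
next
  case (Suc x)
  have "of_real (sqrt (Suc x)) * bs_ket \<kappa> (0, Suc x + q) (Suc x, q)
      = of_real (sqrt (1 - \<kappa>) * sqrt (Suc x + q)) * bs_ket \<kappa> (0, x + q) (x, q)"
    using beam_splitter_heisenberg_signal[of \<kappa> 0 "Suc x + q" "(x, q)"] by (simp add: annih1_def)
  also have "\<dots> = of_real (sqrt ((1 - \<kappa>) * (Suc x + q) * (real ((x + q) choose x) * (1 - \<kappa>) ^ x * \<kappa> ^ q)))"
    unfolding Suc by (simp add: real_sqrt_mult)
  also have "(1 - \<kappa>) * (Suc x + q) * (real ((x + q) choose x) * (1 - \<kappa>) ^ x * \<kappa> ^ q)
      = Suc x * (real ((Suc x + q) choose Suc x) * (1 - \<kappa>) ^ Suc x * \<kappa> ^ q)"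
  proof -
    have "Suc x * ((Suc x + q) choose Suc x) = (Suc x + q) * ((x + q) choose x)"
      using Suc_times_binomial[of x "x + q"] by simp
    then have "real (Suc x) * real ((Suc x + q) choose Suc x) = real (Suc x + q) * real ((x + q) choose x)"
      by (metis of_nat_mult)
    then have "real (Suc x) * real ((Suc x + q) choose Suc x) * ((1 - \<kappa>) ^ Suc x * \<kappa> ^ q)
        = real (Suc x + q) * real ((x + q) choose x) * ((1 - \<kappa>) ^ Suc x * \<kappa> ^ q)" by simp
    then show ?thesis by (simp only: mult_ac power_Suc)
  qed
  also have "complex_of_real (sqrt (Suc x * (real ((Suc x + q) choose Suc x) * (1 - \<kappa>) ^ Suc x * \<kappa> ^ q)))
      = of_real (sqrt (Suc x)) * of_real (sqrt (real ((Suc x + q) choose Suc x) * (1 - \<kappa>) ^ Suc x * \<kappa> ^ q))"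
    by (simp only: real_sqrt_mult of_real_mult)
  finally show ?case by (simp del: of_nat_Suc binomial_Suc_Suc)
qed



section \<open>Matrix elements of the thermal loss channel\<close>

definition thermal_weight :: "real \<Rightarrow> nat \<Rightarrow> real" where
  "thermal_weight N n = N ^ n / (N + 1) ^ (n + 1)"

definition channel_entry :: "real \<Rightarrow> real \<Rightarrow> nat \<Rightarrow> nat \<Rightarrow> nat \<Rightarrow> nat \<Rightarrow> complex" where
  "channel_entry \<kappa> N a b x y = thermal_loss \<kappa> N (outer (ket a) (ket b)) x y"

lemma thermal_state_entry: "thermal_state N x y = (if x = y then of_real (thermal_weight N x) else 0)"
proof -
  have "((\<lambda>n. complex_of_real (N ^ n / (N + 1) ^ (n + 1)) * outer (ket n) (ket n) x y) has_sum
      (if x = y then of_real (thermal_weight N x) else 0)) UNIV"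
    by (rule has_sum_finite_neutralI[of "{x}"]) (auto simp: outer_def ket_def thermal_weight_def)
  then show ?thesis unfolding thermal_state_def by (rule infsumI)
qed

lemma summable_linear_geometric:
  fixes r :: real
  assumes "0 \<le> r" "r < 1" "0 \<le> c"
  shows "(\<lambda>n :: nat. (c + real n) * r ^ n) summable_on UNIV"
proof -
  have "summable (\<lambda>n. c * r ^ n + (real (Suc n) * r ^ n - r ^ n))"
    using assms geometric_deriv_sums[of r]
    by (intro summable_add summable_diff summable_mult summable_geometric) (auto simp: sums_iff)
  then have "summable (\<lambda>n. (c + real n) * r ^ n)" by (simp add: algebra_simps)
  then show ?thesis by (rule summable_nonneg_imp_summable_on) (use assms in simp)
qed

lemma thermal_weight_le:
  assumes "0 \<le> N" shows "0 \<le> thermal_weight N n" "thermal_weight N n \<le> (N / (N + 1)) ^ n"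
proof -
  show "0 \<le> thermal_weight N n" using assms by (simp add: thermal_weight_def)
  have "thermal_weight N n = (N / (N + 1)) ^ n * (1 / (N + 1))"
    by (simp add: thermal_weight_def power_divide)
  also have "\<dots> \<le> (N / (N + 1)) ^ n * 1" using assms by (intro mult_left_mono) auto
  finally show "thermal_weight N n \<le> (N / (N + 1)) ^ n" by simp
qed

text \<open>Photon conservation confines the double sum to a line on which \<open>n\<close>
  determines \<open>q\<close>. The linear factor makes room for the square roots that ladder
  operators introduce.\<close>

lemma thermal_summable:
  assumes N: "0 \<le> N" and f0: "\<And>q n. x + q \<noteq> a + n \<Longrightarrow> f (q, n) = 0"
    and le: "\<And>q n. x + q = a + n \<Longrightarrow> cmod (f (q, n)) \<le> thermal_weight N n * (c + real n)"
    and c: "c \<ge> 0"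
  shows "f summable_on UNIV"
proof -
  define D where "D = {(q, n). x + q = a + n}"
  define g where "g n = (c + real n) * (N / (N + 1)) ^ n" for n
  have "g summable_on UNIV" unfolding g_def using N c by (intro summable_linear_geometric) (auto simp: field_simps)
  then have "g summable_on snd ` D" by (rule summable_on_subset_banach) auto
  then have "(g \<circ> snd) summable_on D"
    by (subst (asm) summable_on_reindex) (auto simp: D_def inj_on_def)
  then have "(\<lambda>z. norm (f z)) summable_on D"
  proof (rule summable_on_comparison_test)
    fix z assume "z \<in> D"
    then obtain q n where z: "z = (q, n)" "x + q = a + n" by (auto simp: D_def)
    have "cmod (f (q, n)) \<le> thermal_weight N n * (c + real n)" using z by (intro le)
    also have "\<dots> \<le> (N / (N + 1)) ^ n * (c + real n)"
      using c by (intro mult_right_mono thermal_weight_le N) auto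
    finally show "norm (f z) \<le> (g \<circ> snd) z" by (simp add: g_def z mult.commute)
  qed simp
  then have "f summable_on D" by (rule abs_summable_summable)
  then show ?thesis
    by (subst summable_on_cong_neutral[of D UNIV f f]) (auto simp: D_def f0)
qed

lemma sqrt_le_Suc: "sqrt (real n) \<le> 1 + real n"
  by (rule real_le_lsqrt) (auto simp: power2_eq_square algebra_simps)

text \<open>These are the sums \<open>T\<close>, \<open>Z\<close> and \<open>Y\<close> of
  \<open>channel_entry_rec\<close>. The support is read off the amplitude that contains no truncated
  difference.\<close>

lemma channel_summable:
  assumes k: "0 \<le> \<kappa>" "\<kappa> \<le> 1" and N: "0 \<le> N"
  shows "(\<lambda>(q, n). of_real (thermal_weight N n) * bs_ket \<kappa> (a, n) (x, q) * bs_ket \<kappa> (b, n) (y, q)) summable_on UNIV" (is ?A)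
    and "(\<lambda>(q, n). of_real (thermal_weight N n * sqrt q) * bs_ket \<kappa> (a, n) (x, q - 1) * bs_ket \<kappa> (b, n) (y, q)) summable_on UNIV" (is ?B)
    and "(\<lambda>(q, n). of_real (thermal_weight N n * sqrt n) * bs_ket \<kappa> (a, n) (x, q) * bs_ket \<kappa> (b, n - 1) (y, q)) summable_on UNIV" (is ?C)
proof -
  have bb: "cmod (bs_ket \<kappa> (m, n) z * bs_ket \<kappa> (m', n') z') \<le> 1" for m n z m' n' z'
    unfolding norm_mult by (intro mult_le_one bs_ket_le_1 k) auto
  have b: "cmod (of_real (thermal_weight N n * t) * bs_ket \<kappa> (m, n') z * bs_ket \<kappa> (m', n'') z') \<le> thermal_weight N n * c"
    if "0 \<le> t" "t \<le> c" for n t c m n' z m' n'' z'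
  proof -
    have "cmod (of_real (thermal_weight N n * t) * bs_ket \<kappa> (m, n') z * bs_ket \<kappa> (m', n'') z')
        = thermal_weight N n * t * cmod (bs_ket \<kappa> (m, n') z * bs_ket \<kappa> (m', n'') z')"
      using thermal_weight_le(1)[OF N] that by (simp add: norm_mult abs_mult)
    also have "\<dots> \<le> thermal_weight N n * c * 1"
      using thermal_weight_le(1)[OF N] that by (intro mult_mono bb) auto
    finally show ?thesis by simp
  qed
  show ?A
  proof (rule thermal_summable[OF N, of x a _ 1]; (unfold prod.case)?)
    show "cmod (of_real (thermal_weight N n) * bs_ket \<kappa> (a, n) (x, q) * bs_ket \<kappa> (b, n) (y, q)) \<le> thermal_weight N n * (1 + real n)" for q n
      using b[of 1 "1 + real n" n] by simp
  qed (auto simp: bs_ket_support)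
  show ?B
  proof (rule thermal_summable[OF N, of y b _ "1 + real b"]; (unfold prod.case)?)
    fix q n assume "y + q = b + n"
    then have "sqrt (real q) \<le> 1 + real b + real n" using sqrt_le_Suc[of q] by simp
    then show "cmod (of_real (thermal_weight N n * sqrt q) * bs_ket \<kappa> (a, n) (x, q - 1) * bs_ket \<kappa> (b, n) (y, q)) \<le> thermal_weight N n * (1 + real b + real n)"
      by (intro b) auto
  qed (auto simp: bs_ket_support)
  show ?C
  proof (rule thermal_summable[OF N, of x a _ 1]; (unfold prod.case)?)
    show "cmod (of_real (thermal_weight N n * sqrt n) * bs_ket \<kappa> (a, n) (x, q) * bs_ket \<kappa> (b, n - 1) (y, q)) \<le> thermal_weight N n * (1 + real n)" for q n
      by (intro b sqrt_le_Suc) auto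
  qed (auto simp: bs_ket_support)
qed

lemma channel_entry_eq:
  assumes k: "0 \<le> \<kappa>" "\<kappa> \<le> 1" and N: "0 \<le> N"
  shows "channel_entry \<kappa> N a b x y =
    (\<Sum>\<^sub>\<infinity>(q, n). of_real (thermal_weight N n) * bs_ket \<kappa> (a, n) (x, q) * bs_ket \<kappa> (b, n) (y, q))"
proof -
  define U where "U = beam_splitter \<kappa>"
  have 1: "op_times U (tensor_op (outer (ket a) (ket b)) (thermal_state N)) z (b', n) =
      (if b' = b then of_real (thermal_weight N n) * bs_ket \<kappa> (a, n) z else 0)" for z b' n
    unfolding op_times_def
  proof (rule infsumI, rule has_sum_finite_neutralI[of "{(a, n)}"])
    fix z' assume "z' \<in> UNIV - {(a, n)}"
    then show "U z z' * tensor_op (outer (ket a) (ket b)) (thermal_state N) z' (b', n) = 0"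
      by (cases z') (auto simp: tensor_op_def outer_def ket_def thermal_state_entry)
  qed (auto simp: tensor_op_def outer_def ket_def thermal_state_entry U_def beam_splitter_def)
  have 2: "op_times (op_times U (tensor_op (outer (ket a) (ket b)) (thermal_state N))) (adjoint_op U) (x, q) (y, q)
      = (\<Sum>\<^sub>\<infinity>n. of_real (thermal_weight N n) * bs_ket \<kappa> (a, n) (x, q) * bs_ket \<kappa> (b, n) (y, q))" for q
  proof -
    have "op_times (op_times U (tensor_op (outer (ket a) (ket b)) (thermal_state N))) (adjoint_op U) (x, q) (y, q)
        = (\<Sum>\<^sub>\<infinity>z\<in>range (Pair b). op_times U (tensor_op (outer (ket a) (ket b)) (thermal_state N)) (x, q) z * bs_ket \<kappa> z (y, q))"
      unfolding op_times_def[of "op_times _ _"]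
    proof (rule infsum_cong_neutral)
      fix z :: "nat \<times> nat" assume "z \<in> UNIV - range (Pair b)"
      then have "fst z \<noteq> b" by (cases z) auto
      then show "op_times U (tensor_op (outer (ket a) (ket b)) (thermal_state N)) (x, q) z * adjoint_op U z (y, q) = 0"
        by (cases z) (simp add: 1)
    qed (auto simp: adjoint_op_def U_def beam_splitter_def)
    also have "\<dots> = (\<Sum>\<^sub>\<infinity>n. of_real (thermal_weight N n) * bs_ket \<kappa> (a, n) (x, q) * bs_ket \<kappa> (b, n) (y, q))"
      by (subst infsum_reindex) (auto simp: inj_on_def o_def 1)
    finally show ?thesis .
  qed
  have "channel_entry \<kappa> N a b x y = (\<Sum>\<^sub>\<infinity>q. \<Sum>\<^sub>\<infinity>n. of_real (thermal_weight N n) * bs_ket \<kappa> (a, n) (x, q) * bs_ket \<kappa> (b, n) (y, q))"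
    unfolding channel_entry_def thermal_loss_def partial_trace_snd_def U_def[symmetric] 2 ..
  also have "\<dots> = (\<Sum>\<^sub>\<infinity>(q, n)\<in>UNIV \<times> UNIV. of_real (thermal_weight N n) * bs_ket \<kappa> (a, n) (x, q) * bs_ket \<kappa> (b, n) (y, q))"
    by (rule infsum_Sigma'_banach) (use channel_summable(1)[OF assms] in simp)
  finally show ?thesis by simp
qed

section \<open>Recurrence of the channel in the input photon number\<close>

lemma channel_entry_flip:
  assumes k: "0 \<le> \<kappa>" "\<kappa> \<le> 1" and N: "0 \<le> N"
  shows "channel_entry \<kappa> N a b x y = channel_entry \<kappa> N b a y x"
  unfolding channel_entry_eq[OF assms] by (simp add: mult_ac)

lemma infsum_lincomb:
  fixes f g :: "'a \<Rightarrow> 'b :: real_normed_field"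
  assumes "f summable_on A" "g summable_on A"
  shows "(\<Sum>\<^sub>\<infinity>x\<in>A. a * f x + b * g x) = a * infsum f A + b * infsum g A"
  using assms by (subst infsum_add) (auto intro: summable_on_cmult_right simp: infsum_cmult_right')

lemma infsum_shift_fst:
  fixes f :: "nat \<times> 'b \<Rightarrow> 'c :: {comm_monoid_add, t2_space}"
  assumes "\<And>n. f (0, n) = 0"
  shows "infsum f UNIV = (\<Sum>\<^sub>\<infinity>(q, n). f (Suc q, n))"
proof -
  have "infsum f UNIV = infsum f (range (\<lambda>(q, n). (Suc q, n)))"
  proof (rule infsum_cong_neutral)
    fix z assume "z \<in> UNIV - range (\<lambda>(q, n). (Suc q, n :: 'b))"
    then have "fst z = 0" by (cases z; cases "fst z") auto
    then show "f z = 0" using assms by (cases z) auto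
  qed auto
  also have "\<dots> = (\<Sum>\<^sub>\<infinity>(q, n). f (Suc q, n))"
    by (subst infsum_reindex) (auto simp: inj_on_def o_def case_prod_unfold)
  finally show ?thesis .
qed

lemma infsum_shift_snd:
  fixes f :: "'b \<times> nat \<Rightarrow> 'c :: {comm_monoid_add, t2_space}"
  assumes "\<And>q. f (q, 0) = 0"
  shows "infsum f UNIV = (\<Sum>\<^sub>\<infinity>(q, n). f (q, Suc n))"
proof -
  have "infsum f UNIV = infsum f (range (\<lambda>(q, n). (q, Suc n)))"
  proof (rule infsum_cong_neutral)
    fix z assume "z \<in> UNIV - range (\<lambda>(q :: 'b, n). (q, Suc n))"
    then have "snd z = 0" by (cases z; cases "snd z") auto
    then show "f z = 0" using assms by (cases z) auto
  qed auto
  also have "\<dots> = (\<Sum>\<^sub>\<infinity>(q, n). f (q, Suc n))"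
    by (subst infsum_reindex) (auto simp: inj_on_def o_def case_prod_unfold)
  finally show ?thesis .
qed

text \<open>With \<open>\<Phi>\<close> the channel, this is the matrix form of
  \<open>\<Phi>(a\<^sup>* \<rho>) = (\<surd>\<kappa> / G) a\<^sup>* \<Phi>(\<rho>) + (1 - \<kappa> / G) \<Phi>(\<rho> a\<^sup>*)\<close>.  The partial trace lets \<open>a\<^sub>2\<^sup>*\<close> be moved
  cyclically around \<open>U (\<rho> \<otimes> \<theta>) U\<^sup>*\<close>, and \<open>\<theta> a\<^sup>* = N / (N + 1) a\<^sup>* \<theta>\<close> for the thermal state \<open>\<theta>\<close>.\<close>

lemma channel_entry_rec:
  assumes k: "0 \<le> \<kappa>" "\<kappa> \<le> 1" and N: "0 \<le> N" and G: "G = (1 - \<kappa>) * N + 1"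
  shows "of_real (sqrt (Suc a)) * channel_entry \<kappa> N (Suc a) b x y =
      of_real (sqrt \<kappa> / G * sqrt x) * channel_entry \<kappa> N a b (x - 1) y
    + of_real ((1 - \<kappa> / G) * sqrt b) * channel_entry \<kappa> N a (b - 1) x y"
proof -
  define A B where "A = complex_of_real (sqrt \<kappa>)" and "B = complex_of_real (sqrt (1 - \<kappa>))"
  define w where "w n = complex_of_real (thermal_weight N n)" for n
  define sq where "sq n = complex_of_real (sqrt (real n))" for n
  define \<beta> where "\<beta> m k x q = bs_ket \<kappa> (m, k) (x, q)" for m k x q
  define T where "T = channel_entry \<kappa> N"
  have AA: "A * A = of_real \<kappa>" and BB: "B * B = 1 - of_real \<kappa>"
    using k by (simp_all add: A_def B_def flip: of_real_mult)
  have T: "T a b x y = (\<Sum>\<^sub>\<infinity>(q, n). w n * \<beta> a n x q * \<beta> b n y q)" for a b x y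
    unfolding T_def w_def \<beta>_def by (rule channel_entry_eq[OF k N])
  \<comment> \<open>\<open>Z\<close> and \<open>Y\<close> contain a creation operator of the
    environment, applied from the left after the beam splitter for \<open>Z\<close> and to the
    thermal state from the right for \<open>Y\<close>. Eliminating \<open>Y\<close> from the linear
    relations \<open>e2\<close> and \<open>e3\<close> leaves the coefficient
    \<open>N + 1 - \<kappa> * N\<close> of \<open>Z\<close>, which is \<open>G\<close>.\<close>
  define Z where "Z = (\<Sum>\<^sub>\<infinity>(q, n). w n * sq q * \<beta> a n x (q - 1) * \<beta> b n y q)"
  define Y where "Y = (\<Sum>\<^sub>\<infinity>(q, n). w n * sq n * \<beta> a n x q * \<beta> b (n - 1) y q)"
  have s1: "(\<lambda>(q, n). w n * \<beta> a n x q * \<beta> b n y q) summable_on UNIV" for a b x y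
    using channel_summable(1)[OF k N] unfolding w_def \<beta>_def .
  have s2: "(\<lambda>(q, n). w n * sq q * \<beta> a n x (q - 1) * \<beta> b n y q) summable_on UNIV"
    using channel_summable(2)[OF k N, of a x b y] unfolding w_def \<beta>_def sq_def of_real_mult .
  have s3: "(\<lambda>(q, n). w n * sq n * \<beta> a n x q * \<beta> b (n - 1) y q) summable_on UNIV"
    using channel_summable(3)[OF k N, of a x b y] unfolding w_def \<beta>_def sq_def of_real_mult .
  have c1: "sq (Suc a) * \<beta> (Suc a) n x q = A * sq x * \<beta> a n (x - 1) q - B * sq q * \<beta> a n x (q - 1)" for n q
    using bs_ket_Suc_signal[of a \<kappa> n "(x, q)"]
    by (simp add: sq_def \<beta>_def A_def B_def rot_def create1_def create2_def algebra_simps del: of_nat_Suc)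
  have c2: "sq (Suc n) * \<beta> a (Suc n) x q = B * sq x * \<beta> a n (x - 1) q + A * sq q * \<beta> a n x (q - 1)" for n q
    using bs_ket_Suc_environment[of n \<kappa> a "(x, q)"]
    by (simp add: sq_def \<beta>_def A_def B_def rot_def create1_def create2_def algebra_simps del: of_nat_Suc)
  have a2: "sq (Suc q) * \<beta> b n y (Suc q) = - B * sq b * \<beta> (b - 1) n y q + A * sq n * \<beta> b (n - 1) y q" for n q
    using beam_splitter_heisenberg_environment[of \<kappa> b n "(y, q)"]
    by (simp add: sq_def \<beta>_def A_def B_def annih2_def algebra_simps)
  have e1: "sq (Suc a) * T (Suc a) b x y = A * sq x * T a b (x - 1) y - B * Z"
  proof -
    have "sq (Suc a) * T (Suc a) b x y
        = (\<Sum>\<^sub>\<infinity>z. (A * sq x) * (case z of (q, n) \<Rightarrow> w n * \<beta> a n (x - 1) q * \<beta> b n y q)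
          + (- B) * (case z of (q, n) \<Rightarrow> w n * sq q * \<beta> a n x (q - 1) * \<beta> b n y q))"
      unfolding T infsum_cmult_right'[symmetric]
    proof (rule infsum_cong)
      fix z :: "nat \<times> nat"
      obtain q n where z: "z = (q, n)" by force
      have "sq (Suc a) * (w n * \<beta> (Suc a) n x q * \<beta> b n y q) = w n * (sq (Suc a) * \<beta> (Suc a) n x q) * \<beta> b n y q"
        by (simp add: mult_ac)
      then show "sq (Suc a) * (case z of (q, n) \<Rightarrow> w n * \<beta> (Suc a) n x q * \<beta> b n y q)
        = (A * sq x) * (case z of (q, n) \<Rightarrow> w n * \<beta> a n (x - 1) q * \<beta> b n y q)
          + (- B) * (case z of (q, n) \<Rightarrow> w n * sq q * \<beta> a n x (q - 1) * \<beta> b n y q)"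
        unfolding z prod.case c1 by (simp add: algebra_simps)
    qed
    also have "\<dots> = A * sq x * T a b (x - 1) y - B * Z"
      unfolding T Z_def by (subst infsum_lincomb[OF s1 s2]) simp
    finally show ?thesis .
  qed
  have e2: "Z = - B * sq b * T a (b - 1) x y + A * Y"
  proof -
    have "Z = (\<Sum>\<^sub>\<infinity>(q, n). w n * sq (Suc q) * \<beta> a n x q * \<beta> b n y (Suc q))"
      unfolding Z_def by (subst infsum_shift_fst) (simp_all add: sq_def)
    also have "\<dots> = (\<Sum>\<^sub>\<infinity>z. (- B * sq b) * (case z of (q, n) \<Rightarrow> w n * \<beta> a n x q * \<beta> (b - 1) n y q)
          + A * (case z of (q, n) \<Rightarrow> w n * sq n * \<beta> a n x q * \<beta> b (n - 1) y q))"
    proof (rule infsum_cong)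
      fix z :: "nat \<times> nat"
      obtain q n where z: "z = (q, n)" by force
      have "w n * sq (Suc q) * \<beta> a n x q * \<beta> b n y (Suc q) = w n * \<beta> a n x q * (sq (Suc q) * \<beta> b n y (Suc q))"
        by (simp add: mult_ac)
      then show "(case z of (q, n) \<Rightarrow> w n * sq (Suc q) * \<beta> a n x q * \<beta> b n y (Suc q))
        = (- B * sq b) * (case z of (q, n) \<Rightarrow> w n * \<beta> a n x q * \<beta> (b - 1) n y q)
          + A * (case z of (q, n) \<Rightarrow> w n * sq n * \<beta> a n x q * \<beta> b (n - 1) y q)"
        unfolding z prod.case a2 by (simp add: algebra_simps)
    qed
    also have "\<dots> = - B * sq b * T a (b - 1) x y + A * Y"
      unfolding T Y_def by (rule infsum_lincomb[OF s1 s3])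
    finally show ?thesis .
  qed
  have e3: "of_real (N + 1) * Y = of_real N * (B * sq x * T a b (x - 1) y + A * Z)"
  proof -
    have wS: "of_real (N + 1) * w (Suc n) = of_real N * w n" for n
    proof -
      have "(N + 1) * thermal_weight N (Suc n) = N * thermal_weight N n"
      proof -
        define D where "D = N + 1"
        have "D \<noteq> 0" using N by (simp add: D_def)
        then show ?thesis by (simp add: thermal_weight_def D_def[symmetric])
      qed
      then show ?thesis unfolding w_def by (metis of_real_mult)
    qed
    have "Y = (\<Sum>\<^sub>\<infinity>(q, n). w (Suc n) * sq (Suc n) * \<beta> a (Suc n) x q * \<beta> b n y q)"
      unfolding Y_def by (subst infsum_shift_snd) (simp_all add: sq_def)
    then have "of_real (N + 1) * Y = (\<Sum>\<^sub>\<infinity>z. of_real (N + 1) * (case z of (q, n) \<Rightarrow> w (Suc n) * sq (Suc n) * \<beta> a (Suc n) x q * \<beta> b n y q))"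
      by (simp only: infsum_cmult_right')
    also have "\<dots> = (\<Sum>\<^sub>\<infinity>z. of_real N * (B * sq x) * (case z of (q, n) \<Rightarrow> w n * \<beta> a n (x - 1) q * \<beta> b n y q)
          + of_real N * A * (case z of (q, n) \<Rightarrow> w n * sq q * \<beta> a n x (q - 1) * \<beta> b n y q))"
    proof (rule infsum_cong)
      fix z :: "nat \<times> nat"
      obtain q n where z: "z = (q, n)" by force
      have "of_real (N + 1) * (w (Suc n) * sq (Suc n) * \<beta> a (Suc n) x q * \<beta> b n y q)
          = (of_real (N + 1) * w (Suc n)) * (sq (Suc n) * \<beta> a (Suc n) x q) * \<beta> b n y q"
        by (simp only: mult_ac)
      then show "of_real (N + 1) * (case z of (q, n) \<Rightarrow> w (Suc n) * sq (Suc n) * \<beta> a (Suc n) x q * \<beta> b n y q)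
        = of_real N * (B * sq x) * (case z of (q, n) \<Rightarrow> w n * \<beta> a n (x - 1) q * \<beta> b n y q)
          + of_real N * A * (case z of (q, n) \<Rightarrow> w n * sq q * \<beta> a n x (q - 1) * \<beta> b n y q)"
        unfolding z prod.case c2 wS by (simp add: algebra_simps)
    qed
    also have "\<dots> = of_real N * (B * sq x) * T a b (x - 1) y + of_real N * A * Z"
      unfolding T Z_def by (rule infsum_lincomb[OF s1 s2])
    finally show ?thesis by (simp add: algebra_simps)
  qed
  define X W where "X = sq x * T a b (x - 1) y" and "W = sq b * T a (b - 1) x y"
  have "(1 - \<kappa>) * N \<ge> 0" using k N by simp
  then have G0: "G > 0" unfolding G by linarith
  have G': "complex_of_real G = 1 + of_real N - (A * A) * of_real N" by (simp add: G AA algebra_simps)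
  have "of_real (N + 1) * Z = - B * of_real (N + 1) * W + A * (of_real (N + 1) * Y)"
    by (subst e2) (simp add: W_def algebra_simps)
  then have Z_eq: "of_real G * Z = A * of_real N * B * X - B * of_real (N + 1) * W"
    unfolding e3 G' by (simp add: X_def algebra_simps)
  have "of_real G * (B * Z) = B * (of_real G * Z)" by (simp add: mult_ac)
  also have "\<dots> = (B * B) * (A * of_real N * X - of_real (N + 1) * W)"
    unfolding Z_eq by (simp add: algebra_simps)
  finally have GZ: "of_real G * (B * Z) = (B * B) * (A * of_real N * X - of_real (N + 1) * W)" .
  have "of_real G * (sq (Suc a) * T (Suc a) b x y) = of_real G * A * X - of_real G * (B * Z)"
    unfolding e1 by (simp add: X_def algebra_simps)
  also have "\<dots> = A * X + of_real (G - \<kappa>) * W"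
    unfolding GZ BB by (simp add: G algebra_simps)
  finally have "sq (Suc a) * T (Suc a) b x y = (A * X + of_real (G - \<kappa>) * W) / of_real G"
    using G0 by (simp add: field_simps)
  also have "\<dots> = of_real (sqrt \<kappa> / G * sqrt x) * T a b (x - 1) y + of_real ((1 - \<kappa> / G) * sqrt b) * T a (b - 1) x y"
    using G0 by (simp add: X_def W_def A_def sq_def field_simps)
  finally show ?thesis by (simp add: sq_def T_def)
qed


section \<open>Vacuum input\<close>

lemma negative_binomial_sums:
  fixes s :: real
  assumes "0 \<le> s" "s < 1"
  shows "(\<lambda>k. real ((m + k) choose k) * s ^ k) sums (1 / (1 - s) ^ (m + 1))"
proof -
  have "((- real (m + 1)) gchoose k) * (- s) ^ k = real ((m + k) choose k) * s ^ k" for k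
  proof -
    have "((- real (m + 1)) gchoose k) * (- s) ^ k = ((-1) ^ k * (-1) ^ k) * (real (m + k) gchoose k) * s ^ k"
      by (subst gbinomial_minus) (simp add: power_minus[of s] algebra_simps)
    also have "(-1) ^ k * (-1) ^ k = (1 :: real)" by (simp flip: power_mult_distrib)
    finally show ?thesis by (simp add: binomial_gbinomial)
  qed
  moreover have "(1 + - s) powr (- real (m + 1)) = 1 / (1 - s) ^ (m + 1)"
    using assms by (subst powr_minus_divide) (simp add: powr_realpow del: of_nat_add of_nat_Suc)
  ultimately show ?thesis
    using gen_binomial_real[of "- s" "- real (m + 1)"] assms by simp
qed

lemma negative_binomial_has_sum:
  fixes s :: real
  assumes "0 \<le> s" "s < 1"
  shows "((\<lambda>k. real ((m + k) choose k) * s ^ k) has_sum (1 / (1 - s) ^ (m + 1))) UNIV"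
  using negative_binomial_sums[OF assms] by (rule sums_nonneg_imp_has_sum) (use assms in auto)

text \<open>Photon conservation forces \<open>x = y\<close>, and the photons leaving through the
  traced port form a negative binomial series. The result, a thermal state of mean photon number
  \<open>G - 1\<close>, is also what the amplifier makes of the vacuum.\<close>

lemma channel_entry_vacuum:
  assumes k: "0 \<le> \<kappa>" "\<kappa> \<le> 1" and N: "0 \<le> N" and G: "G = (1 - \<kappa>) * N + 1"
  shows "channel_entry \<kappa> N 0 0 x y = (if x = y then of_real ((G - 1) ^ x / G ^ (x + 1)) else 0)"
proof -
  define f where "f = (\<lambda>(q, n). of_real (thermal_weight N n) * bs_ket \<kappa> (0, n) (x, q) * bs_ket \<kappa> (0, n) (y, q))"
  have e: "channel_entry \<kappa> N 0 0 x y = infsum f UNIV"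
    unfolding f_def by (rule channel_entry_eq[OF k N])
  show ?thesis
  proof (cases "x = y")
    case False
    have "f z = 0" for z
    proof -
      obtain q n where z: "z = (q, n)" by force
      have "x + q \<noteq> 0 + n \<or> y + q \<noteq> 0 + n" using False by auto
      then show ?thesis by (auto simp: f_def z bs_ket_support)
    qed
    then show ?thesis using False by (simp add: e infsum_0)
  next
    case True
    \<comment> \<open>The ratio of the series over \<open>q\<close>: one more thermal photon has
      relative weight \<open>N / (N + 1)\<close> and stays in the environment with probability
      \<open>\<kappa>\<close>.\<close>
    define r where "r = \<kappa> * (N / (N + 1))"
    have r: "0 \<le> r" "r < 1" "1 - r = G / (N + 1)"
    proof -
      show "0 \<le> r" using k N by (simp add: r_def)
      have "r \<le> 1 * (N / (N + 1))" unfolding r_def using k N by (intro mult_right_mono) auto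
      also have "\<dots> < 1" using N by simp
      finally show "r < 1" .
      show "1 - r = G / (N + 1)" using N by (simp add: r_def G field_simps)
    qed
    define C where "C = (1 - \<kappa>) ^ x * N ^ x / (N + 1) ^ (x + 1)"
    have fq: "f (q, x + q) = of_real (C * (real ((x + q) choose q) * r ^ q))" for q
    proof -
      have "f (q, x + q) = of_real (thermal_weight N (x + q) * (real ((x + q) choose x) * (1 - \<kappa>) ^ x * \<kappa> ^ q))"
        using k by (simp add: f_def True[symmetric] bs_ket_vacuum[OF k] mult.assoc flip: of_real_mult)
      also have "thermal_weight N (x + q) * (real ((x + q) choose x) * (1 - \<kappa>) ^ x * \<kappa> ^ q) = C * (real ((x + q) choose q) * r ^ q)"
        using binomial_symmetric[of x "x + q"]
        by (simp add: thermal_weight_def C_def r_def power_add power_mult_distrib power_divide mult_ac)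
      finally show ?thesis .
    qed
    have "infsum f UNIV = infsum f (range (\<lambda>q. (q, x + q)))"
    proof (rule infsum_cong_neutral)
      fix z :: "nat \<times> nat" assume z: "z \<in> UNIV - range (\<lambda>q. (q, x + q))"
      obtain q n where qn: "z = (q, n)" by force
      then have "x + q \<noteq> 0 + n" using z by auto
      then show "f z = 0" by (simp add: f_def qn bs_ket_support)
    qed auto
    also have "\<dots> = (\<Sum>\<^sub>\<infinity>q. f (q, x + q))"
      by (subst infsum_reindex) (auto simp: inj_on_def o_def)
    also have "\<dots> = of_real (C * (1 / (1 - r) ^ (x + 1)))"
      unfolding fq by (intro infsumI has_sum_of_real has_sum_cmult_right negative_binomial_has_sum r)
    also have "C * (1 / (1 - r) ^ (x + 1)) = (G - 1) ^ x / G ^ (x + 1)"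
      using N by (simp add: C_def r(3) G power_divide power_mult_distrib)
    finally have f_sum: "infsum f UNIV = of_real ((G - 1) ^ x / G ^ (x + 1))" .
    show ?thesis unfolding e f_sum using True by simp
  qed
qed

section \<open>Kraus operators of loss followed by amplification\<close>

text \<open>The entries of \<open>A\<^sub>k L\<^sub>l\<close>, where \<open>L\<^sub>l\<close> are the Kraus operators of the pure loss channel
  with transmittance \<open>\<kappa>\<^sub>t\<close> and \<open>A\<^sub>k\<close> those of the quantum-limited amplifier with gain \<open>G\<close>;
  \<open>kraus_amp \<kappa>\<^sub>t G m l k\<close> maps \<open>|m + l\<rangle>\<close> to \<open>|m + k\<rangle>\<close>.\<close>

definition kraus_amp :: "real \<Rightarrow> real \<Rightarrow> nat \<Rightarrow> nat \<Rightarrow> nat \<Rightarrow> real" where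
  "kraus_amp \<kappa>t G m l k = sqrt (fact (m + l) * fact (m + k)) / (fact m * sqrt (fact l * fact k)) *
     (sqrt (\<kappa>t / G) ^ m * sqrt (1 - \<kappa>t) ^ l * sqrt ((G - 1) / G) ^ k * sqrt (1 / G))"

text \<open>Output \<open>x = m + k\<close> and input \<open>a = m + l\<close>, where
  \<open>m\<close> photons survive, \<open>l\<close> are lost and \<open>k\<close> are created; the
  condition expresses the existence of \<open>m\<close> without truncated subtraction.\<close>

definition kraus :: "real \<Rightarrow> real \<Rightarrow> nat \<Rightarrow> nat \<times> nat \<Rightarrow> nat \<Rightarrow> real" where
  "kraus \<kappa>t G x L a = (case L of (l, k) \<Rightarrow> if k \<le> x \<and> x + l = a + k then kraus_amp \<kappa>t G (x - k) l k else 0)"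

text \<open>Commuting a creation operator through a Kraus operator: the added photon either passes
  or is one of the lost ones.\<close>

lemma kraus_rec_create:
  "sqrt (Suc a) * kraus \<kappa>t G x (l, k) (Suc a) =
    sqrt (\<kappa>t / G) * sqrt x * kraus \<kappa>t G (x - 1) (l, k) a + sqrt (1 - \<kappa>t) * sqrt l * kraus \<kappa>t G x (l - 1, k) a"
proof (cases "k \<le> x \<and> x + l = Suc a + k")
  case False
  then have "kraus \<kappa>t G x (l, k) (Suc a) = 0" by (auto simp: kraus_def)
  moreover have "sqrt x * kraus \<kappa>t G (x - 1) (l, k) a = 0" using False by (cases x) (auto simp: kraus_def)
  moreover have "sqrt l * kraus \<kappa>t G x (l - 1, k) a = 0" using False by (cases l) (auto simp: kraus_def)
  ultimately show ?thesis by (simp only: mult.assoc mult_zero_right add_0)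
next
  case True
  define m where "m = x - k"
  have x: "x = m + k" and a: "Suc a = m + l" using True by (auto simp: m_def)
  \<comment> \<open>The Kraus entry with \<open>fact (m + l)\<close> replaced by
    \<open>fact a\<close>. The three terms of the claim are \<open>(m + l) * D\<close>,
    \<open>m * D\<close> and \<open>l * D\<close>.\<close>
  define D where "D = sqrt (fact a * fact x) / (fact m * sqrt (fact l * fact k)) *
     (sqrt (\<kappa>t / G) ^ m * sqrt (1 - \<kappa>t) ^ l * sqrt ((G - 1) / G) ^ k * sqrt (1 / G))"
  have s: "sqrt (real n) * sqrt (real n) = real n" for n by simp
  have L: "sqrt (Suc a) * kraus \<kappa>t G x (l, k) (Suc a) = real (m + l) * D"
  proof -
    have "kraus \<kappa>t G x (l, k) (Suc a) = sqrt (Suc a) * D"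
      using True by (simp add: kraus_def kraus_amp_def D_def m_def[symmetric] a[symmetric] x[symmetric] real_sqrt_mult del: of_nat_Suc)
    then show ?thesis using a by (metis mult.assoc s)
  qed
  have R1: "sqrt (\<kappa>t / G) * sqrt x * kraus \<kappa>t G (x - 1) (l, k) a = real m * D"
  proof (cases m)
    case 0
    then have "sqrt x * kraus \<kappa>t G (x - 1) (l, k) a = 0" using x by (cases x) (auto simp: kraus_def)
    then show ?thesis using 0 by (simp add: mult.assoc)
  next
    case (Suc j)
    have xs: "x = Suc (j + k)" and as: "a = j + l" using x a Suc by auto
    have "kraus \<kappa>t G (x - 1) (l, k) a = kraus_amp \<kappa>t G j l k" by (simp add: kraus_def xs as)
    then show ?thesis
      by (simp add: kraus_amp_def D_def Suc xs as real_sqrt_mult del: of_nat_Suc)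
  qed
  have R2: "sqrt (1 - \<kappa>t) * sqrt l * kraus \<kappa>t G x (l - 1, k) a = real l * D"
  proof (cases l)
    case (Suc j)
    have as: "a = m + j" using a Suc by auto
    define E where "E = sqrt (fact (m + j) * fact (m + k)) / (fact m * sqrt (fact k)) *
      (sqrt (\<kappa>t / G) ^ m * sqrt (1 - \<kappa>t) ^ j * sqrt ((G - 1) / G) ^ k * sqrt (1 / G))"
    have K: "kraus \<kappa>t G x (l - 1, k) a = E / sqrt (fact j)"
      by (simp add: kraus_def kraus_amp_def E_def x as Suc real_sqrt_mult)
    have D: "D = E * sqrt (1 - \<kappa>t) / sqrt (fact (Suc j))"
      by (simp add: D_def E_def x as Suc real_sqrt_mult mult_ac)
    have "sqrt (Suc j) / sqrt (fact j) = real (Suc j) / sqrt (fact (Suc j))"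
      by (simp add: real_sqrt_mult field_simps del: of_nat_Suc)
    then have "sqrt (1 - \<kappa>t) * E * (sqrt (Suc j) / sqrt (fact j)) = sqrt (1 - \<kappa>t) * E * (real (Suc j) / sqrt (fact (Suc j)))"
      by simp
    then show ?thesis unfolding K D by (simp add: Suc mult_ac del: of_nat_Suc fact_Suc)
  qed simp
  show ?thesis unfolding L R1 R2 by (simp add: algebra_simps)
qed

text \<open>Losing one more photon amounts to annihilating it before the loss, up to a
  factor.\<close>

lemma kraus_rec_annih:
  "sqrt (1 - \<kappa>t) * sqrt b * kraus \<kappa>t G y (l, k) (b - 1) = sqrt (Suc l) * kraus \<kappa>t G y (Suc l, k) b"
proof (cases b)
  case 0
  then show ?thesis by (auto simp: kraus_def)
next
  case (Suc j)
  show ?thesis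
  proof (cases "k \<le> y \<and> y + l = j + k")
    case True
    have "sqrt (Suc l) / sqrt (fact (Suc l)) = 1 / sqrt (fact l)"
      by (simp add: real_sqrt_mult del: of_nat_Suc)
    then show ?thesis using True
      by (simp add: kraus_def kraus_amp_def Suc real_sqrt_mult field_simps del: of_nat_Suc)
  qed (auto simp: kraus_def Suc)
qed


lemma finite_kraus: "finite {L. kraus \<kappa>t G x L a \<noteq> 0}"
proof (rule finite_subset)
  show "{L. kraus \<kappa>t G x L a \<noteq> 0} \<subseteq> {..a} \<times> {..x}"
    by (auto simp: kraus_def split: if_splits)
qed simp

definition kraus_entry :: "real \<Rightarrow> real \<Rightarrow> nat \<Rightarrow> nat \<Rightarrow> nat \<Rightarrow> nat \<Rightarrow> real" where
  "kraus_entry \<kappa>t G a b x y = (\<Sum>\<^sub>\<infinity>L. kraus \<kappa>t G x L a * kraus \<kappa>t G y L b)"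

lemma kraus_mult_summable:
  "(\<lambda>L. kraus \<kappa>t G x L a * f L) summable_on UNIV" "(\<lambda>L. f L * kraus \<kappa>t G x L a) summable_on UNIV"
  by (rule finite_nonzero_values_imp_summable_on, rule finite_subset[OF _ finite_kraus[of \<kappa>t G x a]], auto)+

text \<open>The sum over \<open>l\<close> plays the part of the partial trace: shifting
  \<open>l\<close> by one moves the lost photon from the first Kraus factor to the second, where it
  acts as an annihilation operator on \<open>b\<close>.\<close>

lemma kraus_entry_rec:
  assumes "\<kappa>t \<le> 1"
  shows "sqrt (Suc a) * kraus_entry \<kappa>t G (Suc a) b x y =
    sqrt (\<kappa>t / G) * sqrt x * kraus_entry \<kappa>t G a b (x - 1) y + (1 - \<kappa>t) * sqrt b * kraus_entry \<kappa>t G a (b - 1) x y"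
proof -
  define K where "K = kraus \<kappa>t G"
  define Z where "Z = (\<Sum>\<^sub>\<infinity>(l, k). sqrt l * K x (l - 1, k) a * K y (l, k) b)"
  have s: "(\<lambda>(l, k). sqrt l * K x (l - 1, k) a * K y (l, k) b) summable_on UNIV"
    using kraus_mult_summable(2)[of "\<lambda>(l, k). sqrt l * K x (l - 1, k) a" \<kappa>t G y b]
    by (simp add: K_def case_prod_unfold)
  have "sqrt (Suc a) * kraus_entry \<kappa>t G (Suc a) b x y = (\<Sum>\<^sub>\<infinity>L. (sqrt (\<kappa>t / G) * sqrt x) * (K (x - 1) L a * K y L b)
      + sqrt (1 - \<kappa>t) * (case L of (l, k) \<Rightarrow> sqrt l * K x (l - 1, k) a * K y (l, k) b))"
    unfolding kraus_entry_def infsum_cmult_right'[symmetric]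
  proof (rule infsum_cong)
    fix L :: "nat \<times> nat"
    obtain l k where L: "L = (l, k)" by force
    have "sqrt (Suc a) * (K x L (Suc a) * K y L b) = (sqrt (Suc a) * K x (l, k) (Suc a)) * K y L b"
      by (simp add: L)
    then show "sqrt (Suc a) * (kraus \<kappa>t G x L (Suc a) * kraus \<kappa>t G y L b) = (sqrt (\<kappa>t / G) * sqrt x) * (K (x - 1) L a * K y L b)
      + sqrt (1 - \<kappa>t) * (case L of (l, k) \<Rightarrow> sqrt l * K x (l - 1, k) a * K y (l, k) b)"
      unfolding K_def kraus_rec_create by (simp add: L algebra_simps)
  qed
  also have "\<dots> = (sqrt (\<kappa>t / G) * sqrt x) * kraus_entry \<kappa>t G a b (x - 1) y + sqrt (1 - \<kappa>t) * Z"
    unfolding kraus_entry_def Z_def K_def[symmetric]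
    by (rule infsum_lincomb) (use kraus_mult_summable(1) s in \<open>auto simp: K_def\<close>)
  also have "sqrt (1 - \<kappa>t) * Z = sqrt (1 - \<kappa>t) * (\<Sum>\<^sub>\<infinity>(l, k). K x (l, k) a * (sqrt (Suc l) * K y (Suc l, k) b))"
    unfolding Z_def by (subst infsum_shift_fst) (simp_all add: mult_ac)
  also have "\<dots> = (sqrt (1 - \<kappa>t) * sqrt (1 - \<kappa>t)) * sqrt b * kraus_entry \<kappa>t G a (b - 1) x y"
    unfolding K_def kraus_rec_annih[symmetric] kraus_entry_def mult.assoc infsum_cmult_right'[symmetric]
    by (intro infsum_cong) (auto simp: mult_ac)
  finally show ?thesis using assms by simp
qed

lemma kraus_entry_flip: "kraus_entry \<kappa>t G a b x y = kraus_entry \<kappa>t G b a y x"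
  by (simp add: kraus_entry_def mult.commute)

lemma kraus_entry_vacuum:
  assumes "G \<ge> 1"
  shows "kraus_entry \<kappa>t G 0 0 x y = (if x = y then (G - 1) ^ x / G ^ (x + 1) else 0)"
proof -
  have s: "sqrt g ^ n * sqrt g ^ n = g ^ n" if "g \<ge> 0" for g :: real and n
    using that by (simp flip: power_mult_distrib)
  have "((\<lambda>L. kraus \<kappa>t G x L 0 * kraus \<kappa>t G y L 0) has_sum (if x = y then (G - 1) ^ x / G ^ (x + 1) else 0)) UNIV"
  proof (rule has_sum_finite_neutralI[of "{(0, x)}"])
    have "sqrt ((G - 1) / G) ^ x * sqrt (1 / G) * (sqrt ((G - 1) / G) ^ x * sqrt (1 / G))
        = (sqrt ((G - 1) / G) ^ x * sqrt ((G - 1) / G) ^ x) * (sqrt (1 / G) ^ 1 * sqrt (1 / G) ^ 1)"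
      by (simp only: power_one_right mult_ac)
    also have "\<dots> = (G - 1) ^ x / G ^ (x + 1)"
      using assms by (subst s, simp, subst s) (simp_all add: power_divide)
    finally show "(if x = y then (G - 1) ^ x / G ^ (x + 1) else 0) = (\<Sum>L\<in>{(0, x)}. kraus \<kappa>t G x L 0 * kraus \<kappa>t G y L 0)"
      by (auto simp: kraus_def kraus_amp_def)
  qed (auto simp: kraus_def split: if_splits)
  then show ?thesis unfolding kraus_entry_def by (rule infsumI)
qed

text \<open>The two recurrences have the same coefficients, and they lower \<open>a + b\<close>, so
  agreement on the vacuum suffices. This explains the constants:
  \<open>\<kappa>t * G = \<kappa>\<close> matches the transmitted amplitude, and
  \<open>G - 1\<close> is the noise added to the vacuum.\<close>

lemma channel_entry_kraus:
  assumes k: "0 \<le> \<kappa>" "\<kappa> \<le> 1" and N: "0 \<le> N" and G: "G = (1 - \<kappa>) * N + 1" and t: "\<kappa>t = \<kappa> / G"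
  shows "channel_entry \<kappa> N a b x y = of_real (kraus_entry \<kappa>t G a b x y)"
proof -
  have G1: "G \<ge> 1" using k N G by simp
  have t1: "\<kappa>t \<le> 1" using k G1 by (simp add: t field_simps)
  have st: "sqrt (\<kappa>t / G) = sqrt \<kappa> / G"
    using G1 by (simp add: t real_sqrt_divide)
  show ?thesis
  proof (induction "a + b" arbitrary: a b x y rule: less_induct)
    case less
    have suc: "channel_entry \<kappa> N (Suc a') b' x y = of_real (kraus_entry \<kappa>t G (Suc a') b' x y)"
      if "Suc a' + b' = a + b" for a' b' x y
    proof -
      have "of_real (sqrt (Suc a')) * channel_entry \<kappa> N (Suc a') b' x y
          = of_real (sqrt \<kappa> / G * sqrt x) * of_real (kraus_entry \<kappa>t G a' b' (x - 1) y)
            + of_real ((1 - \<kappa> / G) * sqrt b') * of_real (kraus_entry \<kappa>t G a' (b' - 1) x y)"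
        using that by (simp only: channel_entry_rec[OF k N G]) (subst (1 2) less, auto)
      also have "\<dots> = of_real (sqrt (Suc a') * kraus_entry \<kappa>t G (Suc a') b' x y)"
        unfolding kraus_entry_rec[OF t1] st by (simp add: t)
      finally show ?thesis by (simp del: of_nat_Suc)
    qed
    show ?case
    proof (cases a)
      case (Suc a')
      then show ?thesis using suc[of a' b x y] by simp
    next
      case 0
      show ?thesis
      proof (cases b)
        case (Suc b')
        \<comment> \<open>The recurrence acts on the first input number only; for
          \<open>a = 0\<close> the flip brings \<open>b\<close> into its place.\<close>
        then show ?thesis using suc[of b' 0 y x] 0
          by (simp add: channel_entry_flip[OF k N, of 0] kraus_entry_flip[of \<kappa>t G 0])
      qed (use 0 channel_entry_vacuum[OF k N G] kraus_entry_vacuum[OF G1] in simp)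
    qed
  qed
qed

section \<open>Overlap of the Kraus operators of two channels\<close>

lemma kraus_amp_mult:
  assumes "0 \<le> \<kappa>t0" "\<kappa>t0 \<le> 1" "0 \<le> \<kappa>t1" "\<kappa>t1 \<le> 1" "G0 \<ge> 1" "G1 \<ge> 1"
  shows "kraus_amp \<kappa>t0 G0 m l k * kraus_amp \<kappa>t1 G1 m l k =
    real ((m + l) choose l) * (sqrt (\<kappa>t0 * \<kappa>t1) / sqrt (G0 * G1)) ^ m * sqrt ((1 - \<kappa>t0) * (1 - \<kappa>t1)) ^ l / sqrt (G0 * G1)
    * (real ((m + k) choose k) * (sqrt ((G0 - 1) * (G1 - 1)) / sqrt (G0 * G1)) ^ k)"
proof -
  have "(sqrt (fact (m + l) * fact (m + k)) / (fact m * sqrt (fact l * fact k)))\<^sup>2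
      = real ((m + l) choose l) * real ((m + k) choose k)"
    by (simp add: power_divide power_mult_distrib binomial_fact power2_eq_square)
  then have f: "sqrt (fact (m + l) * fact (m + k)) / (fact m * sqrt (fact l * fact k)) * (sqrt (fact (m + l) * fact (m + k)) / (fact m * sqrt (fact l * fact k)))
      = real ((m + l) choose l) * real ((m + k) choose k)" by (simp only: power2_eq_square)
  have w: "sqrt (\<kappa>t0 / G0) ^ m * sqrt (1 - \<kappa>t0) ^ l * sqrt ((G0 - 1) / G0) ^ k * sqrt (1 / G0) *
      (sqrt (\<kappa>t1 / G1) ^ m * sqrt (1 - \<kappa>t1) ^ l * sqrt ((G1 - 1) / G1) ^ k * sqrt (1 / G1))
    = (sqrt (\<kappa>t0 * \<kappa>t1) / sqrt (G0 * G1)) ^ m * sqrt ((1 - \<kappa>t0) * (1 - \<kappa>t1)) ^ l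
      * (sqrt ((G0 - 1) * (G1 - 1)) / sqrt (G0 * G1)) ^ k * (1 / sqrt (G0 * G1))"
    by (simp add: real_sqrt_mult real_sqrt_divide power_mult_distrib power_divide mult_ac)
  have "kraus_amp \<kappa>t0 G0 m l k * kraus_amp \<kappa>t1 G1 m l k = (real ((m + l) choose l) * real ((m + k) choose k)) *
     ((sqrt (\<kappa>t0 * \<kappa>t1) / sqrt (G0 * G1)) ^ m * sqrt ((1 - \<kappa>t0) * (1 - \<kappa>t1)) ^ l
      * (sqrt ((G0 - 1) * (G1 - 1)) / sqrt (G0 * G1)) ^ k * (1 / sqrt (G0 * G1)))"
    unfolding f[symmetric] w[symmetric] kraus_amp_def by (simp only: mult_ac)
  then show ?thesis by (simp add: mult_ac)
qed

lemma kraus_nonneg: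
  assumes "0 \<le> \<kappa>t" "\<kappa>t \<le> 1" "G \<ge> 1" shows "0 \<le> kraus \<kappa>t G x L a"
  using assms by (auto simp: kraus_def kraus_amp_def split: prod.splits)

text \<open>The inequality between arithmetic and geometric means for \<open>G0 - 1\<close> and
  \<open>G1 - 1\<close>. It makes the negative binomial series of \<open>kraus_overlap\<close>
  converge and puts \<open>\<nu>\<close> between 0 and 1.\<close>

lemma gain_gap:
  assumes "G0 \<ge> 1" "G1 \<ge> 1"
  shows "sqrt (G0 * G1) - sqrt ((G0 - 1) * (G1 - 1)) \<ge> (1 :: real)"
proof -
  define g where "g = sqrt ((G0 - 1) * (G1 - 1))"
  have g: "g \<ge> 0" "g\<^sup>2 = (G0 - 1) * (G1 - 1)" using assms by (simp_all add: g_def)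
  have "2 * g \<le> (G0 - 1) + (G1 - 1)"
    using arith_geo_mean_sqrt[of "G0 - 1" "G1 - 1"] assms by (simp add: g_def)
  then have "(1 + g)\<^sup>2 \<le> G0 * G1" using g(2) by (simp add: power2_eq_square algebra_simps)
  then have "1 + g \<le> sqrt (G0 * G1)" by (rule real_le_rsqrt)
  then show ?thesis by (simp add: g_def)
qed

text \<open>With \<open>m = a - l\<close> survivors the sum over created photons contributes
  \<open>(\<nu> * H) ^ (m + 1)\<close>. It cancels the powers of \<open>H\<close>, leaves
  \<open>\<nu> * c\<close> per survivor and one further \<open>\<nu>\<close>; the sum over
  \<open>l\<close> is then a binomial expansion.\<close>

lemma kraus_overlap:
  assumes t: "0 \<le> \<kappa>t0" "\<kappa>t0 \<le> 1" "0 \<le> \<kappa>t1" "\<kappa>t1 \<le> 1" and G: "G0 \<ge> 1" "G1 \<ge> 1"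
    and \<nu>: "\<nu> = 1 / (sqrt (G0 * G1) - sqrt ((G0 - 1) * (G1 - 1)))"
  shows "((\<lambda>(x, L). kraus \<kappa>t0 G0 x L a * kraus \<kappa>t1 G1 x L a) has_sum
     \<nu> * (\<nu> * sqrt (\<kappa>t0 * \<kappa>t1) + sqrt ((1 - \<kappa>t0) * (1 - \<kappa>t1))) ^ a) UNIV"
proof -
  define c d g H where "c = sqrt (\<kappa>t0 * \<kappa>t1)" and "d = sqrt ((1 - \<kappa>t0) * (1 - \<kappa>t1))"
    and "g = sqrt ((G0 - 1) * (G1 - 1))" and "H = sqrt (G0 * G1)"
  have gap: "H - g \<ge> 1" using gain_gap[OF G] by (simp add: H_def g_def)
  have nn: "c \<ge> 0" "d \<ge> 0" "g \<ge> 0" using t G by (simp_all add: c_def d_def g_def)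
  have H: "H > 0" using gap nn by linarith
  have nu: "\<nu> = 1 / (H - g)" by (simp add: \<nu> H_def g_def)
  define F where "F = (\<lambda>(l, k). kraus_amp \<kappa>t0 G0 (a - l) l k * kraus_amp \<kappa>t1 G1 (a - l) l k)"
  have F: "F (l, k) = real (a choose l) * (c / H) ^ (a - l) * d ^ l / H * (real ((a - l + k) choose k) * (g / H) ^ k)"
    if "l \<le> a" for l k
    using kraus_amp_mult[OF t G, of "a - l" l k] that by (simp add: F_def c_def d_def g_def H_def)
  have row: "((\<lambda>k. F (l, k)) has_sum \<nu> * (real (a choose l) * (\<nu> * c) ^ (a - l) * d ^ l)) UNIV" if l: "l \<le> a" for l
  proof -
    have "((\<lambda>k. F (l, k)) has_sum real (a choose l) * (c / H) ^ (a - l) * d ^ l / H * (1 / (1 - g / H) ^ (a - l + 1))) UNIV"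
      unfolding F[OF l] using nn gap H by (intro has_sum_cmult_right negative_binomial_has_sum) (auto simp: field_simps)
    also have "1 / (1 - g / H) ^ (a - l + 1) = (\<nu> * H) ^ (a - l + 1)"
    proof -
      have "1 - g / H = 1 / (\<nu> * H)" using H gap by (simp add: nu field_simps)
      then show ?thesis by (simp add: power_divide)
    qed
    also have "real (a choose l) * (c / H) ^ (a - l) * d ^ l / H * (\<nu> * H) ^ (a - l + 1)
        = \<nu> * (real (a choose l) * (\<nu> * c) ^ (a - l) * d ^ l)"
      using H by (simp add: power_divide power_mult_distrib field_simps)
    finally show ?thesis .
  qed
  have tot: "((\<lambda>l. \<nu> * (real (a choose l) * (\<nu> * c) ^ (a - l) * d ^ l)) has_sum \<nu> * (\<nu> * c + d) ^ a) {..a}"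
  proof (rule has_sum_finiteI)
    have "(\<nu> * c + d) ^ a = (\<Sum>l\<le>a. real (a choose l) * d ^ l * (\<nu> * c) ^ (a - l))"
      using binomial_ring[of d "\<nu> * c" a] by (simp add: add.commute)
    then show "\<nu> * (\<nu> * c + d) ^ a = (\<Sum>l\<le>a. \<nu> * (real (a choose l) * (\<nu> * c) ^ (a - l) * d ^ l))"
      by (simp add: sum_distrib_left mult_ac)
  qed simp
  have "F summable_on {..a} \<times> UNIV"
  proof (rule summable_on_SigmaI[OF row])
    fix l k assume "l \<in> {..a}"
    then show "0 \<le> F (l, k)" using nn H by (simp add: F)
  qed (use tot in \<open>auto simp: summable_on_def\<close>)
  then have "(F has_sum \<nu> * (\<nu> * c + d) ^ a) ({..a} \<times> UNIV)"
    by (intro has_sum_SigmaI[OF row tot]) auto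
  \<comment> \<open>The numbers of lost and created photons parametrise the nonzero terms, as they
    force the output number.\<close>
  moreover define h where "h = (\<lambda>(l, k). (a - l + k, (l, k)))"
  define Q where "Q = (\<lambda>(x, L). kraus \<kappa>t0 G0 x L a * kraus \<kappa>t1 G1 x L a)"
  have "(Q \<circ> h) z = F z" if "z \<in> {..a} \<times> UNIV" for z
    using that by (auto simp: Q_def h_def F_def kraus_def)
  ultimately have "(Q \<circ> h has_sum \<nu> * (\<nu> * c + d) ^ a) ({..a} \<times> UNIV)" by (simp cong: has_sum_cong)
  then have "(Q has_sum \<nu> * (\<nu> * c + d) ^ a) (h ` ({..a} \<times> UNIV))"
    by (subst has_sum_reindex) (auto simp: inj_on_def h_def)
  then have "(Q has_sum \<nu> * (\<nu> * c + d) ^ a) UNIV"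
  proof (rule has_sum_cong_neutral[THEN iffD1, rotated -1])
    fix z assume z: "z \<in> UNIV - h ` ({..a} \<times> UNIV)"
    obtain x l k where xlk: "z = (x, (l, k))" by (metis prod.exhaust)
    have "\<not> (k \<le> x \<and> x + l = a + k)"
    proof
      assume "k \<le> x \<and> x + l = a + k"
      then have "z = h (l, k)" "l \<le> a" by (auto simp: h_def xlk)
      then show False using z by auto
    qed
    then show "Q z = 0" by (auto simp: Q_def xlk kraus_def)
  qed auto
  then show ?thesis by (simp add: Q_def c_def d_def)
qed



section \<open>Several modes and the input state\<close>

text \<open>Every finite set of choice functions lies in a finite box, over which the sum of
  products factorises; nonnegativity then gives summability.\<close>

lemma has_sum_prod_UNIV:
  fixes f :: "'m :: finite \<Rightarrow> 'b \<Rightarrow> real"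
  assumes nn: "\<And>j z. f j z \<ge> 0" and s: "\<And>j. (f j has_sum S j) UNIV"
  shows "((\<lambda>g. \<Prod>j\<in>UNIV. f j (g j)) has_sum (\<Prod>j\<in>UNIV. S j)) UNIV"
proof -
  have bound: "(\<Sum>g\<in>X. \<Prod>j\<in>UNIV. f j (g j)) \<le> (\<Prod>j\<in>UNIV. S j)" if X: "finite X" for X :: "('m \<Rightarrow> 'b) set"
  proof -
    define Y where "Y j = (\<lambda>g. g j) ` X" for j
    have Y: "finite (Y j)" for j using X by (simp add: Y_def)
    have "(\<Sum>g\<in>X. \<Prod>j\<in>UNIV. f j (g j)) \<le> (\<Sum>g\<in>PiE UNIV Y. \<Prod>j\<in>UNIV. f j (g j))"
      by (intro sum_mono2 finite_PiE) (auto simp: Y_def X nn prod_nonneg)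
    also have "\<dots> = (\<Prod>j\<in>UNIV. \<Sum>z\<in>Y j. f j z)"
      by (subst prod_sum_PiE) (auto simp: Y)
    also have "\<dots> \<le> (\<Prod>j\<in>UNIV. S j)"
      using s nn Y by (intro prod_mono conjI sum_nonneg finite_sum_le_has_sum) auto
    finally show ?thesis .
  qed
  have "(\<lambda>g. \<Prod>j\<in>UNIV. f j (g j)) summable_on UNIV"
    by (rule nonneg_bdd_above_summable_on) (auto intro!: bdd_aboveI[of _ "\<Prod>j\<in>UNIV. S j"] bound prod_nonneg nn)
  moreover have "(\<Sum>\<^sub>\<infinity>g\<in>PiE UNIV (\<lambda>_. UNIV). \<Prod>j\<in>UNIV. f j (g j)) = (\<Prod>j\<in>UNIV. infsum (f j) UNIV)"
    by (rule infsum_prod_PiE_abs) (use s nn in \<open>auto simp: summable_on_def\<close>)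
  ultimately show ?thesis using s by (simp add: has_sum_iff infsumI[OF s])
qed

definition modes_kraus :: "real \<Rightarrow> real \<Rightarrow> ('m::finite \<Rightarrow> nat) \<Rightarrow> ('m \<Rightarrow> nat \<times> nat) \<Rightarrow> ('m \<Rightarrow> nat) \<Rightarrow> real" where
  "modes_kraus \<kappa>t G x L a = (\<Prod>j\<in>UNIV. kraus \<kappa>t G (x j) (L j) (a j))"

text \<open>The number state that the Kraus operator \<open>L\<close> maps to the number state \<open>x\<close>, if there is one;
  otherwise the value is irrelevant, as the Kraus matrix elements vanish.\<close>

definition kraus_source :: "('m \<Rightarrow> nat) \<Rightarrow> ('m \<Rightarrow> nat \<times> nat) \<Rightarrow> 'm \<Rightarrow> nat" where
  "kraus_source x L = (\<lambda>j. x j + fst (L j) - snd (L j))"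

lemma modes_kraus_source:
  fixes a :: "'m::finite \<Rightarrow> nat"
  assumes "modes_kraus \<kappa>t G x L a \<noteq> 0" shows "a = kraus_source x L"
proof
  fix j
  have "kraus \<kappa>t G (x j) (L j) (a j) \<noteq> 0" using assms by (simp add: modes_kraus_def)
  then have "x j + fst (L j) = a j + snd (L j)" by (auto simp: kraus_def split: if_splits prod.splits)
  then show "a j = kraus_source x L j" by (simp add: kraus_source_def)
qed

lemma modes_kraus_nonneg: "0 \<le> \<kappa>t \<Longrightarrow> \<kappa>t \<le> 1 \<Longrightarrow> G \<ge> 1 \<Longrightarrow> 0 \<le> modes_kraus \<kappa>t G x L a"
  unfolding modes_kraus_def by (intro prod_nonneg) (simp add: kraus_nonneg)

lemma modes_overlap:
  fixes a :: "'m::finite \<Rightarrow> nat"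
  assumes t: "0 \<le> \<kappa>t0" "\<kappa>t0 \<le> 1" "0 \<le> \<kappa>t1" "\<kappa>t1 \<le> 1" and G: "G0 \<ge> 1" "G1 \<ge> 1"
    and \<nu>: "\<nu> = 1 / (sqrt (G0 * G1) - sqrt ((G0 - 1) * (G1 - 1)))"
  shows "((\<lambda>(x, L). modes_kraus \<kappa>t0 G0 x L a * modes_kraus \<kappa>t1 G1 x L a) has_sum
     \<nu> ^ CARD('m) * (\<nu> * sqrt (\<kappa>t0 * \<kappa>t1) + sqrt ((1 - \<kappa>t0) * (1 - \<kappa>t1))) ^ (\<Sum>j\<in>UNIV. a j)) UNIV"
proof -
  define br where "br = \<nu> * sqrt (\<kappa>t0 * \<kappa>t1) + sqrt ((1 - \<kappa>t0) * (1 - \<kappa>t1))"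
  have "((\<lambda>g :: 'm \<Rightarrow> nat \<times> nat \<times> nat. \<Prod>j\<in>UNIV. case g j of (x, L) \<Rightarrow> kraus \<kappa>t0 G0 x L (a j) * kraus \<kappa>t1 G1 x L (a j)) has_sum
      (\<Prod>j\<in>UNIV. \<nu> * br ^ a j)) UNIV"
    unfolding br_def by (intro has_sum_prod_UNIV kraus_overlap[OF t G \<nu>]) (auto simp: kraus_nonneg t G split: prod.split)
  also have "(\<Prod>j\<in>UNIV. \<nu> * br ^ a j) = \<nu> ^ CARD('m) * br ^ (\<Sum>j\<in>UNIV. a j)"
    by (simp add: prod.distrib power_sum)
  finally show ?thesis unfolding br_def[symmetric]
    by (subst has_sum_reindex_bij_witness[of UNIV "\<lambda>g. (fst \<circ> g, snd \<circ> g)" "\<lambda>(x, L) j. (x j, L j)" UNIV,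
          where g = "\<lambda>(x, L). modes_kraus \<kappa>t0 G0 x L a * modes_kraus \<kappa>t1 G1 x L a"
            and h = "\<lambda>g. \<Prod>j\<in>UNIV. case g j of (x, L) \<Rightarrow> kraus \<kappa>t0 G0 x L (a j) * kraus \<kappa>t1 G1 x L (a j)"])
       (auto simp: modes_kraus_def prod.distrib fun_eq_iff case_prod_unfold)
qed

section \<open>Purified channel outputs\<close>

lemma input_vec_entry: "input_vec p \<phi> (i, a) = complex_of_real (sqrt (p a)) * \<phi> a i"
proof -
  have "((\<lambda>n. complex_of_real (sqrt (p n)) * tensor_vec (\<phi> n) (ket n) (i, a)) has_sum complex_of_real (sqrt (p a)) * \<phi> a i) UNIV"
    by (rule has_sum_finite_neutralI[of "{a}"]) (auto simp: tensor_vec_def ket_def)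
  then show ?thesis unfolding input_vec_def by (rule infsumI)
qed

text \<open>The amplitude of output \<open>(i, x)\<close> with environment record \<open>L\<close>.
  It is one term instead of a sum over inputs, since \<open>x\<close> and \<open>L\<close> leave a
  single possible input number state.\<close>

definition dilation ::
    "('i \<times> ('m::finite \<Rightarrow> nat)) vec \<Rightarrow> real \<Rightarrow> real \<Rightarrow> 'i \<times> ('m \<Rightarrow> nat) \<Rightarrow> ('m \<Rightarrow> nat \<times> nat) \<Rightarrow> complex" where
  "dilation \<psi> \<kappa>t G = (\<lambda>(i, x) L. \<psi> (i, kraus_source x L) * of_real (modes_kraus \<kappa>t G x L (kraus_source x L)))"

text \<open>Equal \<open>x\<close> and \<open>L\<close> in both amplitudes force equal inputs
  \<open>a\<close>, so different idler states never meet and only the weights \<open>p a\<close>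
  remain.\<close>

lemma dilation_overlap:
  fixes \<psi> :: "('i \<times> ('m::finite \<Rightarrow> nat)) vec"
  assumes t: "0 \<le> \<kappa>t0" "\<kappa>t0 \<le> 1" "0 \<le> \<kappa>t1" "\<kappa>t1 \<le> 1" and G: "G0 \<ge> 1" "G1 \<ge> 1"
    and \<nu>: "\<nu> = 1 / (sqrt (G0 * G1) - sqrt ((G0 - 1) * (G1 - 1)))"
    and \<psi>: "\<And>a. ((\<lambda>i. (cmod (\<psi> (i, a)))\<^sup>2) has_sum p a) UNIV"
    and S: "((\<lambda>a. p a * (\<nu> ^ CARD('m) * (\<nu> * sqrt (\<kappa>t0 * \<kappa>t1) + sqrt ((1 - \<kappa>t0) * (1 - \<kappa>t1))) ^ (\<Sum>j\<in>UNIV. a j))) has_sum S) UNIV"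
  shows "((\<lambda>(z, L). cnj (dilation \<psi> \<kappa>t0 G0 z L) * dilation \<psi> \<kappa>t1 G1 z L) has_sum of_real S) UNIV"
proof -
  define K where "K x L a = modes_kraus \<kappa>t0 G0 x L a * modes_kraus \<kappa>t1 G1 x L a" for x L and a :: "'m \<Rightarrow> nat"
  define c where "c a = \<nu> ^ CARD('m) * (\<nu> * sqrt (\<kappa>t0 * \<kappa>t1) + sqrt ((1 - \<kappa>t0) * (1 - \<kappa>t1))) ^ (\<Sum>j\<in>UNIV. a j)" for a :: "'m \<Rightarrow> nat"
  have K: "((\<lambda>(x, L). K x L a) has_sum c a) UNIV" for a
    unfolding K_def c_def by (rule modes_overlap[OF t G \<nu>])
  have Knn: "0 \<le> K x L a" for x L a unfolding K_def by (intro mult_nonneg_nonneg modes_kraus_nonneg t G)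
  have cnn: "0 \<le> c a" for a by (rule has_sum_nonneg[OF K]) (auto simp: Knn split: prod.split)
  \<comment> \<open>The input label \<open>a\<close> is made a free variable; the terms with
    \<open>a\<close> different from \<open>kraus_source x L\<close> vanish. All terms are
    nonnegative, so the sum may be taken over \<open>z\<close> first, giving \<open>c a\<close>, and
    then over \<open>i\<close>, giving \<open>p a\<close>.\<close>
  define F where "F = (\<lambda>((a, i), z). (cmod (\<psi> (i, a)))\<^sup>2 * (case z of (x, L) \<Rightarrow> K x L a))"
  have Fnn: "0 \<le> F w" for w by (auto simp: F_def Knn split: prod.split)
  have r1: "((\<lambda>z. F (w, z)) has_sum (case w of (a, i) \<Rightarrow> (cmod (\<psi> (i, a)))\<^sup>2 * c a)) UNIV" for w
    unfolding F_def by (auto intro: has_sum_cmult_right K split: prod.split)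
  have r2: "((\<lambda>(a, i). (cmod (\<psi> (i, a)))\<^sup>2 * c a) has_sum S) (UNIV \<times> UNIV)"
  proof (rule has_sum_SigmaI)
    show "((\<lambda>a. p a * c a) has_sum S) UNIV" using S by (simp add: c_def)
    show row: "((\<lambda>i. case (a, i) of (a, i) \<Rightarrow> (cmod (\<psi> (i, a)))\<^sup>2 * c a) has_sum p a * c a) UNIV" for a
      using has_sum_cmult_left[OF \<psi>] by simp
    show "(\<lambda>(a, i). (cmod (\<psi> (i, a)))\<^sup>2 * c a) summable_on UNIV \<times> UNIV"
      by (rule summable_on_SigmaI[OF row]) (use S cnn in \<open>auto simp: c_def summable_on_def\<close>)
  qed
  have "(F has_sum S) ((UNIV \<times> UNIV) \<times> UNIV)"
  proof (rule has_sum_SigmaI[OF r1 r2])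
    show "F summable_on (UNIV \<times> UNIV) \<times> UNIV"
      by (rule summable_on_SigmaI[OF r1]) (use r2 Fnn in \<open>auto simp: summable_on_def\<close>)
  qed
  then have F_UNIV: "(F has_sum S) UNIV" by simp
  define h where "h = (\<lambda>((i :: 'i, x), L). ((kraus_source x L, i), (x :: 'm \<Rightarrow> nat, L)))"
  from F_UNIV have "(F has_sum S) (range h)"
  proof (rule has_sum_cong_neutral[THEN iffD1, rotated -1])
    fix w assume w: "w \<in> UNIV - range h"
    obtain a i x L where e: "w = ((a, i), (x, L))" by (metis prod.exhaust)
    have "a \<noteq> kraus_source x L"
    proof
      assume "a = kraus_source x L"
      then have "w = h ((i, x), L)" by (simp add: h_def e)
      then show False using w by auto
    qed
    then have "modes_kraus \<kappa>t0 G0 x L a = 0" using modes_kraus_source by blast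
    then show "F w = 0" by (simp add: F_def e K_def)
  qed auto
  then have "(F \<circ> h has_sum S) UNIV"
    by (subst (asm) has_sum_reindex) (auto simp: inj_on_def h_def)
  then have "((\<lambda>z. complex_of_real ((F \<circ> h) z)) has_sum of_real S) UNIV" by (rule has_sum_of_real)
  moreover have "(\<lambda>z. complex_of_real ((F \<circ> h) z)) = (\<lambda>(z, L). cnj (dilation \<psi> \<kappa>t0 G0 z L) * dilation \<psi> \<kappa>t1 G1 z L)"
    by (auto simp: fun_eq_iff F_def h_def K_def dilation_def complex_norm_square mult_ac simp del: of_real_power)
  ultimately show ?thesis by (simp only:)
qed

text \<open>The squared norm is the overlap of the dilation with itself. For equal parameters
  \<open>\<nu>\<close> and the bracket are both 1, so it equals the total probability.\<close>

lemma hs_dilation: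
  fixes \<psi> :: "('i \<times> ('m::finite \<Rightarrow> nat)) vec"
  assumes t: "0 \<le> \<kappa>t" "\<kappa>t \<le> 1" and G: "G \<ge> 1"
    and \<psi>: "\<And>a. ((\<lambda>i. (cmod (\<psi> (i, a)))\<^sup>2) has_sum p a) UNIV" and p: "(p has_sum 1) UNIV"
  shows "hs (dilation \<psi> \<kappa>t G)"
proof -
  have 1: "(1 :: real) = 1 / (sqrt (G * G) - sqrt ((G - 1) * (G - 1)))" using G by simp
  have "((\<lambda>(z, L). cnj (dilation \<psi> \<kappa>t G z L) * dilation \<psi> \<kappa>t G z L) has_sum of_real 1) UNIV"
    by (rule dilation_overlap[OF t t G G 1 \<psi>]) (use t p in simp)
  then have "((\<lambda>w. complex_of_real ((cmod (case w of (z, L) \<Rightarrow> dilation \<psi> \<kappa>t G z L))\<^sup>2)) has_sum of_real 1) UNIV"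
    by (simp add: case_prod_unfold complex_norm_square mult.commute del: of_real_power)
  then show ?thesis unfolding hs_def l2_def
    by (simp only: has_sum_of_real_iff) (auto simp: summable_on_def)
qed

lemma channel_output_gram:
  fixes \<psi> :: "('i \<times> ('m::finite \<Rightarrow> nat)) vec"
  assumes k: "0 \<le> \<kappa>" "\<kappa> \<le> 1" and N: "0 \<le> N" and G: "G = (1 - \<kappa>) * N + 1" and t: "\<kappa>t = \<kappa> / G"
    and hs: "hs (dilation \<psi> \<kappa>t G)"
  shows "id_tensor_map (tensor_power_map (thermal_loss \<kappa> N)) (outer \<psi> \<psi>) = gram (dilation \<psi> \<kappa>t G)"
proof (intro ext)
  fix ix jy :: "'i \<times> ('m \<Rightarrow> nat)"
  obtain i x j y where e: "ix = (i, x)" "jy = (j, y)" by force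
  have "(1 - \<kappa>) * N \<ge> 0" using k N by simp
  then have G1: "G \<ge> 1" unfolding G by linarith
  have t1: "0 \<le> \<kappa>t" "\<kappa>t \<le> 1" using k G1 by (simp_all add: t field_simps)
  define K :: "('m \<Rightarrow> nat) \<Rightarrow> _" where "K = modes_kraus \<kappa>t G"
  \<comment> \<open>Both input labels are made free. Given \<open>L\<close>, a single pair
    contributes, so the total sum is the Gram entry, convergent by the square-summable rows of the
    dilation. Summing over \<open>L\<close> first gives the series that defines the tensor
    power.\<close>
  define f where "f = (\<lambda>((a, b), L). \<psi> (i, a) * cnj (\<psi> (j, b)) * of_real (K x L a * K y L b))"
  have K: "((\<lambda>L. K x L a * K y L b) has_sum (\<Prod>m\<in>UNIV. kraus_entry \<kappa>t G (a m) (b m) (x m) (y m))) UNIV" for a b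
    unfolding K_def modes_kraus_def prod.distrib[symmetric] kraus_entry_def
    by (intro has_sum_prod_UNIV has_sum_infsum kraus_mult_summable mult_nonneg_nonneg kraus_nonneg t1 G1)
  have f_row: "((\<lambda>L. f ((a, b), L)) has_sum \<psi> (i, a) * cnj (\<psi> (j, b)) *
      (\<Prod>m\<in>UNIV. thermal_loss \<kappa> N (outer (ket (a m)) (ket (b m))) (x m) (y m))) UNIV" for a b
    unfolding channel_entry_def[symmetric] channel_entry_kraus[OF k N G t] f_def prod.case of_real_prod[symmetric]
    by (intro has_sum_cmult_right has_sum_of_real K)
  define h where "h L = ((kraus_source x L, kraus_source y L), L)" for L
  have fh: "f (h L) = dilation \<psi> \<kappa>t G (i, x) L * cnj (dilation \<psi> \<kappa>t G (j, y) L)" for L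
    by (simp add: f_def h_def dilation_def K_def mult_ac)
  have f0: "f w = 0" if "w \<notin> range h" for w
  proof -
    obtain a b L where w: "w = ((a, b), L)" by (metis prod.exhaust)
    have "a \<noteq> kraus_source x L \<or> b \<noteq> kraus_source y L" using that by (auto simp: h_def w)
    then have "K x L a = 0 \<or> K y L b = 0" using modes_kraus_source unfolding K_def by blast
    then show ?thesis by (auto simp: f_def w)
  qed
  have inj: "inj h" by (auto simp: inj_on_def h_def)
  note rows = hs_rows(1)[OF hs]
  have "((\<lambda>L. dilation \<psi> \<kappa>t G (i, x) L * cnj (dilation \<psi> \<kappa>t G (j, y) L)) has_sum gram (dilation \<psi> \<kappa>t G) (i, x) (j, y)) UNIV"
    using ip_has_sum[OF rows[of "(j, y)"] rows[of "(i, x)"]] by (simp add: gram_ip mult.commute)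
  then have "(f has_sum gram (dilation \<psi> \<kappa>t G) (i, x) (j, y)) (range h)"
    by (subst has_sum_reindex[OF inj]) (simp add: o_def fh)
  then have "(f has_sum gram (dilation \<psi> \<kappa>t G) (i, x) (j, y)) UNIV"
    by (rule has_sum_cong_neutral[THEN iffD1, rotated -1]) (auto simp: f0)
  then have "(f has_sum gram (dilation \<psi> \<kappa>t G) (i, x) (j, y)) (UNIV \<times> UNIV)" by simp
  then have "((\<lambda>(a, b). \<psi> (i, a) * cnj (\<psi> (j, b)) *
      (\<Prod>m\<in>UNIV. thermal_loss \<kappa> N (outer (ket (a m)) (ket (b m))) (x m) (y m))) has_sum gram (dilation \<psi> \<kappa>t G) (i, x) (j, y)) UNIV"
    by (rule has_sum_SigmaD) (use f_row in \<open>auto split: prod.split\<close>)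
  then show "id_tensor_map (tensor_power_map (thermal_loss \<kappa> N)) (outer \<psi> \<psi>) ix jy = gram (dilation \<psi> \<kappa>t G) ix jy"
    by (simp add: e id_tensor_map_def tensor_power_map_def outer_def[of \<psi>] infsumI)
qed

section \<open>Grouping by total photon number and the final bound\<close>

lemma has_sum_total_number:
  fixes p :: "('m::finite \<Rightarrow> nat) \<Rightarrow> real"
  assumes "((\<lambda>a. p a * b ^ (\<Sum>k\<in>UNIV. a k)) has_sum S) UNIV"
  shows "(\<lambda>n. total_number_prob p n * b ^ n) sums S"
proof -
  define B where "B n = {a :: 'm \<Rightarrow> nat. (\<Sum>k\<in>UNIV. a k) = n}" for n
  have img: "snd ` (SIGMA n:UNIV. B n) = UNIV" by (force simp: B_def)
  have "((\<lambda>(n, a). p a * b ^ n) has_sum S) (SIGMA n:UNIV. B n)"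
  proof -
    have "((\<lambda>a. p a * b ^ (\<Sum>k\<in>UNIV. a k)) \<circ> snd has_sum S) (SIGMA n:UNIV. B n)"
      using assms by (subst has_sum_reindex[symmetric]) (auto simp: img inj_on_def B_def)
    then show ?thesis by (rule has_sum_cong[THEN iffD1, rotated]) (auto simp: B_def)
  qed
  then have "((\<lambda>n. \<Sum>a\<in>B n. p a * b ^ n) has_sum S) UNIV"
    by (rule has_sum_SigmaD) (auto intro!: has_sum_finite simp: B_def finite_total_number)
  then have "(\<lambda>n. \<Sum>a\<in>B n. p a * b ^ n) sums S" by (rule has_sum_imp_sums)
  then show ?thesis by (simp add: total_number_prob_def B_def sum_distrib_right)
qed

text \<open>The two geometric means lie below arithmetic means that add up to 1. Hence the powers of
  the bracket are at most 1 and the series in the bound is dominated by \<open>p\<close>.\<close>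

lemma overlap_base_bounds:
  assumes t: "0 \<le> \<kappa>t0" "\<kappa>t0 \<le> 1" "0 \<le> \<kappa>t1" "\<kappa>t1 \<le> (1::real)" and \<nu>: "0 \<le> \<nu>" "\<nu> \<le> 1"
  shows "0 \<le> \<nu> * sqrt (\<kappa>t0 * \<kappa>t1) + sqrt ((1 - \<kappa>t0) * (1 - \<kappa>t1))"
    "\<nu> * sqrt (\<kappa>t0 * \<kappa>t1) + sqrt ((1 - \<kappa>t0) * (1 - \<kappa>t1)) \<le> 1"
proof -
  show "0 \<le> \<nu> * sqrt (\<kappa>t0 * \<kappa>t1) + sqrt ((1 - \<kappa>t0) * (1 - \<kappa>t1))" using t \<nu> by simp
  have "\<nu> * sqrt (\<kappa>t0 * \<kappa>t1) \<le> 1 * sqrt (\<kappa>t0 * \<kappa>t1)" using t \<nu> by (intro mult_right_mono) auto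
  moreover have "sqrt (\<kappa>t0 * \<kappa>t1) \<le> (\<kappa>t0 + \<kappa>t1) / 2" using t by (intro arith_geo_mean_sqrt) auto
  moreover have "sqrt ((1 - \<kappa>t0) * (1 - \<kappa>t1)) \<le> ((1 - \<kappa>t0) + (1 - \<kappa>t1)) / 2"
    using t by (intro arith_geo_mean_sqrt) auto
  ultimately show "\<nu> * sqrt (\<kappa>t0 * \<kappa>t1) + sqrt ((1 - \<kappa>t0) * (1 - \<kappa>t1)) \<le> 1" by (simp add: field_simps)
qed

theorem mainTheorem1:
  fixes \<kappa>0 \<kappa>1 N0 N1 G0 G1 \<kappa>t0 \<kappa>t1 \<nu> :: real
    and p :: "('m::finite \<Rightarrow> nat) \<Rightarrow> real"
    and \<phi> :: "('m \<Rightarrow> nat) \<Rightarrow> 'i vec"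
    and \<Psi> \<tau>0 \<tau>1 :: "('i \<times> ('m \<Rightarrow> nat)) matrix"
  assumes "0 \<le> \<kappa>0" "\<kappa>0 \<le> 1" "0 \<le> \<kappa>1" "\<kappa>1 \<le> 1" "0 \<le> N0" "0 \<le> N1"
    and "\<And>n. 0 \<le> p n" "(p has_sum 1) UNIV"
    and "\<And>n. unit_vec (\<phi> n)"
    and "\<Psi> = outer (input_vec p \<phi>) (input_vec p \<phi>)"
    and "\<tau>0 = id_tensor_map (tensor_power_map (thermal_loss \<kappa>0 N0)) \<Psi>"
    and "\<tau>1 = id_tensor_map (tensor_power_map (thermal_loss \<kappa>1 N1)) \<Psi>"
    and "G0 = (1 - \<kappa>0) * N0 + 1" "G1 = (1 - \<kappa>1) * N1 + 1"
    and "\<kappa>t0 = \<kappa>0 / G0" "\<kappa>t1 = \<kappa>1 / G1"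
    and "\<nu> = 1 / (sqrt (G0 * G1) - sqrt ((G0 - 1) * (G1 - 1)))"
  shows "fidelity \<tau>0 \<tau>1 \<ge>
    \<nu> ^ CARD('m) * (\<Sum>n. total_number_prob p n *
      (\<nu> * sqrt (\<kappa>t0 * \<kappa>t1) + sqrt ((1 - \<kappa>t0) * (1 - \<kappa>t1))) ^ n)"
proof -
  define \<psi> where "\<psi> = input_vec p \<phi>"
  define br where "br = \<nu> * sqrt (\<kappa>t0 * \<kappa>t1) + sqrt ((1 - \<kappa>t0) * (1 - \<kappa>t1))"
  have gain: "g \<ge> 1" if "g = (1 - \<kappa>) * N + 1" "\<kappa> \<le> 1" "0 \<le> N" for g \<kappa> N :: real
    using that mult_nonneg_nonneg[of "1 - \<kappa>" N] by simp
  have G0: "G0 \<ge> 1" and G1: "G1 \<ge> 1" using gain assms by auto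
  have t: "0 \<le> \<kappa>t0" "\<kappa>t0 \<le> 1" "0 \<le> \<kappa>t1" "\<kappa>t1 \<le> 1"
    using assms(1-4) G0 G1 by (simp_all add: assms(15,16) field_simps)
  have inv: "0 \<le> 1 / d \<and> 1 / d \<le> 1" if "d \<ge> 1" for d :: real
    using that by simp
  have "0 \<le> \<nu>" "\<nu> \<le> 1" using inv[OF gain_gap[OF G0 G1]] unfolding assms(17) by blast+
  note br = overlap_base_bounds[OF t this, folded br_def]
  have \<psi>: "((\<lambda>i. (cmod (\<psi> (i, a)))\<^sup>2) has_sum p a) UNIV" for a
    using has_sum_cmult_right[OF assms(9)[unfolded unit_vec_def, of a], of "p a"] assms(7)[of a]
    by (simp add: \<psi>_def input_vec_entry norm_mult power_mult_distrib)
  \<comment> \<open>Unconditional convergence over all number states permits the later regrouping by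
    total number.\<close>
  have "(\<lambda>a. p a * br ^ (\<Sum>k\<in>UNIV. a k)) summable_on UNIV"
  proof (rule summable_on_comparison_test[of p])
    show "p summable_on UNIV" using assms(8) by (auto simp: summable_on_def)
    show "p a * br ^ (\<Sum>k\<in>UNIV. a k) \<le> p a" for a
      using mult_left_mono[OF power_le_one[OF br] assms(7)[of a]] by simp
  qed (use assms(7) br in simp)
  then obtain S where S: "((\<lambda>a. p a * br ^ (\<Sum>k\<in>UNIV. a k)) has_sum S) UNIV" by (auto simp: summable_on_def)
  have "((\<lambda>a. p a * (\<nu> ^ CARD('m) * br ^ (\<Sum>k\<in>UNIV. a k))) has_sum \<nu> ^ CARD('m) * S) UNIV"
    using has_sum_cmult_right[OF S, of "\<nu> ^ CARD('m)"] by (simp add: mult_ac)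
  then have "((\<lambda>(z, L). cnj (dilation \<psi> \<kappa>t0 G0 z L) * dilation \<psi> \<kappa>t1 G1 z L) has_sum of_real (\<nu> ^ CARD('m) * S)) UNIV"
    unfolding br_def by (rule dilation_overlap[OF t G0 G1 assms(17) \<psi>])
  then have ov: "ip (\<lambda>(z, L). dilation \<psi> \<kappa>t0 G0 z L) (\<lambda>(z, L). dilation \<psi> \<kappa>t1 G1 z L) = of_real (\<nu> ^ CARD('m) * S)"
    unfolding ip_def by (intro infsumI) (simp add: case_prod_unfold)
  have h0: "hs (dilation \<psi> \<kappa>t0 G0)" by (rule hs_dilation[OF t(1,2) G0 \<psi> assms(8)])
  have h1: "hs (dilation \<psi> \<kappa>t1 G1)" by (rule hs_dilation[OF t(3,4) G1 \<psi> assms(8)])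
  have "\<tau>0 = gram (dilation \<psi> \<kappa>t0 G0)"
    unfolding assms(10,11) \<psi>_def[symmetric] by (rule channel_output_gram[OF assms(1,2,5,13,15) h0])
  moreover have "\<tau>1 = gram (dilation \<psi> \<kappa>t1 G1)"
    unfolding assms(10,12) \<psi>_def[symmetric] by (rule channel_output_gram[OF assms(3,4,6,14,16) h1])
  ultimately have "cmod (of_real (\<nu> ^ CARD('m) * S)) \<le> fidelity \<tau>0 \<tau>1"
    using fidelity_ge_overlap[OF h0 h1] by (simp only: ov)
  moreover have "\<nu> ^ CARD('m) * S \<le> cmod (of_real (\<nu> ^ CARD('m) * S))"
    by (simp only: norm_of_real abs_ge_self)
  moreover have "(\<Sum>n. total_number_prob p n * br ^ n) = S"
    using has_sum_total_number[OF S] by (rule sums_unique[symmetric])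
  ultimately show ?thesis unfolding br_def by simp
qed

end
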